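(* Let $\alpha$ be a finite measure on $(\mathbb{R},\mathscr{B}(\mathbb{R}))$ with $a=\alpha(\mathbb{R})>0$ and $\int_{\mathbb{R}}\log(1+|x|)\,\alpha(dx)<+\infty$, let $\tilde\varphi$ be a Dirichlet process with parameter $\alpha$, let $\tilde V=\int_{\mathbb{R}}(x-\tilde\varphi(I))^2\,\tilde\varphi(dx)$ be its random variance, and let $g_{\tilde V}(t)=\mathscr{D}_\alpha(e^{-t\tilde V})$, $t\ge0$, be the moment generating function of $\tilde V$. (1) If the support of $\alpha$ is bounded, then for every $t\ge0$ $$g_{\tilde V}(t)=\frac{\Gamma(a)}{4\pi^{3/2}i}\int_{\mathbb{R}}e^{-y^2/4}\;\mathrm{PV}\!\int_{\gamma'_{y,t}-i\infty}^{\gamma'_{y,t}+i\infty}\frac{e^z}{z^a}\exp\left\{-\int_{\mathbb{R}}\log\left(1+\frac{tx^2-y\sqrt t\,x}{z}\right)\alpha(dx)\right\}dz\,dy,$$ where $\gamma'_{y,t}$ is any element of $(0,+\infty)$ satisfying $\gamma'_{y,t}>\sup_{x\in\mathrm{supp}(\alpha)}(y\sqrt t\,x-tx^2)$. (2) In general, for every $t\ge0$ $$g_{\tilde V}(t)=\frac{\Gamma(a)}{4\pi^{3/2}i}\lim_{k\to+\infty}\int_{\mathbb{R}}e^{-y^2/4}\;\mathrm{PV}\!\int_{\gamma'_{y,t}-i\infty}^{\gamma'_{y,t}+i\infty}\frac{e^z}{z^a}\exp\left\{-\int_{\mathbb{R}}\log\left(1+\frac{tx^2-y\sqrt t\,x}{z}\right)\alpha^{(k)}(dx)\right\}dz\,dy,$$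 where $\gamma'_{y,t}$ (which may depend on $k$) is any element of $(0,+\infty)$ satisfying $\gamma'_{y,t}>\sup_{x\in\mathrm{supp}(\alpha^{(k)})}(y\sqrt t\,x-tx^2)$.
   Context: A random probability measure $\tilde\varphi$ on $\mathbb{R}$ is a Dirichlet process with parameter $\alpha$ (law $\mathscr{D}_\alpha$) if, for every finite measurable partition $C_1,\ldots,C_{n+1}$ of $\mathbb{R}$, $(\tilde\varphi(C_1),\ldots,\tilde\varphi(C_n))$ has the Dirichlet distribution with parameter $(\alpha(C_1),\ldots,\alpha(C_{n+1}))$ (components with $\alpha(C_i)=0$ being a.s. $0$). $\mathscr{D}_\alpha(\cdot)$ also denotes expectation under $\mathscr{D}_\alpha$. $\tilde\varphi(I)=\int_{\mathbb{R}}x\,\tilde\varphi(dx)$; under the log-integrability condition $\tilde\varphi(I)$ and $\tilde V$ are finite a.s. For $k\in\mathbb{N}$ (positive integers), $$\alpha^{(k)}(\cdot)=\alpha((-\infty,-k])\,\delta_{-k}(\cdot)+\alpha(\cdot\cap(-k,k))+\alpha([k,+\infty))\,\delta_k(\cdot).$$ $\log$ is the principal logarithm ($\arg\in(-\pi,\pi]$), $z^a$ the principal power, and $\mathrm{PV}\int_{\gamma-i\infty}^{\gamma+i\infty}$ means $\lim_{R\to+\infty}\int_{\gamma-iR}^{\gamma+iR}$. *)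

theory Defs
  imports "HOL-Probability.Probability" "HOL-Complex_Analysis.Complex_Analysis"
begin

definition measure_support :: "real measure \<Rightarrow> real set" where
  "measure_support \<alpha> = {x. \<forall>U. open U \<longrightarrow> x \<in> U \<longrightarrow> emeasure \<alpha> U > 0}"

(* The density of (X_j) for j in J - {m} when (X_j) for j in J has the Dirichlet
   distribution with parameters p j > 0, so that X_m is one minus the sum of the others. *)
definition dirichlet_density ::
  "nat set \<Rightarrow> nat \<Rightarrow> (nat \<Rightarrow> real) \<Rightarrow> (nat \<Rightarrow> real) \<Rightarrow> real" where
  "dirichlet_density J m p x =
    (if (\<forall>j\<in>J - {m}. 0 < x j) \<and> (\<Sum>j\<in>J - {m}. x j) < 1
     then Gamma (\<Sum>j\<in>J. p j) / (\<Prod>j\<in>J. Gamma (p j)) *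
          (\<Prod>j\<in>J - {m}. x j powr (p j - 1)) * (1 - (\<Sum>j\<in>J - {m}. x j)) powr (p m - 1)
     else 0)"

(* Dirichlet distribution with parameter (p 0, ..., p n), as the law on R^n of the first n of
   the n + 1 components.  Parameters may vanish, but not all of them: components with parameter
   0 are 0, and the remaining ones (indexed by J) have the usual Dirichlet distribution.  The
   last index m of J plays the role of the component expressed through the others; in the
   nondegenerate case J = {..n} and m = n. *)
definition dirichlet_distribution :: "nat \<Rightarrow> (nat \<Rightarrow> real) \<Rightarrow> (nat \<Rightarrow> real) measure" where
  "dirichlet_distribution n p =
    (let J = {i. i \<le> n \<and> 0 < p i}; m = Max J in
     distr (density (PiM (J - {m}) (\<lambda>_. lborel)) (\<lambda>x. ennreal (dirichlet_density J m p x)))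
       (PiM {..<n} (\<lambda>_. borel))
       (\<lambda>x. \<lambda>i\<in>{..<n}. if i = m then 1 - (\<Sum>j\<in>J - {m}. x j) else if i \<in> J then x i else 0))"

(* The partitions C 0, ..., C n may contain empty sets; these have parameter 0. *)
definition dirichlet_process ::
  "'w measure \<Rightarrow> real measure \<Rightarrow> ('w \<Rightarrow> real measure) \<Rightarrow> bool" where
  "dirichlet_process M \<alpha> \<phi> \<longleftrightarrow>
    \<phi> \<in> M \<rightarrow>\<^sub>M prob_algebra borel \<and>
    (\<forall>n C. (\<forall>i\<le>n. C i \<in> sets borel) \<longrightarrow> disjoint_family_on C {..n} \<longrightarrow> (\<Union>i\<le>n. C i) = UNIV \<longrightarrow>
      distr M (PiM {..<n} (\<lambda>_. borel)) (\<lambda>\<omega>. \<lambda>i\<in>{..<n}. measure (\<phi> \<omega>) (C i)) =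
      dirichlet_distribution n (\<lambda>i. measure \<alpha> (C i)))"

definition random_mean :: "('w \<Rightarrow> real measure) \<Rightarrow> 'w \<Rightarrow> real" where
  "random_mean \<phi> \<omega> = (\<integral>x. x \<partial>\<phi> \<omega>)"

definition random_variance :: "('w \<Rightarrow> real measure) \<Rightarrow> 'w \<Rightarrow> real" where
  "random_variance \<phi> \<omega> = (\<integral>x. (x - random_mean \<phi> \<omega>)\<^sup>2 \<partial>\<phi> \<omega>)"

definition variance_mgf :: "'w measure \<Rightarrow> ('w \<Rightarrow> real measure) \<Rightarrow> real \<Rightarrow> real" where
  "variance_mgf M \<phi> t = (\<integral>\<omega>. exp (- t * random_variance \<phi> \<omega>) \<partial>M)"

definition truncated_measure :: "real measure \<Rightarrow> nat \<Rightarrow> real measure" where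
  "truncated_measure \<alpha> k = measure_of UNIV (sets borel)
    (\<lambda>B. emeasure \<alpha> {..- real k} * emeasure (return borel (- real k)) B
        + emeasure \<alpha> (B \<inter> {- real k<..<real k})
        + emeasure \<alpha> {real k..} * emeasure (return borel (real k)) B)"

lemma sets_truncated_measure [simp, measurable_cong]:
  "sets (truncated_measure \<alpha> k) = sets borel"
  unfolding truncated_measure_def using sets.sigma_sets_eq[of "borel :: real measure"]
  by simp

lemma emeasure_truncated_measure:
  assumes "sets \<alpha> = sets borel" and B: "B \<in> sets borel"
  shows "emeasure (truncated_measure \<alpha> k) B =
      emeasure \<alpha> {..- real k} * emeasure (return borel (- real k)) B
        + emeasure \<alpha> (B \<inter> {- real k<..<real k})
        + emeasure \<alpha> {real k..} * emeasure (return borel (real k)) B"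
    (is "_ = ?F B")
proof (rule emeasure_measure_of[OF truncated_measure_def])
  show "positive (sets (truncated_measure \<alpha> k)) ?F"
    by (simp add: positive_def)
  show "countably_additive (sets (truncated_measure \<alpha> k)) ?F"
  proof (rule countably_additiveI)
    fix A :: "nat \<Rightarrow> real set"
    assume "range A \<subseteq> sets (truncated_measure \<alpha> k)" and dj: "disjoint_family A"
    then have A: "range A \<subseteq> sets borel" by simp
    let ?I = "{- real k<..<real k}"
    have ret: "(\<Sum>i. emeasure (return borel c) (A i)) = emeasure (return borel c) (\<Union>i. A i)"
      for c :: real
      using A dj by (intro suminf_emeasure) auto
    have mid: "(\<Sum>i. emeasure \<alpha> (A i \<inter> ?I)) = emeasure \<alpha> (\<Union>i. A i \<inter> ?I)"
    proof (rule suminf_emeasure)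
      show "range (\<lambda>i. A i \<inter> ?I) \<subseteq> sets \<alpha>" using A assms(1) by auto
      show "disjoint_family (\<lambda>i. A i \<inter> ?I)" using dj by (auto simp: disjoint_family_on_def)
    qed
    show "(\<Sum>i. ?F (A i)) = ?F (\<Union>i. A i)"
      by (simp only: suminf_add[symmetric, OF summableI summableI] ennreal_suminf_cmult
          ret mid Int_UN_distrib2 UN_simps)
  qed
qed (use B in auto)

(* PV of the integral of f along the vertical line with real part c *)
definition has_pv_vertical_integral :: "(complex \<Rightarrow> complex) \<Rightarrow> complex \<Rightarrow> real \<Rightarrow> bool" where
  "has_pv_vertical_integral f l c \<longleftrightarrow>
    (\<forall>R>0. f contour_integrable_on linepath (Complex c (- R)) (Complex c R)) \<and>
    ((\<lambda>R. contour_integral (linepath (Complex c (- R)) (Complex c R)) f) \<longlongrightarrow> l) at_top"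

definition pv_vertical_integral :: "(complex \<Rightarrow> complex) \<Rightarrow> real \<Rightarrow> complex" where
  "pv_vertical_integral f c =
    Lim at_top (\<lambda>R. contour_integral (linepath (Complex c (- R)) (Complex c R)) f)"

definition inversion_kernel ::
  "real measure \<Rightarrow> real \<Rightarrow> real \<Rightarrow> real \<Rightarrow> complex \<Rightarrow> complex" where
  "inversion_kernel \<alpha> a t y z =
    exp z / z powr complex_of_real a *
    exp (- (\<integral>x. Ln (1 + complex_of_real (t * x\<^sup>2 - y * sqrt t * x) / z) \<partial>\<alpha>))"

definition admissible_abscissa :: "real measure \<Rightarrow> real \<Rightarrow> real \<Rightarrow> real \<Rightarrow> bool" where
  "admissible_abscissa \<alpha> t y c \<longleftrightarrow>
    0 < c \<and> (SUP x\<in>measure_support \<alpha>. y * sqrt t * x - t * x\<^sup>2) < c"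

definition gaussian_inversion_integrand ::
  "real measure \<Rightarrow> real \<Rightarrow> real \<Rightarrow> (real \<Rightarrow> real) \<Rightarrow> real \<Rightarrow> complex" where
  "gaussian_inversion_integrand \<alpha> a t \<gamma> y =
    complex_of_real (exp (- y\<^sup>2 / 4)) * pv_vertical_integral (inversion_kernel \<alpha> a t y) (\<gamma> y)"

end

theory Submission
  imports Defs
begin

text \<open>
  Write \<open>m\<close> and \<open>q\<close> for the first two moments of the random measure \<open>\<phi>\<close>, so that its
  variance is \<open>q - m\<^sup>2\<close>.  The square in \<open>exp (- t (q - m\<^sup>2)) = exp (t m\<^sup>2 - t q)\<close> is linearised by a
  Gaussian integral,
    \<open>2 sqrt \<pi> exp (t m\<^sup>2 - t q) = \<integral> exp (- y\<^sup>2/4) exp (y sqrt t m - t q) dy\<close>,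
  and the second exponent is the mean \<open>\<phi>(h)\<close> of the single function \<open>h(x) = y sqrt t x - t x\<^sup>2\<close>
  (lemma \<open>gaussian_linear_integral\<close>).  After Fubini, what is needed is the moment
  generating function \<open>E exp \<phi>(h)\<close> of a linear functional of a Dirichlet process.

  The Markov-Krein identity \<open>E (z - \<phi>(h)) powr -a = exp (- \<integral> Ln (z - h) d\<alpha>)\<close> is accessible.  For
  a simple positive function on a partition it is the classical Dirichlet integral, which follows by
  writing \<open>\<Gamma>(a) w powr -a\<close> as a Laplace integral: the Dirichlet weights then turn into
  independent Gamma variables (\<open>dirichlet_integral\<close>).  Bounded positive functions follow by
  approximation (\<open>markov_krein_real\<close>), complex \<open>z\<close> by analytic continuation
  (\<open>markov_krein_complex\<close>).

  Hankel's integral, the principal value of \<open>\<integral> e^w w powr -a dw\<close> on a vertical line being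
  \<open>2 \<pi> \<i> / \<Gamma>(a)\<close>, recovers the exponential from the power.  With a primitive \<open>Q\<close> of the
  integrand on the right half-plane, the expectation of \<open>e^Y Q(z - Y)\<close>, \<open>Y = \<phi>(h)\<close>, is a primitive of
  \<open>e^z E (z - Y) powr -a\<close>, and the latter is the inversion kernel.  Contour integrals are therefore
  expectations of differences of \<open>Q\<close>, and these differences converge uniformly for \<open>Y\<close> in a
  bounded set; this handles the merely conditional convergence for \<open>a \<le> 1\<close>
  (\<open>hankel_primitive\<close>, \<open>pv_integral_exp_mean\<close>).

  For unbounded support, truncating \<open>\<alpha>\<close> amounts to pushing both \<open>\<alpha>\<close> and \<open>\<phi>\<close> forward
  along a clamping map, and Dirichlet processes are stable under push-forward.  Log-integrability of
  \<open>\<alpha>\<close> makes the second moment of \<open>\<phi>\<close> almost surely finite, again by the Markov-Krein identity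
  (\<open>AE_integrable_of_log_integrable\<close>), so the variances of the truncated processes converge
  to that of \<open>\<phi>\<close>, and by dominated convergence so do their moment generating functions.
\<close>

section \<open>Integrals depending holomorphically on a parameter\<close>

text \<open>
  The mean value inequality on the ball bounds the difference quotients by the bound for the
  derivative, so dominated convergence applies to them.
\<close>
lemma has_field_derivative_integral:
  fixes f f' :: "complex \<Rightarrow> 'a \<Rightarrow> complex"
  assumes e: "0 < e"
    and df: "\<And>w x. w \<in> ball z e \<Longrightarrow> x \<in> space M \<Longrightarrow> ((\<lambda>w. f w x) has_field_derivative f' w x) (at w)"
    and int: "\<And>w. w \<in> ball z e \<Longrightarrow> integrable M (f w)"
    and meas: "f' z \<in> borel_measurable M"
    and bound: "\<And>w x. w \<in> ball z e \<Longrightarrow> x \<in> space M \<Longrightarrow> norm (f' w x) \<le> g x"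
    and g: "integrable M g"
  shows "((\<lambda>w. \<integral>x. f w x \<partial>M) has_field_derivative (\<integral>x. f' z x \<partial>M)) (at z)"
proof -
  have "((\<lambda>w. ((\<integral>x. f w x \<partial>M) - (\<integral>x. f z x \<partial>M)) / (w - z)) \<longlongrightarrow> (\<integral>x. f' z x \<partial>M)) (at z within ball z e)"
    unfolding tendsto_at_iff_sequentially comp_def
  proof (intro allI impI)
    fix X assume X: "\<forall>i. X i \<in> ball z e - {z}" and lim: "X \<longlonglongrightarrow> z"
    have z: "z \<in> ball z e" using e by simp
    have "(\<lambda>i. \<integral>x. (f (X i) x - f z x) / (X i - z) \<partial>M) \<longlonglongrightarrow> (\<integral>x. f' z x \<partial>M)"
    proof (rule integral_dominated_convergence[where w = g])
      show "(\<lambda>x. (f (X i) x - f z x) / (X i - z)) \<in> borel_measurable M" for i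
        using int[OF z] int[of "X i"] X by (auto intro!: borel_measurable_divide borel_measurable_diff)
      show "AE x in M. (\<lambda>i. (f (X i) x - f z x) / (X i - z)) \<longlonglongrightarrow> f' z x"
      proof (rule AE_I2)
        fix x assume "x \<in> space M"
        from df[OF z this] have "((\<lambda>w. (f w x - f z x) / (w - z)) \<longlongrightarrow> f' z x) (at z)"
          by (simp add: has_field_derivative_iff)
        then have "((\<lambda>w. (f w x - f z x) / (w - z)) \<circ> X) \<longlonglongrightarrow> f' z x"
          using X lim unfolding tendsto_at_iff_sequentially by auto
        then show "(\<lambda>i. (f (X i) x - f z x) / (X i - z)) \<longlonglongrightarrow> f' z x" by (simp add: comp_def)
      qed
      show "AE x in M. norm ((f (X i) x - f z x) / (X i - z)) \<le> g x" for i
      proof (rule AE_I2)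
        fix x assume x: "x \<in> space M"
        have "norm (f (X i) x - f z x) \<le> g x * norm (X i - z)"
          by (rule field_differentiable_bound[where S = "ball z e" and f' = "\<lambda>w. f' w x"])
            (use X x z bound df in \<open>auto intro: has_field_derivative_at_within\<close>)
        moreover have "norm (X i - z) > 0" using X by auto
        ultimately show "norm ((f (X i) x - f z x) / (X i - z)) \<le> g x"
          by (simp add: norm_divide field_simps)
      qed
    qed (use meas g in auto)
    moreover have eq: "(\<integral>x. (f (X i) x - f z x) / (X i - z) \<partial>M) = ((\<integral>x. f (X i) x \<partial>M) - (\<integral>x. f z x \<partial>M)) / (X i - z)" for i
      using int[OF z] int[of "X i"] X by (cases "X i = z") (auto simp: Bochner_Integration.integral_diff)
    ultimately show "(\<lambda>i. ((\<integral>x. f (X i) x \<partial>M) - (\<integral>x. f z x \<partial>M)) / (X i - z)) \<longlonglongrightarrow> (\<integral>x. f' z x \<partial>M)"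
      by (simp only: eq)
  qed
  then have "((\<lambda>w. \<integral>x. f w x \<partial>M) has_field_derivative (\<integral>x. f' z x \<partial>M)) (at z within ball z e)"
    by (simp add: has_field_derivative_iff)
  then show ?thesis using e by (simp add: at_within_open[of z "ball z e"])
qed

text \<open>
  Both the complex Gamma integral and the complex Markov-Krein identity are obtained from their real
  versions through this instance of the identity theorem.
\<close>
lemma holomorphic_eq_on_halfplane:
  assumes f: "f holomorphic_on {z. s < Re z}" and g: "g holomorphic_on {z. s < Re z}"
    and eq: "\<And>x. s < x \<Longrightarrow> f (complex_of_real x) = g (complex_of_real x)" and z: "s < Re z"
  shows "f z = g z"
proof -
  let ?H = "{z. s < Re z}"
  have "(\<lambda>z. f z - g z) holomorphic_on ?H" using f g by (intro holomorphic_intros)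
  moreover have op: "open ?H" by (rule open_halfspace_Re_gt)
  moreover have "connected ?H" by (intro convex_connected convex_halfspace_Re_gt)
  moreover have "of_real ` {s<..} \<subseteq> ?H" by auto
  moreover have "complex_of_real (s+1) \<in> ?H" by simp
  moreover have "complex_of_real (s+1) islimpt of_real ` {s<..}"
    unfolding islimpt_approachable
  proof (intro allI impI)
    fix e :: real assume "e > 0"
    then have "complex_of_real (s+1+e/2) \<in> of_real ` {s<..}" by (intro imageI) simp
    moreover have "complex_of_real (s+1+e/2) - complex_of_real (s+1) = complex_of_real (e/2)"
      by (simp flip: of_real_diff)
    then have "complex_of_real (s+1+e/2) \<noteq> complex_of_real (s+1)"
      and "dist (complex_of_real (s+1+e/2)) (complex_of_real (s+1)) < e"
      using \<open>e > 0\<close> by (auto simp: dist_norm)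
    ultimately show "\<exists>x'\<in>of_real ` {s<..}. x' \<noteq> complex_of_real (s+1) \<and> dist x' (complex_of_real (s+1)) < e"
      by blast
  qed
  moreover have "f z - g z = 0" if "z \<in> of_real ` {s<..}" for z using that eq by auto
  ultimately have "f z - g z = 0"
    by (rule analytic_continuation[where S = ?H]) (use z in auto)
  then show ?thesis by simp
qed

lemma nn_integral_gamma_scaled:
  assumes "0 < b" "0 < (x::real)"
  shows "(\<integral>\<^sup>+s. ennreal (indicator {0<..} s * s powr (b - 1) * exp (- (x * s))) \<partial>lborel) = ennreal (Gamma b * x powr (-b))"
proof -
  let ?I = "\<integral>\<^sup>+s. ennreal (indicator {0<..} s * s powr (b - 1) * exp (- (x * s))) \<partial>lborel"
  have "ennreal (Gamma b) = (\<integral>\<^sup>+s. ennreal (indicator {0..} s * s powr (b - 1) / exp s) \<partial>lborel)"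
    by (rule Gamma_conv_nn_integral_real[OF assms(1)])
  also have "\<dots> = \<bar>x\<bar> * (\<integral>\<^sup>+s. ennreal (indicator {0..} (0 + x * s) * (0 + x * s) powr (b - 1) / exp (0 + x * s)) \<partial>lborel)"
    using assms by (intro nn_integral_real_affine) auto
  also have "(\<integral>\<^sup>+s. ennreal (indicator {0..} (0 + x * s) * (0 + x * s) powr (b - 1) / exp (0 + x * s)) \<partial>lborel) =
    (\<integral>\<^sup>+s. ennreal (x powr (b - 1)) * ennreal (indicator {0<..} s * s powr (b - 1) * exp (- (x * s))) \<partial>lborel)"
    using assms by (intro nn_integral_cong)
      (auto simp: indicator_def powr_mult exp_minus field_simps zero_le_mult_iff simp flip: ennreal_mult')
  also have "\<dots> = ennreal (x powr (b - 1)) * ?I" by (intro nn_integral_cmult) auto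
  also have "ennreal \<bar>x\<bar> * (ennreal (x powr (b - 1)) * ?I) = ennreal (x powr b) * ?I"
    using assms by (simp add: mult.assoc[symmetric] ennreal_mult'[symmetric] powr_mult_base)
  finally have G: "ennreal (Gamma b) = ennreal (x powr b) * ?I" .
  have "ennreal (Gamma b * x powr (-b)) = ennreal (x powr (-b)) * ennreal (Gamma b)"
    by (simp add: ennreal_mult'' mult.commute)
  also have "\<dots> = ennreal (x powr (-b)) * ennreal (x powr b) * ?I" by (simp add: G mult.assoc)
  also have "ennreal (x powr (-b)) * ennreal (x powr b) = 1"
    using assms by (simp flip: ennreal_mult' powr_add)
  finally show ?thesis by simp
qed

lemma has_bochner_integral_gamma_scaled:
  assumes "0 < b" "0 < (x::real)"
  shows "has_bochner_integral lborel (\<lambda>s. indicator {0<..} s * s powr (b - 1) * exp (- (x * s))) (Gamma b * x powr (-b))"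
  by (rule has_bochner_integral_nn_integral)
    (use nn_integral_gamma_scaled[OF assms] assms Gamma_real_pos[of b] in \<open>auto simp: less_imp_le\<close>)

text \<open>
  For real \<open>w\<close> this is a rescaled Gamma integral; both sides are holomorphic in \<open>w\<close>.
\<close>
lemma gamma_integral_complex:
  fixes w :: complex
  assumes b: "0 < b" and w: "0 < Re w"
  shows "integrable lborel (\<lambda>s. complex_of_real (indicator {0<..} s * s powr (b - 1)) * exp (- (w * of_real s)))" (is ?A)
    and "(\<integral>s. complex_of_real (indicator {0<..} s * s powr (b - 1)) * exp (- (w * of_real s)) \<partial>lborel) = of_real (Gamma b) * w powr (- of_real b)" (is ?B)
proof -
  define f where "f w s = complex_of_real (indicator {0<..} s * s powr (b - 1)) * exp (- (w * of_real s))" for w s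
  define f' where "f' w s = - complex_of_real s * f w s" for w s
  have [measurable]: "f w \<in> borel_measurable borel" for w unfolding f_def by measurable
  have nf: "norm (f w s) = indicator {0<..} s * s powr (b - 1) * exp (- (Re w * s))" for w s
    by (simp add: f_def norm_mult)
  have int: "integrable lborel (f w)" if "0 < Re w" for w
    by (rule Bochner_Integration.integrable_bound[OF integrable.intros[OF has_bochner_integral_gamma_scaled[OF b that]]])
      (simp_all add: nf)
  then show ?A using w by (simp add: f_def[abs_def])
  have "(\<integral>s. f w s \<partial>lborel) = of_real (Gamma b) * w powr (- of_real b)"
  proof (rule holomorphic_eq_on_halfplane[OF _ _ _ w])
    show "(\<lambda>w. of_real (Gamma b) * w powr (- of_real b)) holomorphic_on {z. 0 < Re z}"
      by (intro holomorphic_intros) (auto simp: complex_nonpos_Reals_iff)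
    show "(\<lambda>w. \<integral>s. f w s \<partial>lborel) holomorphic_on {z. 0 < Re z}"
    proof (subst holomorphic_on_open, rule open_halfspace_Re_gt, safe)
      fix z :: complex assume z: "0 < Re z"
      have "((\<lambda>w. \<integral>s. f w s \<partial>lborel) has_field_derivative (\<integral>s. f' z s \<partial>lborel)) (at z)"
      proof (rule has_field_derivative_integral[where e = "Re z / 2"])
        show "0 < Re z / 2" using z by simp
        have R: "Re z / 2 < Re w" if "w \<in> ball z (Re z / 2)" for w
          using that abs_Re_le_cmod[of "z - w"] by (auto simp: dist_norm)
        show "integrable lborel (f w)" if "w \<in> ball z (Re z / 2)" for w
          using R[OF that] z by (intro int) auto
        show "((\<lambda>w. f w s) has_field_derivative f' w s) (at w)" for w s
          unfolding f_def f'_def by (auto intro!: derivative_eq_intros)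
        show "f' z \<in> borel_measurable lborel" unfolding f'_def by measurable
        show "integrable lborel (\<lambda>s. indicator {0<..} s * s powr (b + 1 - 1) * exp (- (Re z / 2 * s)))"
          by (rule integrable.intros[OF has_bochner_integral_gamma_scaled]) (use b z in auto)
        show "norm (f' w s) \<le> indicator {0<..} s * s powr (b + 1 - 1) * exp (- (Re z / 2 * s))"
          if "w \<in> ball z (Re z / 2)" for w s
        proof (cases "s > 0")
          case True
          then have "norm (f' w s) = s powr b * exp (- (Re w * s))"
            by (simp add: f'_def norm_mult nf powr_mult_base)
          also have "\<dots> \<le> s powr b * exp (- (Re z / 2 * s))"
            using True R[OF that] by (intro mult_left_mono) auto
          finally show ?thesis using True by simp
        qed (simp add: f'_def f_def)
      qed
      then show "\<exists>f'. ((\<lambda>w. \<integral>s. f w s \<partial>lborel) has_field_derivative f') (at z)" ..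
    qed
    fix x :: real assume x: "0 < x"
    have "(\<integral>s. f (of_real x) s \<partial>lborel) = (\<integral>s. complex_of_real (indicator {0<..} s * s powr (b - 1) * exp (- (x * s))) \<partial>lborel)"
      by (simp add: f_def exp_of_real flip: of_real_mult of_real_minus)
    also have "\<dots> = of_real (Gamma b * x powr (-b))"
      using has_bochner_integral_gamma_scaled[OF b x] by (simp only: integral_complex_of_real has_bochner_integral_integral_eq)
    also have "\<dots> = of_real (Gamma b) * of_real x powr (- of_real b)"
      using x by (simp add: powr_of_real flip: of_real_minus)
    finally show "(\<integral>s. f (of_real x) s \<partial>lborel) = of_real (Gamma b) * of_real x powr (- of_real b)" .
  qed
  then show ?B by (simp add: f_def)
qed

section \<open>Hankel's inversion integral for the Gamma function\<close>

lemma norm_exp_powr_line: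
  assumes "w \<noteq> 0"
  shows "norm (exp w * w powr (- complex_of_real b)) = exp (Re w) * norm w powr (- b)"
  using norm_powr_real_powr'[of "- complex_of_real b" w] by (simp add: norm_mult)

text \<open>
  The condition \<open>2 \<le> b\<close> is convenient for comparison with \<open>1 / (1 + v\<^sup>2)\<close>; smaller exponents
  are reached later by integration by parts.
\<close>
lemma integrable_exp_powr_line:
  assumes "2 \<le> b"
  shows "integrable lborel (\<lambda>v. exp (Complex 1 v) * Complex 1 v powr (- complex_of_real b))"
proof (rule Bochner_Integration.integrable_bound)
  have "integrable lborel (\<lambda>x::real. inverse (1 + x^2))"
    using integrable_inverse_1_plus_square by (simp add: set_integrable_def)
  then show "integrable lborel (\<lambda>x::real. exp 1 * inverse (1 + x^2))" by simp
  show "(\<lambda>v. exp (Complex 1 v) * Complex 1 v powr (- complex_of_real b)) \<in> borel_measurable lborel"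
    by (simp add: Complex_eq)
  show "AE v in lborel. norm (exp (Complex 1 v) * Complex 1 v powr (- complex_of_real b)) \<le> norm (exp 1 * inverse (1 + v^2))"
  proof (rule AE_I2)
    fix v :: real
    have "sqrt (1 + v\<^sup>2) powr (- b) \<le> sqrt (1 + v\<^sup>2) powr (- 2)"
      using assms by (intro powr_mono) auto
    also have "\<dots> = inverse (sqrt (1 + v\<^sup>2) ^ 2)"
      by (subst powr_minus, subst powr_numeral) (auto simp: add_nonneg_eq_0_iff)
    also have "\<dots> = inverse (1 + v\<^sup>2)" by simp
    finally show "norm (exp (Complex 1 v) * Complex 1 v powr (- complex_of_real b)) \<le> norm (exp 1 * inverse (1 + v^2))"
      by (subst norm_exp_powr_line) (auto simp: complex_eq_iff cmod_def)
  qed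
qed

lemma gamma_weight_bound:
  fixes s b :: real
  assumes "1 < b"
  shows "indicator {0<..} s * s powr (b - 1) * exp (1 - s) \<le> exp 1 * (b - 1) powr (b - 1)"
proof (cases "s > 0")
  case True
  have "s / (b - 1) \<le> exp (s / (b - 1))" using exp_ge_add_one_self[of "s / (b - 1)"] by linarith
  then have "(s / (b - 1)) powr (b - 1) \<le> exp (s / (b - 1)) powr (b - 1)"
    using True assms by (intro powr_mono2) auto
  also have "\<dots> = exp s" using assms by (simp add: exp_powr_real)
  finally have "s powr (b - 1) \<le> (b - 1) powr (b - 1) * exp s"
    using True assms by (simp add: powr_divide field_simps)
  then have "s powr (b - 1) * exp (1 - s) \<le> (b - 1) powr (b - 1) * exp s * exp (1 - s)"
    by (intro mult_right_mono) auto
  also have "\<dots> = exp 1 * (b - 1) powr (b - 1)" by (simp add: exp_diff)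
  finally show ?thesis using True by simp
qed simp

text \<open>
  With a Gaussian factor the order of integration can be exchanged after \<open>w powr -b\<close> is replaced by
  its Laplace integral.  The inner integral is then the characteristic function of a normal
  distribution, which concentrates at the point \<open>s = 1\<close> as \<open>e\<close> tends to 0; the right-hand side is
  written in the variable \<open>x\<close> with \<open>s = 1 + e x\<close>.
\<close>
lemma gaussian_regularised_hankel:
  assumes b: "1 < b" and e: "0 < e"
  shows "of_real (Gamma b) * (\<integral>v. exp (- (e * v)\<^sup>2 / 2) *\<^sub>R (exp (Complex 1 v) * Complex 1 v powr (- of_real b)) \<partial>lborel)
    = of_real (sqrt (2 * pi) * (\<integral>x. indicator {0<..} (1 + e * x) * (1 + e * x) powr (b - 1) * exp (- (e * x)) * exp (- x\<^sup>2 / 2) \<partial>lborel))"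
proof -
  let ?N = "std_normal_distribution"
  interpret N: real_distribution ?N by (rule real_dist_normal_dist)
  interpret P: pair_sigma_finite ?N lborel by unfold_locales
  define k where "k s = indicator {0<..} s * s powr (b - 1)" for s :: real
  define G where "G v = exp (Complex 1 v) * Complex 1 v powr (- of_real b)" for v
  define F where "F u s = exp (Complex 1 (u / e)) * (complex_of_real (k s) * exp (- (Complex 1 (u / e) * of_real s)))" for u s
  have [measurable]: "k \<in> borel_measurable borel" unfolding k_def by measurable
  have [measurable]: "(\<lambda>p. F (fst p) (snd p)) \<in> borel_measurable (borel \<Otimes>\<^sub>M borel)"
    unfolding F_def Complex_eq by measurable
  have intF: "integrable lborel (F u)" for u
    unfolding F_def k_def using gamma_integral_complex(1)[of b "Complex 1 (u/e)"] b by (intro integrable_mult_right) auto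
  have intF': "(\<integral>s. F u s \<partial>lborel) = of_real (Gamma b) * G (u / e)" for u
    unfolding F_def k_def using gamma_integral_complex(2)[of b "Complex 1 (u/e)"] b
    by (subst integral_mult_right_zero) (simp add: G_def)
  have Feq: "F u s = of_real (k s * exp (1 - s)) * iexp (u * ((1 - s) / e))" for u s
  proof -
    have "F u s = of_real (k s) * exp (Complex 1 (u / e) - Complex 1 (u / e) * of_real s)"
      by (simp add: F_def exp_diff exp_minus divide_inverse mult_ac)
    also have "Complex 1 (u / e) - Complex 1 (u / e) * of_real s = of_real (1 - s) + \<i> * of_real (u * ((1 - s) / e))"
      using e by (simp add: complex_eq_iff field_simps)
    also have "exp (of_real (1 - s) + \<i> * of_real (u * ((1 - s) / e))) = of_real (exp (1 - s)) * iexp (u * ((1 - s) / e))"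
      by (simp only: exp_add exp_of_real)
    finally show ?thesis by (simp only: of_real_mult mult.assoc)
  qed
  have char_normal: "(\<integral>u. exp (\<i> * (of_real u * of_real x)) \<partial>?N) = of_real (exp (- x\<^sup>2 / 2))" for x :: real
    using fun_cong[OF char_std_normal_distribution, of x] by (simp add: char_def mult.commute)
  have "(\<integral>u. (\<integral>s. F u s \<partial>lborel) \<partial>?N) = (\<integral>s. (\<integral>u. F u s \<partial>?N) \<partial>lborel)"
  proof (rule P.Fubini_integral[symmetric])
    show "integrable (?N \<Otimes>\<^sub>M lborel) (case_prod F)"
    proof (rule P.Fubini_integrable)
      show "case_prod F \<in> borel_measurable (?N \<Otimes>\<^sub>M lborel)" by (simp add: case_prod_beta' cong: measurable_cong_sets)
      show "AE u in ?N. integrable lborel (\<lambda>s. case_prod F (u, s))" using intF by simp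
      have "norm (F u s) = k s * exp (1 - s)" for u s
        by (simp add: Feq norm_mult k_def)
      then show "integrable ?N (\<lambda>u. \<integral>s. norm (case_prod F (u, s)) \<partial>lborel)" by simp
    qed
  qed
  also have "(\<integral>u. (\<integral>s. F u s \<partial>lborel) \<partial>?N) = of_real (Gamma b) * (\<integral>u. std_normal_density u *\<^sub>R G (u / e) \<partial>lborel)"
    unfolding intF' by (subst integral_mult_right_zero, subst integral_density) (auto simp: G_def Complex_eq)
  also have "(\<integral>u. std_normal_density u *\<^sub>R G (u / e) \<partial>lborel) = \<bar>e\<bar> *\<^sub>R (\<integral>v. std_normal_density (0 + e * v) *\<^sub>R G ((0 + e * v) / e) \<partial>lborel)"
    using e by (intro lborel_integral_real_affine) auto
  also have "(\<integral>v. std_normal_density (0 + e * v) *\<^sub>R G ((0 + e * v) / e) \<partial>lborel) = (\<integral>v. (1 / sqrt (2 * pi)) *\<^sub>R (exp (- (e * v)\<^sup>2 / 2) *\<^sub>R G v) \<partial>lborel)"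
    using e by (simp add: std_normal_density_def)
  also have "\<dots> = (1 / sqrt (2 * pi)) *\<^sub>R (\<integral>v. exp (- (e * v)\<^sup>2 / 2) *\<^sub>R G v \<partial>lborel)" by (rule integral_scaleR_right)
  also have "(\<integral>s. (\<integral>u. F u s \<partial>?N) \<partial>lborel) = (\<integral>s. of_real (k s * exp (1 - s) * exp (- ((1 - s) / e)\<^sup>2 / 2)) \<partial>lborel)"
    by (simp only: Feq integral_mult_right_zero char_normal of_real_mult)
  also have "\<dots> = of_real (\<integral>s. k s * exp (1 - s) * exp (- ((1 - s) / e)\<^sup>2 / 2) \<partial>lborel)"
    by (rule integral_complex_of_real)
  also have "(\<integral>s. k s * exp (1 - s) * exp (- ((1 - s) / e)\<^sup>2 / 2) \<partial>lborel) =
     \<bar>e\<bar> *\<^sub>R (\<integral>x. k (1 + e * x) * exp (1 - (1 + e * x)) * exp (- ((1 - (1 + e * x)) / e)\<^sup>2 / 2) \<partial>lborel)"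
    using e by (intro lborel_integral_real_affine) auto
  also have "(\<integral>x. k (1 + e * x) * exp (1 - (1 + e * x)) * exp (- ((1 - (1 + e * x)) / e)\<^sup>2 / 2) \<partial>lborel)
    = (\<integral>x. k (1 + e * x) * exp (- (e * x)) * exp (- x\<^sup>2 / 2) \<partial>lborel)"
    using e by simp
  finally show ?thesis using e unfolding k_def[symmetric] G_def[symmetric]
    by (simp add: scaleR_conv_of_real field_simps)
qed

text \<open>
  Removing the regularisation: each side converges by dominated convergence, using
  \<open>gamma_weight_bound\<close> on the Gaussian side.
\<close>
lemma hankel_integral_absolute:
  assumes b: "2 \<le> b"
  shows "(\<integral>v. exp (Complex 1 v) * Complex 1 v powr (- of_real b) \<partial>lborel) = of_real (2 * pi / Gamma b)"
proof -
  define G where "G v = exp (Complex 1 v) * Complex 1 v powr (- of_real b)" for v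
  define H where "H e x = indicator {0<..} (1 + e * x) * (1 + e * x) powr (b - 1) * exp (- (e * x)) * exp (- x\<^sup>2 / 2)" for e x :: real
  let ?e = "\<lambda>n. 1 / real (Suc n)"
  have e0: "?e \<longlonglongrightarrow> 0" using LIMSEQ_inverse_real_of_nat by (simp add: inverse_eq_divide)
  have gauss: "integrable lborel (\<lambda>x::real. exp (- x\<^sup>2 / 2))" "(\<integral>x. exp (- x\<^sup>2 / 2) \<partial>lborel) = sqrt (2 * pi)"
  proof -
    have "(\<lambda>x::real. exp (- x\<^sup>2 / 2)) = (\<lambda>x. sqrt (2 * pi) * std_normal_density x)"
      by (simp add: std_normal_density_def)
    then show "integrable lborel (\<lambda>x::real. exp (- x\<^sup>2 / 2))" "(\<integral>x. exp (- x\<^sup>2 / 2) \<partial>lborel) = sqrt (2 * pi)"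
      by (simp_all add: integrable_normal_density)
  qed
  have [measurable]: "G \<in> borel_measurable borel" unfolding G_def Complex_eq by measurable
  have "(\<lambda>n. \<integral>v. exp (- (?e n * v)\<^sup>2 / 2) *\<^sub>R G v \<partial>lborel) \<longlonglongrightarrow> (\<integral>v. G v \<partial>lborel)"
  proof (rule integral_dominated_convergence[where w = "\<lambda>v. norm (G v)"])
    show "integrable lborel (\<lambda>v. norm (G v))" unfolding G_def using integrable_exp_powr_line[OF b] by (rule integrable_norm)
    show "AE v in lborel. (\<lambda>n. exp (- (?e n * v)\<^sup>2 / 2) *\<^sub>R G v) \<longlonglongrightarrow> G v"
    proof (rule AE_I2)
      fix v
      have "(\<lambda>n. exp (- (?e n * v)\<^sup>2 / 2) *\<^sub>R G v) \<longlonglongrightarrow> exp (- (0 * v)\<^sup>2 / 2) *\<^sub>R G v"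
        by (intro tendsto_intros e0) simp
      then show "(\<lambda>n. exp (- (?e n * v)\<^sup>2 / 2) *\<^sub>R G v) \<longlonglongrightarrow> G v" by simp
    qed
    show "AE v in lborel. norm (exp (- (?e n * v)\<^sup>2 / 2) *\<^sub>R G v) \<le> norm (G v)" for n
      by (intro AE_I2) (auto simp: mult_left_le_one_le)
  qed measurable
  then have "(\<lambda>n. of_real (Gamma b) * (\<integral>v. exp (- (?e n * v)\<^sup>2 / 2) *\<^sub>R G v \<partial>lborel)) \<longlonglongrightarrow> of_real (Gamma b) * (\<integral>v. G v \<partial>lborel)"
    by (intro tendsto_intros)
  moreover have "(\<lambda>n. \<integral>x. H (?e n) x \<partial>lborel) \<longlonglongrightarrow> (\<integral>x. exp (- x\<^sup>2 / 2) \<partial>lborel)"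
  proof (rule integral_dominated_convergence[where w = "\<lambda>x. (exp 1 * (b - 1) powr (b - 1)) * exp (- x\<^sup>2 / 2)"])
    show "integrable lborel (\<lambda>x. (exp 1 * (b - 1) powr (b - 1)) * exp (- x\<^sup>2 / 2))" using gauss by simp
    show "AE x in lborel. (\<lambda>n. H (?e n) x) \<longlonglongrightarrow> exp (- x\<^sup>2 / 2)"
    proof (rule AE_I2)
      fix x :: real
      have l1: "(\<lambda>n. 1 + ?e n * x) \<longlonglongrightarrow> 1 + 0 * x" by (intro tendsto_intros e0)
      then have ev: "\<forall>\<^sub>F n in sequentially. 1 + ?e n * x > 0" by (intro order_tendstoD) auto
      have "(\<lambda>n. (1 + ?e n * x) powr (b - 1) * exp (- (?e n * x)) * exp (- x\<^sup>2 / 2))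
          \<longlonglongrightarrow> (1 + 0 * x) powr (b - 1) * exp (- (0 * x)) * exp (- x\<^sup>2 / 2)"
        by (intro tendsto_intros e0) auto
      moreover have "\<forall>\<^sub>F n in sequentially. (1 + ?e n * x) powr (b - 1) * exp (- (?e n * x)) * exp (- x\<^sup>2 / 2) = H (?e n) x"
        using ev by eventually_elim (simp add: H_def)
      ultimately show "(\<lambda>n. H (?e n) x) \<longlonglongrightarrow> exp (- x\<^sup>2 / 2)"
        by (auto dest: Lim_transform_eventually)
    qed
    show "AE x in lborel. norm (H (?e n) x) \<le> (exp 1 * (b - 1) powr (b - 1)) * exp (- x\<^sup>2 / 2)" for n
    proof (rule AE_I2)
      fix x :: real
      have "norm (H (?e n) x) = (indicator {0<..} (1 + ?e n * x) * (1 + ?e n * x) powr (b - 1) * exp (1 - (1 + ?e n * x))) * exp (- x\<^sup>2 / 2)"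
        by (simp add: H_def abs_mult)
      also have "\<dots> \<le> (exp 1 * (b - 1) powr (b - 1)) * exp (- x\<^sup>2 / 2)"
        using b by (intro mult_right_mono gamma_weight_bound) auto
      finally show "norm (H (?e n) x) \<le> (exp 1 * (b - 1) powr (b - 1)) * exp (- x\<^sup>2 / 2)" .
    qed
  qed (auto simp: H_def)
  then have "(\<lambda>n. of_real (sqrt (2 * pi) * (\<integral>x. H (?e n) x \<partial>lborel)) :: complex) \<longlonglongrightarrow> of_real (sqrt (2 * pi) * sqrt (2 * pi))"
    unfolding gauss by (intro tendsto_intros)
  moreover have "of_real (Gamma b) * (\<integral>v. exp (- (?e n * v)\<^sup>2 / 2) *\<^sub>R G v \<partial>lborel) = of_real (sqrt (2 * pi) * (\<integral>x. H (?e n) x \<partial>lborel))" for n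
    unfolding G_def H_def by (rule gaussian_regularised_hankel) (use b in auto)
  ultimately have "of_real (Gamma b) * (\<integral>v. G v \<partial>lborel) = of_real (sqrt (2 * pi) * sqrt (2 * pi))"
    using LIMSEQ_unique by auto
  moreover have "0 < Gamma b" using b by (intro Gamma_real_pos) simp
  then have "complex_of_real (Gamma b) \<noteq> 0" by simp
  ultimately have "(\<integral>v. G v \<partial>lborel) = of_real (2 * pi) / of_real (Gamma b)"
    by (simp add: eq_divide_eq mult.commute flip: of_real_mult)
  then show ?thesis by (simp add: G_def)
qed

lemma open_right_halfplane: "open {z. s < Re z}" and convex_right_halfplane: "convex {z. s < Re z}"
  by (rule open_halfspace_Re_gt, rule convex_halfspace_Re_gt)

lemma hankel_primitive_base:
  assumes b: "2 \<le> b"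
  obtains Q where "\<And>w. 0 < Re w \<Longrightarrow> (Q has_field_derivative exp w * w powr (- of_real b)) (at w)"
    and "((\<lambda>R. Q (Complex 1 R) - Q (Complex 1 (- R))) \<longlongrightarrow> 2 * of_real pi * \<i> / of_real (Gamma b)) at_top"
proof -
  define f where "f w = exp w * w powr (- complex_of_real b)" for w
  have "f holomorphic_on {z. 0 < Re z}"
    unfolding f_def by (intro holomorphic_intros) (auto simp: complex_nonpos_Reals_iff)
  from holomorphic_convex_primitive'[OF convex_right_halfplane open_right_halfplane this]
  obtain Q where Q0: "\<And>w. w \<in> {z. 0 < Re z} \<Longrightarrow> (Q has_field_derivative f w) (at w within {z. 0 < Re z})" by blast
  have Q: "(Q has_field_derivative f w) (at w)" if "0 < Re w" for w
    using that Q0[of w] at_within_open[of w "{z. 0 < Re z}"] open_right_halfplane[of 0] by simp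
  have cont: "continuous_on UNIV (\<lambda>v. f (Complex 1 v))"
    unfolding f_def Complex_eq by (intro continuous_intros) (auto simp: complex_nonpos_Reals_iff complex_eq_iff)
  have [measurable]: "(\<lambda>v. f (Complex 1 v)) \<in> borel_measurable borel"
    using cont by (rule borel_measurable_continuous_onI)
  have FTC: "(\<integral>v. indicator {-R..R} v *\<^sub>R (\<i> * f (Complex 1 v)) \<partial>lborel) = Q (Complex 1 R) - Q (Complex 1 (- R))" if "0 \<le> R" for R
  proof (rule integral_FTC_Icc)
    show "- R \<le> R" using that by simp
    show "continuous_on {- R..R} (\<lambda>v. \<i> * f (Complex 1 v))" by (intro continuous_intros continuous_on_subset[OF cont]) auto
    fix v
    have "((\<lambda>v. Complex 1 v) has_vector_derivative \<i>) (at v within {- R..R})"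
      unfolding Complex_eq by (auto intro!: derivative_eq_intros)
    then show "((\<lambda>v. Q (Complex 1 v)) has_vector_derivative \<i> * f (Complex 1 v)) (at v within {- R..R})"
      using field_vector_diff_chain_within[where g = Q and g' = "f (Complex 1 v)" and f = "\<lambda>v. Complex 1 v" and x = v and S = "{-R..R}" and f' = \<i>]
        Q[of "Complex 1 v"] by (auto simp: o_def intro: has_field_derivative_at_within)
  qed
  have "((\<lambda>R. \<integral>v. indicator {-R..R} v *\<^sub>R (\<i> * f (Complex 1 v)) \<partial>lborel) \<longlongrightarrow> (\<integral>v. \<i> * f (Complex 1 v) \<partial>lborel)) at_top"
  proof (rule integral_dominated_convergence_at_top[where w = "\<lambda>v. norm (f (Complex 1 v))"])
    show "integrable lborel (\<lambda>v. norm (f (Complex 1 v)))"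
      unfolding f_def using integrable_exp_powr_line[OF b] by (rule integrable_norm)
    show "AE v in lborel. ((\<lambda>R. indicator {-R..R} v *\<^sub>R (\<i> * f (Complex 1 v))) \<longlongrightarrow> \<i> * f (Complex 1 v)) at_top"
    proof (rule AE_I2, rule tendsto_eventually)
      fix v :: real
      show "\<forall>\<^sub>F R in at_top. indicator {-R..R} v *\<^sub>R (\<i> * f (Complex 1 v)) = \<i> * f (Complex 1 v)"
        using eventually_ge_at_top[of "\<bar>v\<bar>"] by eventually_elim (auto simp: indicator_def)
    qed
    show "\<forall>\<^sub>F R in at_top. AE v in lborel. norm (indicator {-R..R} v *\<^sub>R (\<i> * f (Complex 1 v))) \<le> norm (f (Complex 1 v))"
      by (intro always_eventually allI AE_I2) (auto simp: indicator_def norm_mult)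
  qed measurable
  moreover have "\<forall>\<^sub>F R in at_top. (\<integral>v. indicator {-R..R} v *\<^sub>R (\<i> * f (Complex 1 v)) \<partial>lborel) = Q (Complex 1 R) - Q (Complex 1 (- R))"
    using eventually_ge_at_top[of 0] by eventually_elim (rule FTC)
  ultimately have "((\<lambda>R. Q (Complex 1 R) - Q (Complex 1 (- R))) \<longlongrightarrow> (\<integral>v. \<i> * f (Complex 1 v) \<partial>lborel)) at_top"
    by (rule Lim_transform_eventually)
  also have "(\<integral>v. \<i> * f (Complex 1 v) \<partial>lborel) = 2 * of_real pi * \<i> / of_real (Gamma b)"
    using hankel_integral_absolute[OF b] by (simp add: f_def)
  finally show ?thesis using Q that unfolding f_def by blast
qed

lemma exp_powr_Im_bound:
  assumes "0 < a" "0 \<le> Re w" "Re w \<le> D" "Im w \<noteq> 0"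
  shows "norm (exp w * w powr (- complex_of_real a)) \<le> exp D * \<bar>Im w\<bar> powr (- a)"
proof -
  have "w \<noteq> 0" using assms by auto
  moreover have "norm w powr (- a) \<le> \<bar>Im w\<bar> powr (- a)"
    using assms by (intro powr_mono2') (auto simp: abs_Im_le_cmod)
  ultimately show ?thesis using assms
    by (subst norm_exp_powr_line) (auto intro!: mult_mono)
qed

lemma exp_powr_Im_bound_tendsto:
  assumes "0 < a"
  shows "((\<lambda>R::real. C * \<bar>R\<bar> powr (- a)) \<longlongrightarrow> 0) at_top"
proof -
  have "((\<lambda>R::real. R powr (- a)) \<longlongrightarrow> 0) at_top" using assms by (intro tendsto_neg_powr filterlim_ident) auto
  then have "((\<lambda>R::real. C * R powr (- a)) \<longlongrightarrow> C * 0) at_top" by (rule tendsto_mult_left)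
  then have "((\<lambda>R::real. C * R powr (- a)) \<longlongrightarrow> 0) at_top" by simp
  moreover have "\<forall>\<^sub>F R in at_top. C * R powr (- a) = C * \<bar>R\<bar> powr (- a)"
    using eventually_ge_at_top[of 0] by eventually_elim simp
  ultimately show ?thesis by (rule Lim_transform_eventually)
qed

text \<open>
  Integration by parts: \<open>e^w w powr -a\<close> plus \<open>a\<close> times a primitive for exponent \<open>a + 1\<close> is a primitive
  for exponent \<open>a\<close>, the boundary terms vanish at infinity, and \<open>\<Gamma>(a + 1) = a \<Gamma>(a)\<close>.
\<close>
lemma hankel_primitive_step:
  assumes a: "0 < a"
    and ex: "\<exists>Q. (\<forall>w. 0 < Re w \<longrightarrow> (Q has_field_derivative exp w * w powr (- of_real (a + 1))) (at w)) \<and>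
       ((\<lambda>R. Q (Complex 1 R) - Q (Complex 1 (- R))) \<longlongrightarrow> 2 * of_real pi * \<i> / of_real (Gamma (a + 1))) at_top"
  shows "\<exists>Q. (\<forall>w. 0 < Re w \<longrightarrow> (Q has_field_derivative exp w * w powr (- of_real a)) (at w)) \<and>
       ((\<lambda>R. Q (Complex 1 R) - Q (Complex 1 (- R))) \<longlongrightarrow> 2 * of_real pi * \<i> / of_real (Gamma a)) at_top"
proof -
  from ex obtain Q where Q: "\<And>w. 0 < Re w \<Longrightarrow> (Q has_field_derivative exp w * w powr (- of_real (a + 1))) (at w)"
    and L: "((\<lambda>R. Q (Complex 1 R) - Q (Complex 1 (- R))) \<longlongrightarrow> 2 * of_real pi * \<i> / of_real (Gamma (a + 1))) at_top" by auto
  define f where "f w = exp w * w powr (- complex_of_real a)" for w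
  define P where "P w = f w + of_real a * Q w" for w
  have "(P has_field_derivative f w) (at w)" if w: "0 < Re w" for w
  proof -
    have "w \<notin> \<real>\<^sub>\<le>\<^sub>0" using w by (auto simp: complex_nonpos_Reals_iff)
    moreover have "- complex_of_real (a + 1) = - complex_of_real a - 1" by simp
    note Q[OF w, unfolded this]
    ultimately show ?thesis unfolding P_def f_def
      by (auto intro!: derivative_eq_intros simp: algebra_simps)
  qed
  moreover have f0: "((\<lambda>R. f (Complex 1 R)) \<longlongrightarrow> 0) at_top" "((\<lambda>R. f (Complex 1 (- R))) \<longlongrightarrow> 0) at_top"
  proof -
    have bd: "\<forall>\<^sub>F R in at_top. norm (f (Complex 1 R)) \<le> exp 1 * \<bar>R\<bar> powr (- a) \<and> norm (f (Complex 1 (- R))) \<le> exp 1 * \<bar>R\<bar> powr (- a)"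
      using eventually_gt_at_top[of 0]
    proof eventually_elim
      case (elim R)
      then show ?case unfolding f_def
        using exp_powr_Im_bound[OF a, of "Complex 1 R" 1] exp_powr_Im_bound[OF a, of "Complex 1 (- R)" 1] by simp
    qed
    show "((\<lambda>R. f (Complex 1 R)) \<longlongrightarrow> 0) at_top"
      by (rule Lim_null_comparison[OF _ exp_powr_Im_bound_tendsto[OF a, of "exp 1"]]) (use bd in eventually_elim, auto)
    show "((\<lambda>R. f (Complex 1 (- R))) \<longlongrightarrow> 0) at_top"
      by (rule Lim_null_comparison[OF _ exp_powr_Im_bound_tendsto[OF a, of "exp 1"]]) (use bd in eventually_elim, auto)
  qed
  have "((\<lambda>R. (f (Complex 1 R) - f (Complex 1 (- R))) + of_real a * (Q (Complex 1 R) - Q (Complex 1 (- R))))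
     \<longlongrightarrow> (0 - 0) + of_real a * (2 * of_real pi * \<i> / of_real (Gamma (a + 1)))) at_top"
    by (intro tendsto_intros f0 L)
  then have "((\<lambda>R. P (Complex 1 R) - P (Complex 1 (- R))) \<longlongrightarrow> of_real a * (2 * of_real pi * \<i> / of_real (Gamma (a + 1)))) at_top"
    by (simp add: P_def algebra_simps)
  moreover have "Gamma (a + 1) = a * Gamma a" using a by (intro Gamma_plus1) (auto elim!: nonpos_Ints_cases)
  ultimately show ?thesis using a unfolding f_def by (intro exI[of _ P]) auto
qed

text \<open>
  Two integrations by parts lead from the absolutely convergent case to every \<open>a > 0\<close>.  Moving the
  line from abscissa 1 to \<open>u\<close> costs two horizontal segments at height \<open>\<plusminus>R\<close>, on which the integrand is
  of order \<open>R powr -a\<close>, uniformly for \<open>u\<close> in a bounded set and however close \<open>u\<close> is to 0.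
\<close>
lemma hankel_primitive:
  assumes a: "0 < a"
  obtains Q where "\<And>w. 0 < Re w \<Longrightarrow> (Q has_field_derivative exp w * w powr (- of_real a)) (at w)"
    and "\<And>D. uniform_limit {0<..D} (\<lambda>R u. Q (Complex u R) - Q (Complex u (- R))) (\<lambda>_. 2 * of_real pi * \<i> / of_real (Gamma a)) at_top"
proof -
  let ?L = "2 * of_real pi * \<i> / of_real (Gamma a)"
  have "\<exists>Q. (\<forall>w. 0 < Re w \<longrightarrow> (Q has_field_derivative exp w * w powr (- of_real (a+1+1))) (at w)) \<and>
       ((\<lambda>R. Q (Complex 1 R) - Q (Complex 1 (- R))) \<longlongrightarrow> 2 * of_real pi * \<i> / of_real (Gamma (a+1+1))) at_top"
    by (rule hankel_primitive_base[of "a+1+1"]) (use a in auto)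
  then obtain Q where Q: "\<And>w. 0 < Re w \<Longrightarrow> (Q has_field_derivative exp w * w powr (- of_real a)) (at w)"
    and L: "((\<lambda>R. Q (Complex 1 R) - Q (Complex 1 (- R))) \<longlongrightarrow> ?L) at_top"
    using hankel_primitive_step[OF a] hankel_primitive_step[of "a+1"] a by auto
  have "uniform_limit {0<..D} (\<lambda>R u. Q (Complex u R) - Q (Complex u (- R))) (\<lambda>_. ?L) at_top" for D
  proof (rule uniform_limitI)
    fix e :: real assume e: "e > 0"
    define E where "E = max D 1"
    have shift: "norm (Q (Complex u v) - Q (Complex 1 v)) \<le> exp E * \<bar>v\<bar> powr (- a) * E" if u: "u \<in> {0<..D}" and v: "v \<noteq> 0" for u v
    proof -
      have "norm (Q (Complex u v) - Q (Complex 1 v)) \<le> (exp E * \<bar>v\<bar> powr (- a)) * norm (Complex u v - Complex 1 v)"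
      proof (rule field_differentiable_bound[where S = "closed_segment (Complex 1 v) (Complex u v)"
            and f' = "\<lambda>w. exp w * w powr (- of_real a)"])
        fix w assume w: "w \<in> closed_segment (Complex 1 v) (Complex u v)"
        have im: "Im w = v" and re: "0 < Re w" "Re w \<le> E"
        proof -
          from w obtain x where x: "0 \<le> x" "x \<le> 1" "w = (1 - x) *\<^sub>R Complex 1 v + x *\<^sub>R Complex u v"
            by (auto simp: closed_segment_def)
          show "Im w = v" unfolding x(3) by (simp add: algebra_simps)
          have *: "Re w = (1 - x) * 1 + x * u" unfolding x(3) by simp
          show "0 < Re w"
          proof (cases "x = 0")
            case False
            then have "0 < x * u" using x u by simp
            then show ?thesis using * x by (simp add: add_nonneg_pos)
          qed (use * in simp)
          show "Re w \<le> E" unfolding * using x u by (intro convex_bound_le) (auto simp: E_def)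
        qed
        show "(Q has_field_derivative exp w * w powr (- of_real a)) (at w within closed_segment (Complex 1 v) (Complex u v))"
          by (rule has_field_derivative_at_within[OF Q[OF re(1)]])
        show "norm (exp w * w powr (- complex_of_real a)) \<le> exp E * \<bar>v\<bar> powr (- a)"
          using exp_powr_Im_bound[OF a, of w E] re im v by simp
      qed auto
      also have "norm (Complex u v - Complex 1 v) = \<bar>u - 1\<bar>" by (simp add: cmod_def)
      also have "(exp E * \<bar>v\<bar> powr (- a)) * \<bar>u - 1\<bar> \<le> (exp E * \<bar>v\<bar> powr (- a)) * E"
        using u by (intro mult_left_mono) (auto simp: E_def)
      finally show ?thesis .
    qed
    have "((\<lambda>R. (2 * exp E * E) * \<bar>R\<bar> powr (- a)) \<longlongrightarrow> 0) at_top" by (rule exp_powr_Im_bound_tendsto[OF a])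
    then have "\<forall>\<^sub>F R in at_top. (2 * exp E * E) * \<bar>R\<bar> powr (- a) < e / 2" using e by (intro order_tendstoD) auto
    moreover have "\<forall>\<^sub>F R in at_top. dist (Q (Complex 1 R) - Q (Complex 1 (- R))) ?L < e / 2"
      using L e by (intro tendstoD) auto
    ultimately show "\<forall>\<^sub>F R in at_top. \<forall>u\<in>{0<..D}. dist (Q (Complex u R) - Q (Complex u (- R))) ?L < e"
      using eventually_gt_at_top[of 0]
    proof eventually_elim
      case (elim R)
      show ?case
      proof
        fix u assume u: "u \<in> {0<..D}"
        have "dist (Q (Complex u R) - Q (Complex u (- R))) (Q (Complex 1 R) - Q (Complex 1 (- R))) =
           norm ((Q (Complex u R) - Q (Complex 1 R)) - (Q (Complex u (- R)) - Q (Complex 1 (- R))))"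
          by (simp add: dist_norm algebra_simps)
        also have "\<dots> \<le> norm (Q (Complex u R) - Q (Complex 1 R)) + norm (Q (Complex u (- R)) - Q (Complex 1 (- R)))"
          by (rule norm_triangle_ineq4)
        also have "\<dots> \<le> (2 * exp E * E) * \<bar>R\<bar> powr (- a)"
          using shift[OF u, of R] shift[OF u, of "- R"] elim by (simp add: mult_ac)
        finally have "dist (Q (Complex u R) - Q (Complex u (- R))) (Q (Complex 1 R) - Q (Complex 1 (- R))) < e / 2"
          using elim by simp
        with elim(2) show "dist (Q (Complex u R) - Q (Complex u (- R))) ?L < e"
          using dist_triangle[of "Q (Complex u R) - Q (Complex u (- R))" ?L "Q (Complex 1 R) - Q (Complex 1 (- R))"]
          by linarith
      qed
    qed
  qed
  then show ?thesis using Q that by blast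
qed

section \<open>The Dirichlet integral\<close>

interpretation lborel_PiM: product_sigma_finite "\<lambda>_::nat. lborel :: real measure"
  by unfold_locales

text \<open>
  Change of variables under a homothety, one coordinate at a time.
\<close>
lemma nn_integral_PiM_scale:
  fixes f :: "(nat \<Rightarrow> real) \<Rightarrow> ennreal"
  assumes K: "finite K" and s: "0 < s" and f: "f \<in> borel_measurable (PiM K (\<lambda>_. lborel))"
  shows "(\<integral>\<^sup>+x. f x \<partial>PiM K (\<lambda>_. lborel)) =
    ennreal ((1 / s) ^ card K) * (\<integral>\<^sup>+y. f (\<lambda>i\<in>K. y i / s) \<partial>PiM K (\<lambda>_. lborel))"
  using K f
proof (induction K arbitrary: f rule: finite_induct)
  case empty
  have "(\<lambda>i\<in>{}. y i / s) = (\<lambda>_. undefined)" for y :: "nat \<Rightarrow> real" by (simp add: restrict_def)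
  then have "(\<integral>\<^sup>+y. f (\<lambda>i\<in>{}. y i / s) \<partial>PiM {} (\<lambda>_. lborel)) = f (\<lambda>_. undefined)"
    by (subst lborel_PiM.nn_integral_empty) auto
  then show ?case by (simp only: lborel_PiM.nn_integral_empty[OF zero_le]) simp
next
  case (insert k K)
  note insert.prems[measurable]
  have [measurable]: "(\<lambda>z. f ((fst z)(k := snd z))) \<in> borel_measurable (PiM K (\<lambda>_. lborel) \<Otimes>\<^sub>M lborel)"
    by measurable
  let ?P = "PiM K (\<lambda>_. lborel :: real measure)"
  have upd: "(\<lambda>i\<in>K. x i / s)(k := y / s) = (\<lambda>i\<in>insert k K. (x(k := y)) i / s)" for x y
    using insert.hyps by (auto simp: fun_eq_iff restrict_def)
  have "(\<integral>\<^sup>+x. f x \<partial>PiM (insert k K) (\<lambda>_. lborel)) = (\<integral>\<^sup>+x. \<integral>\<^sup>+y. f (x(k := y)) \<partial>lborel \<partial>?P)"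
    by (rule lborel_PiM.product_nn_integral_insert) (use insert in auto)
  also have "\<dots> = (\<integral>\<^sup>+x. ennreal (1 / s) * (\<integral>\<^sup>+y. f (x(k := y / s)) \<partial>lborel) \<partial>?P)"
  proof (rule nn_integral_cong)
    fix x assume "x \<in> space ?P"
    then have "(\<lambda>y. f (x(k := y))) \<in> borel_measurable borel"
      using measurable_Pair2[of "\<lambda>z. f ((fst z)(k := snd z))" ?P lborel borel x] by simp
    then show "(\<integral>\<^sup>+y. f (x(k := y)) \<partial>lborel) = ennreal (1 / s) * (\<integral>\<^sup>+y. f (x(k := y / s)) \<partial>lborel)"
      using nn_integral_real_affine[of "\<lambda>y. f (x(k := y))" "1 / s" 0] s by simp
  qed
  also have "\<dots> = ennreal (1 / s) * (\<integral>\<^sup>+x. (\<integral>\<^sup>+y. f (x(k := y / s)) \<partial>lborel) \<partial>?P)"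
    by (rule nn_integral_cmult) measurable
  also have "(\<integral>\<^sup>+x. (\<integral>\<^sup>+y. f (x(k := y / s)) \<partial>lborel) \<partial>?P) =
     ennreal ((1 / s) ^ card K) * (\<integral>\<^sup>+x. (\<integral>\<^sup>+y. f ((\<lambda>i\<in>K. x i / s)(k := y / s)) \<partial>lborel) \<partial>?P)"
    by (rule insert.IH) measurable
  also have "(\<integral>\<^sup>+x. (\<integral>\<^sup>+y. f ((\<lambda>i\<in>K. x i / s)(k := y / s)) \<partial>lborel) \<partial>?P) =
     (\<integral>\<^sup>+x. f (\<lambda>i\<in>insert k K. x i / s) \<partial>PiM (insert k K) (\<lambda>_. lborel))"
    unfolding upd by (rule lborel_PiM.product_nn_integral_insert[symmetric]) (use insert in auto)
  also have "ennreal (1 / s) * (ennreal ((1 / s) ^ card K) * I) = ennreal ((1 / s) ^ card (insert k K)) * I" for I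
    using insert.hyps s by (simp add: mult.assoc[symmetric] ennreal_mult'[symmetric])
  finally show ?case .
qed

text \<open>
  All powers of \<open>s\<close> cancel because the exponent \<open>a\<close> is the sum of the Dirichlet parameters.  This is
  the reason why the Gamma radius is independent of the Dirichlet direction.
\<close>
lemma dirichlet_scaling:
  fixes y p c :: "nat \<Rightarrow> real"
  assumes K: "finite K" "m \<notin> K" and s: "0 < s" and y: "\<And>j. j \<in> K \<Longrightarrow> 0 < y j" and sum: "(\<Sum>j\<in>K. y j) < s"
    and a: "a = (\<Sum>j\<in>K. p j) + p m"
  shows "(1 / s) ^ card K * ((\<Prod>j\<in>K. (y j / s) powr (p j - 1)) * (1 - (\<Sum>j\<in>K. y j / s)) powr (p m - 1) *
     (s powr (a - 1) * exp (- (((\<Sum>j\<in>K. c j * (y j / s)) + c m * (1 - (\<Sum>j\<in>K. y j / s))) * s))))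
   = (\<Prod>j\<in>K. y j powr (p j - 1) * exp (- (c j * y j))) *
      ((s - (\<Sum>j\<in>K. y j)) powr (p m - 1) * exp (- (c m * (s - (\<Sum>j\<in>K. y j)))))"
proof -
  define S where "S = (\<Sum>j\<in>K. y j)"
  have 1: "(\<Prod>j\<in>K. (y j / s) powr (p j - 1)) = (\<Prod>j\<in>K. y j powr (p j - 1)) * s powr (\<Sum>j\<in>K. 1 - p j)"
  proof -
    have "(\<Prod>j\<in>K. (y j / s) powr (p j - 1)) = (\<Prod>j\<in>K. y j powr (p j - 1) * s powr (1 - p j))"
    proof (rule prod.cong[OF refl])
      fix j assume "j \<in> K"
      have "s powr (1 - p j) = inverse (s powr (p j - 1))" by (simp flip: powr_minus)
      then show "(y j / s) powr (p j - 1) = y j powr (p j - 1) * s powr (1 - p j)"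
        using y[OF \<open>j \<in> K\<close>] s by (simp add: powr_divide less_imp_le divide_inverse[symmetric])
    qed
    then show ?thesis using s K by (simp add: prod.distrib powr_sum)
  qed
  have Ss: "(\<Sum>j\<in>K. y j / s) = S / s" by (simp add: S_def sum_divide_distrib)
  have 2: "(1 - S / s) powr (p m - 1) = (s - S) powr (p m - 1) * s powr (1 - p m)"
  proof -
    have "1 - S / s = (s - S) / s" using s by (simp add: field_simps)
    moreover have "s powr (1 - p m) = inverse (s powr (p m - 1))" by (simp flip: powr_minus)
    ultimately show ?thesis using s sum by (simp add: S_def powr_divide divide_inverse[symmetric])
  qed
  have 3: "exp (- (((\<Sum>j\<in>K. c j * (y j / s)) + c m * (1 - S / s)) * s)) = (\<Prod>j\<in>K. exp (- (c j * y j))) * exp (- (c m * (s - S)))"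
  proof -
    have "((\<Sum>j\<in>K. c j * (y j / s)) + c m * (1 - S / s)) * s = (\<Sum>j\<in>K. c j * y j) + c m * (s - S)"
      using s by (simp add: ring_distribs sum_distrib_right) 
    then show ?thesis using K by (simp add: exp_sum[symmetric] exp_add[symmetric] sum_negf)
  qed
  have 4: "(1 / s) ^ card K = s powr (- real (card K))"
    using s by (simp add: powr_minus powr_realpow divide_inverse power_inverse)
  have 5: "s powr (- real (card K)) * (s powr (\<Sum>j\<in>K. 1 - p j) * s powr (1 - p m) * s powr (a - 1)) = 1"
    using s by (simp add: powr_add[symmetric] sum_subtractf a)
  have "?thesis \<longleftrightarrow> s powr (- real (card K)) * ((\<Prod>j\<in>K. y j powr (p j - 1)) * s powr (\<Sum>j\<in>K. 1 - p j) *
       ((s - S) powr (p m - 1) * s powr (1 - p m)) * (s powr (a - 1) * ((\<Prod>j\<in>K. exp (- (c j * y j))) * exp (- (c m * (s - S))))))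
     = ((\<Prod>j\<in>K. y j powr (p j - 1)) * (\<Prod>j\<in>K. exp (- (c j * y j)))) * ((s - S) powr (p m - 1) * exp (- (c m * (s - S))))"
    by (simp only: 1 2 3 4 Ss S_def[symmetric] prod.distrib)
  also have "\<dots> \<longleftrightarrow> (s powr (- real (card K)) * (s powr (\<Sum>j\<in>K. 1 - p j) * s powr (1 - p m) * s powr (a - 1))) *
      (((\<Prod>j\<in>K. y j powr (p j - 1)) * (\<Prod>j\<in>K. exp (- (c j * y j)))) * ((s - S) powr (p m - 1) * exp (- (c m * (s - S)))))
     = ((\<Prod>j\<in>K. y j powr (p j - 1)) * (\<Prod>j\<in>K. exp (- (c j * y j)))) * ((s - S) powr (p m - 1) * exp (- (c m * (s - S))))"
    by (simp only: mult_ac)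
  finally show ?thesis by (simp only: 5 mult_1)
qed

text \<open>
  With \<open>W\<close> the linear form and \<open>a\<close> the sum of the \<open>p j\<close>, write \<open>\<Gamma>(a) W powr -a\<close> as an
  integral over a radius \<open>s\<close>; the factor \<open>\<Gamma>(a)\<close> comes from the density.  Substituting
  \<open>x = y / s\<close> turns the integrand into a product of Gamma weights in the \<open>y j\<close> and in
  \<open>s - \<Sum> y j\<close>, so the integral factorises.
\<close>
lemma dirichlet_integral:
  fixes p c :: "nat \<Rightarrow> real"
  assumes J: "finite J" "m \<in> J" and p: "\<And>j. j \<in> J \<Longrightarrow> 0 < p j" and c: "\<And>j. j \<in> J \<Longrightarrow> 0 < c j"
  defines "K \<equiv> J - {m}"
  shows "(\<integral>\<^sup>+x. ennreal (dirichlet_density J m p x) *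
      ennreal (((\<Sum>j\<in>K. c j * x j) + c m * (1 - (\<Sum>j\<in>K. x j))) powr (- (\<Sum>j\<in>J. p j))) \<partial>PiM K (\<lambda>_. lborel))
    = ennreal (\<Prod>j\<in>J. c j powr (- p j))"
proof -
  let ?P = "PiM K (\<lambda>_. lborel :: real measure)"
  define a where "a = (\<Sum>j\<in>J. p j)"
  have K: "finite K" "m \<notin> K" "J = insert m K" using J by (auto simp: K_def)
  have a: "a = (\<Sum>j\<in>K. p j) + p m" using K by (simp add: a_def)
  have apos: "0 < a" using J p unfolding a_def by (intro sum_pos) auto
  define S where "S x = (\<Sum>j\<in>K. x j)" for x :: "nat \<Rightarrow> real"
  define W where "W x = (\<Sum>j\<in>K. c j * x j) + c m * (1 - S x)" for x :: "nat \<Rightarrow> real"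
  define D where "D x \<longleftrightarrow> (\<forall>j\<in>K. 0 < x j) \<and> S x < 1" for x :: "nat \<Rightarrow> real"
  define B where "B x = (\<Prod>j\<in>K. x j powr (p j - 1)) * (1 - S x) powr (p m - 1)" for x :: "nat \<Rightarrow> real"
  define \<kappa> where "\<kappa> = 1 / (\<Prod>j\<in>J. Gamma (p j))"
  have \<kappa>: "0 < \<kappa>" unfolding \<kappa>_def using p by (auto intro!: prod_pos Gamma_real_pos)
  define h where "h x s = (if D x then B x * (indicator {0<..} s * s powr (a - 1) * exp (- (W x * s))) else 0)" for x s
  define g where "g j u = indicator {0<..} u * u powr (p j - 1) * exp (- (c j * u))" for j u
  have sK [measurable]: "(\<lambda>x. x j) \<in> borel_measurable ?P" if "j \<in> K" for j
    using measurable_component_singleton[of j K "\<lambda>_. lborel :: real measure"] that by simp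
  have [measurable]: "S \<in> borel_measurable ?P" unfolding S_def by (intro borel_measurable_sum sK)
  have [measurable]: "W \<in> borel_measurable ?P" unfolding W_def by (intro borel_measurable_add borel_measurable_sum borel_measurable_times borel_measurable_diff sK) auto
  have [measurable]: "Measurable.pred ?P D" unfolding D_def
    by (intro pred_intros_logic pred_intros_finite K borel_measurable_pred_less sK) auto
  have [measurable]: "B \<in> borel_measurable ?P" unfolding B_def
    by (intro borel_measurable_times borel_measurable_prod powr_real_measurable borel_measurable_diff sK) auto
  have [measurable]: "g j \<in> borel_measurable borel" for j unfolding g_def by measurable
  have [measurable]: "(\<lambda>z. h (fst z) (snd z)) \<in> borel_measurable (?P \<Otimes>\<^sub>M lborel)"
    unfolding h_def by measurable
  interpret PP: pair_sigma_finite ?P lborel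
    by (intro pair_sigma_finite.intro lborel_PiM.sigma_finite K lborel.sigma_finite_measure_axioms)
  have Wpos: "0 < W x" if "D x" for x
    unfolding W_def using that c K unfolding D_def by (intro add_nonneg_pos sum_nonneg) (auto intro!: less_imp_le)
  have "(\<integral>\<^sup>+x. ennreal (dirichlet_density J m p x) * ennreal (W x powr (- a)) \<partial>?P) = (\<integral>\<^sup>+x. ennreal \<kappa> * (\<integral>\<^sup>+s. ennreal (h x s) \<partial>lborel) \<partial>?P)"
  proof (rule nn_integral_cong)
    fix x
    show "ennreal (dirichlet_density J m p x) * ennreal (W x powr (- a)) = ennreal \<kappa> * (\<integral>\<^sup>+s. ennreal (h x s) \<partial>lborel)"
    proof (cases "D x")
      case True
      have B: "0 \<le> B x" unfolding B_def by (auto intro!: mult_nonneg_nonneg prod_nonneg)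
      have "(\<integral>\<^sup>+s. ennreal (h x s) \<partial>lborel) = (\<integral>\<^sup>+s. ennreal (B x) * ennreal (indicator {0<..} s * s powr (a - 1) * exp (- (W x * s))) \<partial>lborel)"
        using True B by (simp add: h_def ennreal_mult')
      also have "\<dots> = ennreal (B x) * ennreal (Gamma a * W x powr (- a))"
        by (simp add: nn_integral_cmult nn_integral_gamma_scaled[OF apos Wpos[OF True]])
      finally have "ennreal \<kappa> * (\<integral>\<^sup>+s. ennreal (h x s) \<partial>lborel) = ennreal (\<kappa> * (B x * (Gamma a * W x powr (- a))))"
        using B \<kappa> by (simp add: ennreal_mult' ennreal_mult'')
      moreover have "dirichlet_density J m p x = \<kappa> * Gamma a * B x"
        using True by (simp add: dirichlet_density_def D_def S_def B_def \<kappa>_def a_def flip: K_def)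
      moreover have "0 \<le> \<kappa> * Gamma a * B x" using B \<kappa> apos by (simp add: less_imp_le)
      ultimately show ?thesis by (simp add: ennreal_mult'[symmetric] mult_ac)
    next
      case False
      then have "dirichlet_density J m p x = 0" by (auto simp: dirichlet_density_def D_def S_def K_def)
      then show ?thesis using False by (simp add: h_def)
    qed
  qed
  also have "\<dots> = ennreal \<kappa> * (\<integral>\<^sup>+x. (\<integral>\<^sup>+s. ennreal (h x s) \<partial>lborel) \<partial>?P)"
    by (rule nn_integral_cmult) measurable
  also have "(\<integral>\<^sup>+x. (\<integral>\<^sup>+s. ennreal (h x s) \<partial>lborel) \<partial>?P) = (\<integral>\<^sup>+s. (\<integral>\<^sup>+x. ennreal (h x s) \<partial>?P) \<partial>lborel)"
    by (rule PP.Fubini'[symmetric]) (simp add: case_prod_beta')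
  also have "\<dots> = (\<integral>\<^sup>+s. (\<integral>\<^sup>+y. (\<Prod>j\<in>K. ennreal (g j (y j))) * ennreal (g m (s - S y)) \<partial>?P) \<partial>lborel)"
  proof (rule nn_integral_cong)
    fix s :: real
    show "(\<integral>\<^sup>+x. ennreal (h x s) \<partial>?P) = (\<integral>\<^sup>+y. (\<Prod>j\<in>K. ennreal (g j (y j))) * ennreal (g m (s - S y)) \<partial>?P)"
    proof (cases "0 < s")
      case True
      have [measurable]: "(\<lambda>x. h x s) \<in> borel_measurable ?P" unfolding h_def by measurable
      have "(\<integral>\<^sup>+x. ennreal (h x s) \<partial>?P) = ennreal ((1 / s) ^ card K) * (\<integral>\<^sup>+y. ennreal (h (\<lambda>i\<in>K. y i / s) s) \<partial>?P)"
        by (rule nn_integral_PiM_scale) (use K True in auto)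
      also have "\<dots> = (\<integral>\<^sup>+y. ennreal ((1 / s) ^ card K) * ennreal (h (\<lambda>i\<in>K. y i / s) s) \<partial>?P)"
        by (rule nn_integral_cmult[symmetric]) measurable
      also have "\<dots> = (\<integral>\<^sup>+y. (\<Prod>j\<in>K. ennreal (g j (y j))) * ennreal (g m (s - S y)) \<partial>?P)"
      proof (rule nn_integral_cong)
        fix y :: "nat \<Rightarrow> real"
        have g0: "0 \<le> g j u" for j u by (auto simp: g_def)
        have r: "(\<Sum>j\<in>K. f j ((\<lambda>i\<in>K. y i / s) j)) = (\<Sum>j\<in>K. f j (y j / s))" 
          "(\<Prod>j\<in>K. f j ((\<lambda>i\<in>K. y i / s) j)) = (\<Prod>j\<in>K. f j (y j / s))" for f :: "nat \<Rightarrow> real \<Rightarrow> real"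
          by (auto intro!: sum.cong prod.cong)
        have Sy: "S (\<lambda>i\<in>K. y i / s) = (\<Sum>j\<in>K. y j / s)" unfolding S_def by (rule r(1))
        have Sy': "(\<Sum>j\<in>K. y j / s) = S y / s" by (simp add: S_def sum_divide_distrib)
        have Dy: "D (\<lambda>i\<in>K. y i / s) \<longleftrightarrow> (\<forall>j\<in>K. 0 < y j) \<and> S y < s"
          unfolding D_def Sy Sy' using True by (auto simp: zero_less_divide_iff)
        have "(1 / s) ^ card K * h (\<lambda>i\<in>K. y i / s) s = (\<Prod>j\<in>K. g j (y j)) * g m (s - S y)"
        proof (cases "(\<forall>j\<in>K. 0 < y j) \<and> S y < s")
          case yes: True
          then have "(1 / s) ^ card K * h (\<lambda>i\<in>K. y i / s) s = (1 / s) ^ card K * ((\<Prod>j\<in>K. (y j / s) powr (p j - 1)) * (1 - (\<Sum>j\<in>K. y j / s)) powr (p m - 1) *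
             (s powr (a - 1) * exp (- (((\<Sum>j\<in>K. c j * (y j / s)) + c m * (1 - (\<Sum>j\<in>K. y j / s))) * s))))"
            using True Dy r(1)[of "\<lambda>j u. c j * u"] r(2)[of "\<lambda>j u. u powr (p j - 1)"]
            by (simp add: h_def B_def W_def Sy)
          also have "\<dots> = (\<Prod>j\<in>K. y j powr (p j - 1) * exp (- (c j * y j))) *
              ((s - (\<Sum>j\<in>K. y j)) powr (p m - 1) * exp (- (c m * (s - (\<Sum>j\<in>K. y j)))))"
            using yes K a True by (intro dirichlet_scaling) (auto simp: S_def)
          also have "\<dots> = (\<Prod>j\<in>K. g j (y j)) * g m (s - S y)"
            using yes by (simp add: g_def S_def)
          finally show ?thesis .
        next
          case no: False
          then have "\<not> 0 < s - S y \<or> (\<exists>j\<in>K. \<not> 0 < y j)" by auto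
          moreover have "g j u = 0" if "\<not> 0 < u" for j u using that by (simp add: g_def)
          ultimately have "g m (s - S y) = 0 \<or> (\<exists>j\<in>K. g j (y j) = 0)" by blast
          then have "(\<Prod>j\<in>K. g j (y j)) * g m (s - S y) = 0" using K by (auto simp: prod_zero_iff)
          moreover have "\<not> D (\<lambda>i\<in>K. y i / s)" using no Dy by blast
          then have "h (\<lambda>i\<in>K. y i / s) s = 0" by (simp add: h_def)
          ultimately show ?thesis by (simp only: mult_zero_right)
        qed
        then show "ennreal ((1 / s) ^ card K) * ennreal (h (\<lambda>i\<in>K. y i / s) s) = (\<Prod>j\<in>K. ennreal (g j (y j))) * ennreal (g m (s - S y))"
          using True g0 by (simp add: ennreal_mult'[symmetric] prod_ennreal prod_nonneg)
      qed
      finally show ?thesis .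
    next
      case False
      have prod0: "(\<Prod>j\<in>K. ennreal (g j (y j))) * ennreal (g m (s - S y)) = 0" for y
      proof (cases "\<forall>j\<in>K. 0 < y j")
        case True
        then have "0 \<le> S y" unfolding S_def by (intro sum_nonneg) (auto intro: less_imp_le)
        then show ?thesis using False by (simp add: g_def)
      next
        case no: False
        then obtain j where "j \<in> K" "g j (y j) = 0" by (auto simp: g_def)
        then have "(\<Prod>j\<in>K. ennreal (g j (y j))) = 0" using K by (intro prod_zero bexI[of _ j]) simp_all
        then show ?thesis by simp
      qed
      have "h x s = 0" for x using False by (simp add: h_def)
      then show ?thesis by (simp only: prod0 ennreal_0)
    qed
  qed
  also have "\<dots> = (\<integral>\<^sup>+y. (\<integral>\<^sup>+s. (\<Prod>j\<in>K. ennreal (g j (y j))) * ennreal (g m (s - S y)) \<partial>lborel) \<partial>?P)"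
  proof (rule PP.Fubini')
    have [measurable]: "(\<lambda>y. \<Prod>j\<in>K. ennreal (g j (y j))) \<in> borel_measurable ?P"
      by (intro borel_measurable_prod_ennreal) (use sK in measurable)
    show "(\<lambda>(y, s). (\<Prod>j\<in>K. ennreal (g j (y j))) * ennreal (g m (s - S y))) \<in> borel_measurable (?P \<Otimes>\<^sub>M lborel)"
      by measurable
  qed
  also have "\<dots> = (\<integral>\<^sup>+y. (\<Prod>j\<in>K. ennreal (g j (y j))) * ennreal (Gamma (p m) * c m powr (- p m)) \<partial>?P)"
  proof (rule nn_integral_cong)
    fix y
    have "(\<integral>\<^sup>+s. ennreal (g m (s - S y)) \<partial>lborel) = (\<integral>\<^sup>+s. ennreal (g m s) \<partial>lborel)"
      using nn_integral_real_affine[of "\<lambda>s. ennreal (g m (s - S y))" 1 "S y"] by simp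
    also have "\<dots> = ennreal (Gamma (p m) * c m powr (- p m))"
      unfolding g_def using p c J by (intro nn_integral_gamma_scaled) auto
    finally show "(\<integral>\<^sup>+s. (\<Prod>j\<in>K. ennreal (g j (y j))) * ennreal (g m (s - S y)) \<partial>lborel) = (\<Prod>j\<in>K. ennreal (g j (y j))) * ennreal (Gamma (p m) * c m powr (- p m))"
      by (simp add: nn_integral_cmult)
  qed
  also have "\<dots> = (\<integral>\<^sup>+y. (\<Prod>j\<in>K. ennreal (g j (y j))) \<partial>?P) * ennreal (Gamma (p m) * c m powr (- p m))"
    by (intro nn_integral_multc borel_measurable_prod_ennreal) (use sK in measurable)
  also have "(\<integral>\<^sup>+y. (\<Prod>j\<in>K. ennreal (g j (y j))) \<partial>?P) = (\<Prod>j\<in>K. \<integral>\<^sup>+u. ennreal (g j u) \<partial>lborel)"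
    by (rule lborel_PiM.product_nn_integral_prod) (use K in auto)
  also have "\<dots> = (\<Prod>j\<in>K. ennreal (Gamma (p j) * c j powr (- p j)))"
    unfolding g_def using p c K by (intro prod.cong refl nn_integral_gamma_scaled) auto
  also have "\<dots> * ennreal (Gamma (p m) * c m powr (- p m)) = (\<Prod>j\<in>J. ennreal (Gamma (p j) * c j powr (- p j)))"
    using K by (simp add: mult.commute)
  also have "\<dots> = ennreal (\<Prod>j\<in>J. Gamma (p j) * c j powr (- p j))"
    using p by (intro prod_ennreal) (auto intro!: mult_nonneg_nonneg less_imp_le[OF Gamma_real_pos])
  also have "ennreal \<kappa> * \<dots> = ennreal (\<Prod>j\<in>J. c j powr (- p j))"
  proof -
    have "0 < (\<Prod>j\<in>J. Gamma (p j))" using p by (intro prod_pos Gamma_real_pos) auto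
    then have "\<kappa> * (\<Prod>j\<in>J. Gamma (p j) * c j powr (- p j)) = (\<Prod>j\<in>J. c j powr (- p j))"
      by (simp add: \<kappa>_def prod.distrib)
    then show ?thesis using \<kappa> by (simp add: ennreal_mult'[symmetric])
  qed
  finally show ?thesis by (simp add: W_def S_def a_def)
qed

section \<open>The Markov-Krein identity for positive functions\<close>

lemma borel_measurable_dirichlet_density:
  assumes J: "finite J" "m \<in> J"
  shows "dirichlet_density J m p \<in> borel_measurable (PiM (J - {m}) (\<lambda>_. lborel))"
proof -
  let ?P = "PiM (J - {m}) (\<lambda>_. lborel :: real measure)"
  have [measurable]: "(\<lambda>x. x j) \<in> borel_measurable ?P" if "j \<in> J - {m}" for j
    using measurable_component_singleton[of j "J - {m}" "\<lambda>_. lborel :: real measure"] that by simp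
  have [measurable]: "(\<lambda>x. \<Sum>j\<in>J - {m}. x j) \<in> borel_measurable ?P"
    by (intro borel_measurable_sum) measurable
  have [measurable]: "(\<lambda>x. \<Prod>j\<in>J - {m}. x j powr (p j - 1)) \<in> borel_measurable ?P"
    by (intro borel_measurable_prod) measurable
  have [measurable]: "Measurable.pred ?P (\<lambda>x. \<forall>j\<in>J - {m}. 0 < x j)"
  proof (rule pred_intros_finite)
    show "finite (J - {m})" using J by simp
    fix j assume "j \<in> J - {m}"
    then show "Measurable.pred ?P (\<lambda>x. 0 < x j)" by measurable
  qed
  show ?thesis unfolding dirichlet_density_def by measurable
qed

text \<open>
  Reduces to the coordinates with positive parameter.  The law only records the first \<open>n\<close> components,
  hence the last one is expressed through the others.
\<close>
lemma nn_integral_dirichlet_distribution: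
  fixes p c :: "nat \<Rightarrow> real"
  assumes p: "\<And>i. i \<le> n \<Longrightarrow> 0 \<le> p i" and a: "a = (\<Sum>i\<le>n. p i)" "0 < a" and c: "\<And>i. i \<le> n \<Longrightarrow> 0 < c i"
  shows "(\<integral>\<^sup>+v. ennreal (((\<Sum>i<n. c i * v i) + c n * (1 - (\<Sum>i<n. v i))) powr (- a)) \<partial>dirichlet_distribution n p)
     = ennreal (\<Prod>i\<le>n. c i powr (- p i))"
proof -
  define J where "J = {i. i \<le> n \<and> 0 < p i}"
  define m where "m = Max J"
  define K where "K = J - {m}"
  let ?P = "PiM K (\<lambda>_. lborel :: real measure)"
  have fin: "finite J" by (simp add: J_def)
  have aJ: "a = (\<Sum>j\<in>J. p j)"
    unfolding a by (rule sum.mono_neutral_right) (use p in \<open>auto simp: J_def not_less intro: antisym\<close>)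
  then have "J \<noteq> {}" using a by auto
  then have m: "m \<in> J" and le_m: "\<And>j. j \<in> J \<Longrightarrow> j \<le> m" using fin by (auto simp: m_def)
  have mn: "m \<le> n" using m by (auto simp: J_def)
  define T where "T x = (\<lambda>i\<in>{..<n}. if i = m then 1 - (\<Sum>j\<in>K. x j) else if i \<in> J then x i else 0)" for x :: "nat \<Rightarrow> real"
  define F where "F v = ((\<Sum>i<n. c i * v i) + c n * (1 - (\<Sum>i<n. v i))) powr (- a)" for v :: "nat \<Rightarrow> real"
  have xm [measurable]: "(\<lambda>x. x j) \<in> borel_measurable ?P" if "j \<in> K" for j
    using measurable_component_singleton[of j K "\<lambda>_. lborel :: real measure"] that by simp
  have [measurable]: "T \<in> ?P \<rightarrow>\<^sub>M PiM {..<n} (\<lambda>_. borel)"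
    unfolding T_def
  proof (rule measurable_restrict)
    fix i assume "i \<in> {..<n}"
    have "(\<lambda>x. \<Sum>j\<in>K. x j) \<in> borel_measurable ?P" by (intro borel_measurable_sum) measurable
    then show "(\<lambda>x. if i = m then 1 - (\<Sum>j\<in>K. x j) else if i \<in> J then x i else 0) \<in> ?P \<rightarrow>\<^sub>M borel"
      by (cases "i = m"; cases "i \<in> J") (auto simp: K_def intro!: xm[unfolded K_def])
  qed
  have vm: "(\<lambda>v. v i) \<in> borel_measurable (PiM {..<n} (\<lambda>_. borel :: real measure))" if "i < n" for i
    using that by (intro measurable_component_singleton) auto
  have [measurable]: "F \<in> borel_measurable (PiM {..<n} (\<lambda>_. borel))"
    unfolding F_def
    by (intro powr_real_measurable borel_measurable_add borel_measurable_times borel_measurable_diff borel_measurable_sum vm) auto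
  have [measurable]: "dirichlet_density J m p \<in> borel_measurable ?P"
    unfolding K_def by (rule borel_measurable_dirichlet_density[OF fin m])
  have FT: "F (T x) = ((\<Sum>j\<in>K. c j * x j) + c m * (1 - (\<Sum>j\<in>K. x j))) powr (- a)" for x
  proof -
    have T: "(\<Sum>i<n. f i * T x i) = (\<Sum>i\<in>K. f i * x i) + (if m < n then f m * (1 - (\<Sum>j\<in>K. x j)) else 0)" for f :: "nat \<Rightarrow> real"
    proof -
      have KJ: "i < n" if "i \<in> K" for i using that le_m[of i] mn by (auto simp: K_def)
      have "(\<Sum>i<n. f i * T x i) = (\<Sum>i<n. (if i \<in> K then f i * x i else 0) + (if i = m then f m * (1 - (\<Sum>j\<in>K. x j)) else 0))"
        by (intro sum.cong) (auto simp: T_def K_def)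
      also have "\<dots> = (\<Sum>i<n. if i \<in> K then f i * x i else 0) + (\<Sum>i<n. if i = m then f m * (1 - (\<Sum>j\<in>K. x j)) else 0)"
        by (rule sum.distrib)
      also have "(\<Sum>i<n. if i \<in> K then f i * x i else 0) = (\<Sum>i\<in>{..<n} \<inter> K. f i * x i)"
        by (simp add: sum.inter_restrict)
      also have "{..<n} \<inter> K = K" using KJ by auto
      finally show ?thesis by simp
    qed
    show ?thesis using T[of c] T[of "\<lambda>_. 1"] mn by (cases "m < n") (auto simp: F_def)
  qed
  have dd: "dirichlet_distribution n p = distr (density ?P (\<lambda>x. ennreal (dirichlet_density J m p x))) (PiM {..<n} (\<lambda>_. borel)) T"
    by (simp only: dirichlet_distribution_def Let_def T_def[abs_def] K_def m_def J_def)
  have "(\<integral>\<^sup>+v. ennreal (F v) \<partial>dirichlet_distribution n p) = (\<integral>\<^sup>+x. ennreal (F (T x)) \<partial>density ?P (\<lambda>x. ennreal (dirichlet_density J m p x)))"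
    unfolding dd by (subst nn_integral_distr) auto
  also have "\<dots> = (\<integral>\<^sup>+x. ennreal (dirichlet_density J m p x) * ennreal (F (T x)) \<partial>?P)"
    by (subst nn_integral_density) auto
  also have "\<dots> = ennreal (\<Prod>j\<in>J. c j powr (- p j))"
    unfolding FT aJ K_def by (rule dirichlet_integral) (use fin m c in \<open>auto simp: J_def\<close>)
  also have "(\<Prod>j\<in>J. c j powr (- p j)) = (\<Prod>i\<le>n. c i powr (- p i))"
  proof (rule prod.mono_neutral_left)
    show "\<forall>i\<in>{..n} - J. c i powr (- p i) = 1"
    proof
      fix i assume "i \<in> {..n} - J"
      then have "p i = 0" "0 < c i" using p[of i] c[of i] by (auto simp: J_def)
      then show "c i powr (- p i) = 1" by simp
    qed
  qed (auto simp: J_def)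
  finally show ?thesis by (simp add: F_def)
qed

text \<open>
  The standing hypotheses; push-forwards of the process interpret the same locale.
\<close>
locale dirichlet_process_space = prob_space M + \<alpha>: finite_measure \<alpha>
  for M :: "'w measure" and \<alpha> :: "real measure" +
  fixes \<phi> :: "'w \<Rightarrow> real measure" and a :: real
  assumes sets_\<alpha> [measurable_cong]: "sets \<alpha> = sets borel"
    and a_eq: "a = measure \<alpha> UNIV" and a_pos: "0 < a"
    and DP: "dirichlet_process M \<alpha> \<phi>"
begin

lemma space_\<alpha> [simp]: "space \<alpha> = UNIV"
  using sets_eq_imp_space_eq[OF sets_\<alpha>] by simp

lemma \<phi>_measurable: "\<phi> \<in> M \<rightarrow>\<^sub>M prob_algebra borel"
  using DP by (simp add: dirichlet_process_def)

lemma \<phi>_subprob [measurable]: "\<phi> \<in> M \<rightarrow>\<^sub>M subprob_algebra borel"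
  using \<phi>_measurable by (rule measurable_prob_algebraD)

lemma \<phi>_prob:
  assumes "\<omega> \<in> space M"
  shows "prob_space (\<phi> \<omega>)" "sets (\<phi> \<omega>) = sets borel" "space (\<phi> \<omega>) = UNIV"
  using measurable_space[OF \<phi>_measurable assms] sets_eq_imp_space_eq[of "\<phi> \<omega>" borel]
  by (auto simp: space_prob_algebra)

lemma integral_\<phi>_measurable:
  fixes f :: "real \<Rightarrow> real"
  assumes "f \<in> borel_measurable borel"
  shows "(\<lambda>\<omega>. \<integral>x. f x \<partial>\<phi> \<omega>) \<in> borel_measurable M"
  using measurable_compose[OF \<phi>_subprob integral_measurable_subprob_algebra[OF assms]] .

lemma integrable_\<phi>_bounded:
  fixes f :: "real \<Rightarrow> real"
  assumes "\<omega> \<in> space M" "f \<in> borel_measurable borel" "\<And>x. \<bar>f x\<bar> \<le> B"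
  shows "integrable (\<phi> \<omega>) f"
proof -
  interpret \<phi>: prob_space "\<phi> \<omega>" by (rule \<phi>_prob[OF assms(1)])
  show ?thesis using assms(2,3) \<phi>_prob(2)[OF assms(1)]
    by (intro \<phi>.integrable_const_bound[of _ B]) (auto cong: measurable_cong_sets)
qed

lemma markov_krein_partition:
  fixes n :: nat and C :: "nat \<Rightarrow> real set" and c :: "nat \<Rightarrow> real"
  assumes C: "\<And>i. i \<le> n \<Longrightarrow> C i \<in> sets borel" "disjoint_family_on C {..n}" "(\<Union>i\<le>n. C i) = UNIV"
    and c: "\<And>i. i \<le> n \<Longrightarrow> 0 < c i"
  shows "(\<integral>\<^sup>+\<omega>. ennreal ((\<Sum>i\<le>n. c i * measure (\<phi> \<omega>) (C i)) powr (- a)) \<partial>M)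
    = ennreal (exp (- (\<Sum>i\<le>n. ln (c i) * measure \<alpha> (C i))))"
proof -
  let ?F = "\<lambda>v. ennreal (((\<Sum>i<n. c i * v i) + c n * (1 - (\<Sum>i<n. v i))) powr (- a))"
  let ?X = "\<lambda>\<omega>. \<lambda>i\<in>{..<n}. measure (\<phi> \<omega>) (C i)"
  have total: "(\<Sum>i\<le>n. measure \<mu> (C i)) = measure \<mu> UNIV" if "finite_measure \<mu>" "sets \<mu> = sets borel" for \<mu>
  proof -
    interpret \<mu>: finite_measure \<mu> by fact
    have "C ` {..n} \<subseteq> sets \<mu>" using C(1) that(2) by auto
    from \<mu>.finite_measure_finite_Union[OF finite_atMost this C(2)] show ?thesis using C(3) by simp
  qed
  have vm: "(\<lambda>v. v i) \<in> borel_measurable (PiM {..<n} (\<lambda>_. borel :: real measure))" if "i < n" for i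
    using that by (intro measurable_component_singleton) auto
  have F: "?F \<in> borel_measurable (PiM {..<n} (\<lambda>_. borel))"
    by (intro measurable_compose[OF _ measurable_ennreal] powr_real_measurable borel_measurable_add borel_measurable_times borel_measurable_diff borel_measurable_sum vm) auto
  have X: "?X \<in> M \<rightarrow>\<^sub>M PiM {..<n} (\<lambda>_. borel)"
    by (intro measurable_restrict measurable_compose[OF \<phi>_subprob measurable_measure_subprob_algebra] C) auto
  have "(\<integral>\<^sup>+\<omega>. ennreal ((\<Sum>i\<le>n. c i * measure (\<phi> \<omega>) (C i)) powr (- a)) \<partial>M) = (\<integral>\<^sup>+\<omega>. ?F (?X \<omega>) \<partial>M)"
  proof (rule nn_integral_cong)
    fix \<omega> assume \<omega>: "\<omega> \<in> space M"
    interpret \<phi>: prob_space "\<phi> \<omega>" by (rule \<phi>_prob[OF \<omega>])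
    have "(\<Sum>i\<le>n. measure (\<phi> \<omega>) (C i)) = 1"
      using total[of "\<phi> \<omega>"] \<phi>.prob_space \<phi>_prob[OF \<omega>] \<phi>.finite_measure_axioms by simp
    then have "measure (\<phi> \<omega>) (C n) = 1 - (\<Sum>i<n. measure (\<phi> \<omega>) (C i))"
      by (simp flip: lessThan_Suc_atMost)
    then show "ennreal ((\<Sum>i\<le>n. c i * measure (\<phi> \<omega>) (C i)) powr (- a)) = ?F (?X \<omega>)"
      by (simp flip: lessThan_Suc_atMost)
  qed
  also have "\<dots> = (\<integral>\<^sup>+v. ?F v \<partial>distr M (PiM {..<n} (\<lambda>_. borel)) ?X)"
    by (rule nn_integral_distr[OF X, symmetric], unfold measurable_distr_eq1, rule F)
  also have "distr M (PiM {..<n} (\<lambda>_. borel)) ?X = dirichlet_distribution n (\<lambda>i. measure \<alpha> (C i))"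
    using DP C unfolding dirichlet_process_def by blast
  also have "(\<integral>\<^sup>+v. ?F v \<partial>dirichlet_distribution n (\<lambda>i. measure \<alpha> (C i))) = ennreal (\<Prod>i\<le>n. c i powr (- measure \<alpha> (C i)))"
    by (rule nn_integral_dirichlet_distribution)
      (use c a_pos total[OF \<alpha>.finite_measure_axioms sets_\<alpha>] in \<open>auto simp: a_eq\<close>)
  also have "(\<Prod>i\<le>n. c i powr (- measure \<alpha> (C i))) = (\<Prod>i\<le>n. exp (- (ln (c i) * measure \<alpha> (C i))))"
    by (intro prod.cong refl) (use c in \<open>force simp: powr_def mult.commute\<close>)
  also have "\<dots> = exp (- (\<Sum>i\<le>n. ln (c i) * measure \<alpha> (C i)))"
    by (simp add: exp_sum[symmetric] sum_negf)
  finally show ?thesis .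
qed

lemma markov_krein_simple:
  fixes g :: "real \<Rightarrow> real"
  assumes g: "simple_function borel g" and pos: "\<And>x. 0 < g x"
  shows "(\<integral>\<^sup>+\<omega>. ennreal ((\<integral>x. g x \<partial>\<phi> \<omega>) powr (- a)) \<partial>M) = ennreal (exp (- (\<integral>x. ln (g x) \<partial>\<alpha>)))"
proof -
  have "finite (range g)" using simple_functionD(1)[OF g] by simp
  from finite_imp_nat_seg_image_inj_on[OF this]
  obtain n' :: nat and c where c: "range g = c ` {i. i < n'}" "inj_on c {i. i < n'}"
    by (elim exE conjE) (rule that)
  have "n' \<noteq> 0"
  proof
    assume "n' = 0"
    with c(1) have "range g = {}" by simp
    then show False by blast
  qed
  then obtain n where n': "n' = Suc n" using not0_implies_Suc by blast
  have "{i. i < n'} = {..n}" by (auto simp: n')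
  with c have c: "range g = c ` {..n}" "inj_on c {..n}" by simp_all
  define C where "C i = g -` {c i}" for i
  have Cm: "C i \<in> sets borel" for i
    using simple_functionD(2)[OF g, of "{c i}"] by (simp add: C_def)
  have disj: "disjoint_family_on C {..n}"
    using c(2) by (auto simp: disjoint_family_on_def C_def inj_on_def)
  have gc: "\<exists>i\<le>n. g x = c i" for x using c(1) by blast
  have "x \<in> (\<Union>i\<le>n. C i)" for x using gc[of x] by (auto simp: C_def)
  then have un: "(\<Union>i\<le>n. C i) = UNIV" by blast
  have dec: "f (g x) = (\<Sum>i\<le>n. f (c i) * indicator (C i) x)" for f :: "real \<Rightarrow> real" and x
  proof -
    obtain k where k: "k \<le> n" "g x = c k" using gc[of x] by auto
    then have "x \<in> C i \<longleftrightarrow> i = k" if "i \<le> n" for i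
      using c(2) that by (auto simp: C_def inj_on_def)
    then have "(\<Sum>i\<le>n. f (c i) * indicator (C i) x) = (\<Sum>i\<le>n. if i = k then f (c k) else 0)"
      by (intro sum.cong) (auto simp: indicator_def)
    then show ?thesis using k by simp
  qed
  have int: "(\<integral>x. f (g x) \<partial>\<mu>) = (\<Sum>i\<le>n. f (c i) * measure \<mu> (C i))"
    if "finite_measure \<mu>" "sets \<mu> = sets borel" for \<mu> and f :: "real \<Rightarrow> real"
  proof -
    interpret \<mu>: finite_measure \<mu> by fact
    show ?thesis unfolding dec using Cm that(2)
      by (subst Bochner_Integration.integral_sum) (auto simp: \<mu>.emeasure_finite less_top[symmetric] cong: measurable_cong_sets)
  qed
  have "(\<integral>\<^sup>+\<omega>. ennreal ((\<integral>x. g x \<partial>\<phi> \<omega>) powr (- a)) \<partial>M) = (\<integral>\<^sup>+\<omega>. ennreal ((\<Sum>i\<le>n. c i * measure (\<phi> \<omega>) (C i)) powr (- a)) \<partial>M)"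
  proof (rule nn_integral_cong)
    fix \<omega> assume \<omega>: "\<omega> \<in> space M"
    interpret \<phi>: prob_space "\<phi> \<omega>" by (rule \<phi>_prob[OF \<omega>])
    show "ennreal ((\<integral>x. g x \<partial>\<phi> \<omega>) powr (- a)) = ennreal ((\<Sum>i\<le>n. c i * measure (\<phi> \<omega>) (C i)) powr (- a))"
      using int[OF \<phi>.finite_measure_axioms, of "\<lambda>x. x"] \<phi>_prob[OF \<omega>] by simp
  qed
  also have "\<dots> = ennreal (exp (- (\<Sum>i\<le>n. ln (c i) * measure \<alpha> (C i))))"
  proof (rule markov_krein_partition[OF Cm disj un])
    show "0 < c i" if "i \<le> n" for i
    proof -
      from c(1) that obtain x where "g x = c i" by (metis atMost_iff imageI rangeE)
      then show ?thesis using pos[of x] by simp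
    qed
  qed
  also have "(\<Sum>i\<le>n. ln (c i) * measure \<alpha> (C i)) = (\<integral>x. ln (g x) \<partial>\<alpha>)"
    using int[OF \<alpha>.finite_measure_axioms sets_\<alpha>, of ln] by simp
  finally show ?thesis .
qed

lemma markov_krein_real:
  fixes h :: "real \<Rightarrow> real"
  assumes h [measurable]: "h \<in> borel_measurable borel" and e: "0 < e" and lo: "\<And>x. e \<le> h x" and hi: "\<And>x. h x \<le> B"
  shows "(\<integral>\<omega>. (\<integral>x. h x \<partial>\<phi> \<omega>) powr (- a) \<partial>M) = exp (- (\<integral>x. ln (h x) \<partial>\<alpha>))"
proof -
  obtain s where s: "\<And>i. simple_function borel (s i)" "\<And>x. (\<lambda>i. s i x) \<longlonglongrightarrow> h x" "\<And>i x. dist (s i x) 0 \<le> 2 * dist (h x) 0"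
    using borel_measurable_implies_sequence_metric[OF h, of 0] by auto
  define g where "g i x = max e (s i x)" for i x
  have sg: "simple_function borel (g i)" for i
    unfolding g_def by (rule simple_function_compose1[OF s(1)])
  have gm [measurable]: "g i \<in> borel_measurable borel" for i by (rule borel_measurable_simple_function[OF sg])
  define D where "D = max e (2 * B)"
  have D: "e \<le> D" by (simp add: D_def)
  have g_lo: "e \<le> g i x" and g_hi: "g i x \<le> D" for i x
  proof -
    have "s i x \<le> 2 * B" using s(3)[of i x] lo[of x] hi[of x] e by simp
    then show "e \<le> g i x" "g i x \<le> D" by (auto simp: g_def D_def)
  qed
  have g_lim: "(\<lambda>i. g i x) \<longlonglongrightarrow> h x" for x
  proof -
    have "(\<lambda>i. max e (s i x)) \<longlonglongrightarrow> max e (h x)" by (intro tendsto_intros s)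
    then show ?thesis using lo[of x] by (simp add: g_def max_def)
  qed
  have g_abs: "\<bar>g i x\<bar> \<le> D" "\<bar>ln (g i x)\<bar> \<le> \<bar>ln e\<bar> + \<bar>ln D\<bar>" for i x
  proof -
    have "0 < g i x" using g_lo[of i x] e by simp
    then have "ln e \<le> ln (g i x)" "ln (g i x) \<le> ln D"
      using g_lo[of i x] g_hi[of i x] e by simp_all
    then show "\<bar>ln (g i x)\<bar> \<le> \<bar>ln e\<bar> + \<bar>ln D\<bar>" by linarith
    show "\<bar>g i x\<bar> \<le> D" using \<open>0 < g i x\<close> g_hi[of i x] by simp
  qed
  have h_lim: "(\<lambda>i. \<integral>x. g i x \<partial>\<phi> \<omega>) \<longlonglongrightarrow> (\<integral>x. h x \<partial>\<phi> \<omega>)" and g_int: "e \<le> (\<integral>x. g i x \<partial>\<phi> \<omega>)"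
    and h_int: "e \<le> (\<integral>x. h x \<partial>\<phi> \<omega>)" if \<omega>: "\<omega> \<in> space M" for \<omega> i
  proof -
    interpret \<phi>: prob_space "\<phi> \<omega>" by (rule \<phi>_prob[OF \<omega>])
    note [measurable_cong] = \<phi>_prob(2)[OF \<omega>]
    show "(\<lambda>i. \<integral>x. g i x \<partial>\<phi> \<omega>) \<longlonglongrightarrow> (\<integral>x. h x \<partial>\<phi> \<omega>)"
      by (rule integral_dominated_convergence[where w = "\<lambda>_. D"]) (use g_lim g_abs in \<open>auto simp: measurable_cong_sets[OF \<phi>_prob(2)[OF \<omega>] refl]\<close>)
    have I: "e \<le> (\<integral>x. g i x \<partial>\<phi> \<omega>)" for i
      using \<omega> g_abs g_lo by (intro \<phi>.integral_ge_const integrable_\<phi>_bounded[of _ _ D]) auto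
    then show "e \<le> (\<integral>x. g i x \<partial>\<phi> \<omega>)" .
    show "e \<le> (\<integral>x. h x \<partial>\<phi> \<omega>)"
      using \<open>(\<lambda>i. \<integral>x. g i x \<partial>\<phi> \<omega>) \<longlonglongrightarrow> _\<close> I by (intro LIMSEQ_le_const) auto
  qed
  have "(\<lambda>i. \<integral>\<omega>. (\<integral>x. g i x \<partial>\<phi> \<omega>) powr (- a) \<partial>M) \<longlonglongrightarrow> (\<integral>\<omega>. (\<integral>x. h x \<partial>\<phi> \<omega>) powr (- a) \<partial>M)"
  proof (rule integral_dominated_convergence[where w = "\<lambda>_. e powr (- a)"])
    show "(\<lambda>\<omega>. (\<integral>x. h x \<partial>\<phi> \<omega>) powr (- a)) \<in> borel_measurable M"
      "\<And>i. (\<lambda>\<omega>. (\<integral>x. g i x \<partial>\<phi> \<omega>) powr (- a)) \<in> borel_measurable M"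
      by (intro powr_real_measurable integral_\<phi>_measurable; simp)+
    show "AE \<omega> in M. (\<lambda>i. (\<integral>x. g i x \<partial>\<phi> \<omega>) powr (- a)) \<longlonglongrightarrow> (\<integral>x. h x \<partial>\<phi> \<omega>) powr (- a)"
    proof (rule AE_I2)
      fix \<omega> assume \<omega>: "\<omega> \<in> space M"
      show "(\<lambda>i. (\<integral>x. g i x \<partial>\<phi> \<omega>) powr (- a)) \<longlonglongrightarrow> (\<integral>x. h x \<partial>\<phi> \<omega>) powr (- a)"
        using h_lim[OF \<omega>] h_int[OF \<omega>] e by (intro tendsto_powr tendsto_const) auto
    qed
    show "AE \<omega> in M. norm ((\<integral>x. g i x \<partial>\<phi> \<omega>) powr (- a)) \<le> e powr (- a)" for i
      using g_int e a_pos by (intro AE_I2) (auto intro!: powr_mono2')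
  qed simp
  moreover have "(\<lambda>i. exp (- (\<integral>x. ln (g i x) \<partial>\<alpha>))) \<longlonglongrightarrow> exp (- (\<integral>x. ln (h x) \<partial>\<alpha>))"
  proof (intro tendsto_exp tendsto_minus integral_dominated_convergence[where w = "\<lambda>_. \<bar>ln e\<bar> + \<bar>ln D\<bar>"])
    show "AE x in \<alpha>. (\<lambda>i. ln (g i x)) \<longlonglongrightarrow> ln (h x)"
      using e lo by (intro AE_I2 tendsto_ln g_lim) (metis less_le_trans less_irrefl)
    show "AE x in \<alpha>. norm (ln (g i x)) \<le> \<bar>ln e\<bar> + \<bar>ln D\<bar>" for i using g_abs by simp
  qed auto
  moreover have "(\<integral>\<omega>. (\<integral>x. g i x \<partial>\<phi> \<omega>) powr (- a) \<partial>M) = exp (- (\<integral>x. ln (g i x) \<partial>\<alpha>))" for i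
  proof -
    have "0 < g i x" for x using g_lo[of i x] e by simp
    from markov_krein_simple[OF sg this] show ?thesis
      by (intro integral_eq_nn_integral[THEN trans]) (auto intro!: powr_real_measurable integral_\<phi>_measurable)
  qed
  ultimately show ?thesis using LIMSEQ_unique by simp
qed

end

section \<open>Null sets, finite moments and the complex Markov-Krein identity\<close>

lemma norm_Ln_le:
  assumes "0 < d" "d \<le> norm w" "norm w \<le> D"
  shows "norm (Ln w) \<le> \<bar>ln d\<bar> + \<bar>ln D\<bar> + pi"
proof -
  have w: "w \<noteq> 0" using assms by auto
  have "norm (Ln w) \<le> \<bar>Re (Ln w)\<bar> + \<bar>Im (Ln w)\<bar>" by (rule cmod_le)
  moreover have "\<bar>Im (Ln w)\<bar> \<le> pi" using mpi_less_Im_Ln[OF w] Im_Ln_le_pi[OF w] by simp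
  moreover have "ln d \<le> ln (norm w)" "ln (norm w) \<le> ln D" using assms w by simp_all
  then have "\<bar>Re (Ln w)\<bar> \<le> \<bar>ln d\<bar> + \<bar>ln D\<bar>" using w by simp
  ultimately show ?thesis by linarith
qed

lemma abs_ln_one_plus_mono:
  fixes u v :: real
  assumes "0 \<le> u" "u \<le> v"
  shows "\<bar>ln (1 + u)\<bar> \<le> ln (1 + v)"
proof -
  have "0 < 1 + u" "1 + u \<le> 1 + v" "1 \<le> 1 + u" using assms by auto
  then show ?thesis by (simp add: ln_ge_zero)
qed

lemma ball_Re_gt:
  assumes "w \<in> ball z ((Re z - s) / 2)"
  shows "(Re z - s) / 2 < Re w - s"
  using assms abs_Re_le_cmod[of "z - w"] by (auto simp: dist_norm)

lemma norm_ge_Re_minus: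
  assumes "0 < d" "d \<le> Re w - s" "y \<le> s"
  shows "d \<le> norm (w - complex_of_real y)"
  using assms complex_Re_le_cmod[of "w - complex_of_real y"] by simp

context dirichlet_process_space begin

lemma integral_\<phi>_bounds:
  fixes h :: "real \<Rightarrow> real"
  assumes h: "h \<in> borel_measurable borel" and b: "\<And>x. \<bar>h x\<bar> \<le> B" and s: "\<And>x. h x \<le> s" and \<omega>: "\<omega> \<in> space M"
  shows "(\<integral>x. h x \<partial>\<phi> \<omega>) \<le> s" "- B \<le> (\<integral>x. h x \<partial>\<phi> \<omega>)"
proof -
  interpret \<phi>: prob_space "\<phi> \<omega>" by (rule \<phi>_prob[OF \<omega>])
  have i: "integrable (\<phi> \<omega>) h" by (rule integrable_\<phi>_bounded[OF \<omega> h b])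
  show "(\<integral>x. h x \<partial>\<phi> \<omega>) \<le> s" by (intro \<phi>.integral_le_const i AE_I2 s)
  have "- B \<le> h x" for x using b[of x] by simp
  then show "- B \<le> (\<integral>x. h x \<partial>\<phi> \<omega>)" by (intro \<phi>.integral_ge_const i AE_I2)
qed

text \<open>
  The Markov-Krein identity for \<open>1 + indicator N\<close> says that \<open>(1 + \<phi>(N)) powr -a\<close>, which is at most 1,
  has expectation 1.
\<close>
lemma AE_null_set:
  assumes N: "N \<in> sets borel" "emeasure \<alpha> N = 0"
  shows "AE \<omega> in M. AE x in \<phi> \<omega>. x \<notin> N"
proof -
  define h where "h x = 1 + (indicator N x :: real)" for x
  have hm: "h \<in> borel_measurable borel" unfolding h_def using N by measurable
  have hb: "\<bar>h x\<bar> \<le> 2" "1 \<le> h x" "h x \<le> 2" for x by (auto simp: h_def indicator_def)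
  define X where "X \<omega> = (\<integral>x. h x \<partial>\<phi> \<omega>) powr (- a)" for \<omega>
  have X_eq: "(\<integral>x. h x \<partial>\<phi> \<omega>) = 1 + measure (\<phi> \<omega>) N" if \<omega>: "\<omega> \<in> space M" for \<omega>
  proof -
    interpret \<phi>: prob_space "\<phi> \<omega>" by (rule \<phi>_prob[OF \<omega>])
    have "measure (\<phi> \<omega>) UNIV = 1" using \<phi>.prob_space \<phi>_prob(3)[OF \<omega>] by simp
    then show ?thesis unfolding h_def using N \<phi>_prob[OF \<omega>]
      by (subst Bochner_Integration.integral_add) (auto simp: \<phi>.emeasure_finite less_top[symmetric])
  qed
  have Xm: "X \<in> borel_measurable M" unfolding X_def by (intro powr_real_measurable integral_\<phi>_measurable hm) simp
  have X1: "X \<omega> \<le> 1" "0 \<le> X \<omega>" if "\<omega> \<in> space M" for \<omega>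
    unfolding X_def X_eq[OF that] using a_pos by (auto simp: powr_minus intro!: inverse_le_1_iff[THEN iffD2] ge_one_powr_ge_zero)
  have "AE x in \<alpha>. ln (h x) = 0"
  proof -
    have "AE x in \<alpha>. x \<notin> N" using N by (intro AE_not_in) (auto simp: null_sets_def sets_\<alpha>)
    then show ?thesis by eventually_elim (simp add: h_def)
  qed
  then have "(\<integral>x. ln (h x) \<partial>\<alpha>) = 0" by (rule integral_eq_zero_AE)
  then have E: "(\<integral>\<omega>. X \<omega> \<partial>M) = 1"
    unfolding X_def using markov_krein_real[OF hm, of 1 2] hb by simp
  have Xi: "integrable M X"
    using Xm X1 by (intro integrable_const_bound[of _ 1]) auto
  have "(\<integral>\<omega>. 1 - X \<omega> \<partial>M) = 0" using E Xi by (simp add: prob_space)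
  then have "AE \<omega> in M. 1 - X \<omega> = 0"
    using Xi X1 by (subst (asm) integral_nonneg_eq_0_iff_AE) auto
  then show ?thesis using AE_space
  proof eventually_elim
    case (elim \<omega>)
    interpret \<phi>: prob_space "\<phi> \<omega>" by (rule \<phi>_prob[OF elim(2)])
    have "measure (\<phi> \<omega>) N = 0"
    proof (rule ccontr)
      assume "measure (\<phi> \<omega>) N \<noteq> 0"
      then have "0 < measure (\<phi> \<omega>) N" by (simp add: zero_less_measure_iff)
      then have "1 < (1 + measure (\<phi> \<omega>) N) powr a" using a_pos powr_less_mono2[of a 1 "1 + measure (\<phi> \<omega>) N"] by simp
      then have "X \<omega> < 1" unfolding X_def X_eq[OF elim(2)] by (simp add: powr_minus inverse_less_1_iff)
      then show False using elim(1) by simp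
    qed
    then show "AE x in \<phi> \<omega>. x \<notin> N"
      using N \<phi>_prob[OF elim(2)] by (intro AE_not_in) (auto simp: null_sets_def \<phi>.emeasure_eq_measure)
  qed
qed

text \<open>
  For \<open>l > 0\<close> the Markov-Krein identity for \<open>1 + l min f N\<close> gives
  \<open>E (1 + l \<phi>(min f N)) powr -a \<ge> exp (- \<integral> ln (1 + l f) d\<alpha>)\<close>.  As \<open>N\<close> grows, the integrand on the left tends
  to 0 wherever \<open>\<phi>(f)\<close> is infinite, so the probability that \<open>\<phi>(f)\<close> is finite is at least the
  right-hand side, which tends to 1 as \<open>l\<close> tends to 0.
\<close>
lemma AE_integrable_of_log_integrable:
  fixes f :: "real \<Rightarrow> real"
  assumes f [measurable]: "f \<in> borel_measurable borel" and f0: "\<And>x. 0 \<le> f x" and int: "integrable \<alpha> (\<lambda>x. ln (1 + f x))"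
  shows "AE \<omega> in M. integrable (\<phi> \<omega>) f"
proof -
  define I where "I = {\<omega>\<in>space M. integrable (\<phi> \<omega>) f}"
  have Im [measurable]: "I \<in> sets M"
  proof -
    have "Measurable.pred M (\<lambda>\<omega>. integrable (\<phi> \<omega>) f)"
      using measurable_compose[OF \<phi>_subprob integrable_measurable_subprob_algebra[OF f]] .
    then show ?thesis unfolding I_def by (simp add: pred_def)
  qed
  define X where "X N \<omega> = (\<integral>x. min (f x) (real N) \<partial>\<phi> \<omega>)" for N \<omega>
  have Xm [measurable]: "X N \<in> borel_measurable M" for N unfolding X_def by (intro integral_\<phi>_measurable) measurable
  have minb: "\<bar>min (f x) (real N)\<bar> \<le> real N" for x N using f0[of x] by auto
  have mini: "integrable (\<phi> \<omega>) (\<lambda>x. min (f x) (real N))" if "\<omega> \<in> space M" for \<omega> N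
    by (rule integrable_\<phi>_bounded[OF that _ minb]) measurable
  have X0: "0 \<le> X N \<omega>" for N \<omega> unfolding X_def using f0 by (intro integral_nonneg_AE) auto
  have X_inc: "incseq (\<lambda>N. X N \<omega>)" if "\<omega> \<in> space M" for \<omega>
    unfolding X_def by (intro incseq_SucI integral_mono mini that) auto
  have X_top: "filterlim (\<lambda>N. X N \<omega>) at_top sequentially" if \<omega>: "\<omega> \<in> space M" "\<omega> \<notin> I" for \<omega>
  proof -
    have "\<not> bdd_above (range (\<lambda>N. X N \<omega>))"
    proof
      assume "bdd_above (range (\<lambda>N. X N \<omega>))"
      then obtain C where "\<And>N. X N \<omega> \<le> C" by (auto simp: bdd_above_def)
      from incseq_convergent[OF X_inc[OF \<omega>(1)], of C] this obtain L where L: "(\<lambda>N. X N \<omega>) \<longlonglongrightarrow> L" by blast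
      have "integrable (\<phi> \<omega>) f"
      proof (rule integrable_monotone_convergence[of _ "\<lambda>N x. min (f x) (real N)" _ L])
        show "AE x in \<phi> \<omega>. mono (\<lambda>N. min (f x) (real N))" by (intro AE_I2 monoI) auto
        show "AE x in \<phi> \<omega>. (\<lambda>N. min (f x) (real N)) \<longlonglongrightarrow> f x"
        proof (rule AE_I2, rule tendsto_eventually)
          fix x
          show "\<forall>\<^sub>F N in sequentially. min (f x) (real N) = f x"
            using eventually_ge_at_top[of "nat \<lceil>f x\<rceil>"] by eventually_elim (auto simp: min_def)
        qed
        show "(\<lambda>N. \<integral>x. min (f x) (real N) \<partial>\<phi> \<omega>) \<longlonglongrightarrow> L" using L by (simp add: X_def)
        show "f \<in> borel_measurable (\<phi> \<omega>)" using f \<phi>_prob(2)[OF \<omega>(1)] by (simp cong: measurable_cong_sets)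
      qed (rule mini[OF \<omega>(1)])
      then show False using \<omega> by (simp add: I_def)
    qed
    then have "\<exists>N. Z \<le> X N \<omega>" for Z by (force simp: bdd_above_def not_le intro: less_imp_le)
    then show ?thesis
      unfolding filterlim_at_top eventually_sequentially
      using X_inc[OF \<omega>(1)] by (meson incseq_def order_trans)
  qed
  have key: "exp (- (\<integral>x. ln (1 + l * f x) \<partial>\<alpha>)) \<le> measure M I" if l: "0 < l" "l \<le> 1" for l
  proof -
    define Y where "Y N \<omega> = (1 + l * X N \<omega>) powr (- a)" for N \<omega>
    have Ym [measurable]: "Y N \<in> borel_measurable M" for N unfolding Y_def by measurable
    have Yb: "0 \<le> Y N \<omega>" "Y N \<omega> \<le> 1" for N \<omega>
      unfolding Y_def using X0[of N \<omega>] l a_pos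
      by (auto simp: powr_minus intro!: inverse_le_1_iff[THEN iffD2] ge_one_powr_ge_zero)
    have lint: "integrable \<alpha> (\<lambda>x. ln (1 + l * f x))"
    proof (rule Bochner_Integration.integrable_bound[OF int])
      show "AE x in \<alpha>. norm (ln (1 + l * f x)) \<le> norm (ln (1 + f x))"
      proof (rule AE_I2)
        fix x
        have "0 \<le> l * f x" "l * f x \<le> f x" using l f0[of x] by (auto simp: mult_left_le_one_le)
        then show "norm (ln (1 + l * f x)) \<le> norm (ln (1 + f x))" using abs_ln_one_plus_mono by fastforce
      qed
    qed simp
    have E: "(\<integral>\<omega>. Y N \<omega> \<partial>M) = exp (- (\<integral>x. ln (1 + l * min (f x) (real N)) \<partial>\<alpha>))" for N
    proof -
      have "(\<integral>\<omega>. (\<integral>x. 1 + l * min (f x) (real N) \<partial>\<phi> \<omega>) powr (- a) \<partial>M) = exp (- (\<integral>x. ln (1 + l * min (f x) (real N)) \<partial>\<alpha>))"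
        by (rule markov_krein_real[where e = 1 and B = "1 + l * real N"]) (use l f0 in \<open>auto simp: mult_left_mono\<close>)
      moreover have "(\<integral>x. 1 + l * min (f x) (real N) \<partial>\<phi> \<omega>) = 1 + l * X N \<omega>" if \<omega>: "\<omega> \<in> space M" for \<omega>
      proof -
        interpret \<phi>: prob_space "\<phi> \<omega>" by (rule \<phi>_prob[OF \<omega>])
        show ?thesis using mini[OF \<omega>] by (simp add: X_def \<phi>.prob_space)
      qed
      ultimately show ?thesis unfolding Y_def by (simp cong: Bochner_Integration.integral_cong)
    qed
    have "exp (- (\<integral>x. ln (1 + l * f x) \<partial>\<alpha>)) \<le> (\<integral>\<omega>. Y N \<omega> \<partial>M)" for N
      unfolding E exp_le_cancel_iff neg_le_iff_le
    proof (rule integral_mono)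
      fix x
      have "0 \<le> l * min (f x) (real N)" "l * min (f x) (real N) \<le> l * f x" using l f0[of x] by (auto intro: mult_left_mono)
      then show "ln (1 + l * min (f x) (real N)) \<le> ln (1 + l * f x)" using abs_ln_one_plus_mono by fastforce
      show "integrable \<alpha> (\<lambda>x. ln (1 + l * min (f x) (real N)))"
      proof (rule Bochner_Integration.integrable_bound[OF lint])
        show "AE x in \<alpha>. norm (ln (1 + l * min (f x) (real N))) \<le> norm (ln (1 + l * f x))"
        proof (rule AE_I2)
          fix x
          have "0 \<le> l * min (f x) (real N)" "l * min (f x) (real N) \<le> l * f x" using l f0[of x] by (auto intro: mult_left_mono)
          then show "norm (ln (1 + l * min (f x) (real N))) \<le> norm (ln (1 + l * f x))" using abs_ln_one_plus_mono by fastforce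
        qed
      qed simp
    qed (rule lint)
    also have "(\<integral>\<omega>. Y N \<omega> \<partial>M) \<le> measure M I + (\<integral>\<omega>. indicator (space M - I) \<omega> * Y N \<omega> \<partial>M)" for N
    proof -
      have Yi: "integrable M (\<lambda>\<omega>. indicator (space M - I) \<omega> * Y N \<omega>)"
        using Yb by (intro integrable_const_bound[of _ 1]) (auto simp: indicator_def)
      have "(\<integral>\<omega>. Y N \<omega> \<partial>M) \<le> (\<integral>\<omega>. indicator I \<omega> + indicator (space M - I) \<omega> * Y N \<omega> \<partial>M)"
      proof (rule integral_mono)
        show "integrable M (Y N)" using Yb by (intro integrable_const_bound[of _ 1]) auto
        show "integrable M (\<lambda>\<omega>. indicator I \<omega> + indicator (space M - I) \<omega> * Y N \<omega>)"
          using Yi by (intro Bochner_Integration.integrable_add) (auto simp: less_top[symmetric])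
        show "Y N \<omega> \<le> indicator I \<omega> + indicator (space M - I) \<omega> * Y N \<omega>" if "\<omega> \<in> space M" for \<omega>
          using Yb that by (auto simp: indicator_def)
      qed
      also have "\<dots> = measure M I + (\<integral>\<omega>. indicator (space M - I) \<omega> * Y N \<omega> \<partial>M)"
        using Yi by (subst Bochner_Integration.integral_add) (auto simp: less_top[symmetric])
      finally show ?thesis .
    qed
    finally have bnd: "exp (- (\<integral>x. ln (1 + l * f x) \<partial>\<alpha>)) \<le> measure M I + (\<integral>\<omega>. indicator (space M - I) \<omega> * Y N \<omega> \<partial>M)" for N .
    have "(\<lambda>N. \<integral>\<omega>. indicator (space M - I) \<omega> * Y N \<omega> \<partial>M) \<longlonglongrightarrow> (\<integral>\<omega>. 0 \<partial>M)"
    proof (rule integral_dominated_convergence[where w = "\<lambda>_. 1"])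
      show "AE \<omega> in M. (\<lambda>N. indicator (space M - I) \<omega> * Y N \<omega>) \<longlonglongrightarrow> 0"
      proof (rule AE_I2)
        fix \<omega> assume \<omega>: "\<omega> \<in> space M"
        show "(\<lambda>N. indicator (space M - I) \<omega> * Y N \<omega>) \<longlonglongrightarrow> 0"
        proof (cases "\<omega> \<in> I")
          case False
          have "(\<lambda>N. Y N \<omega>) \<longlonglongrightarrow> 0" unfolding Y_def using a_pos l
            by (intro tendsto_neg_powr filterlim_tendsto_add_at_top[OF tendsto_const]
                filterlim_tendsto_pos_mult_at_top[OF tendsto_const] X_top \<omega> False) auto
          then show ?thesis using \<omega> False by simp
        qed simp
      qed
      show "AE \<omega> in M. norm (indicator (space M - I) \<omega> * Y N \<omega>) \<le> 1" for N
        using Yb by (intro AE_I2) (auto simp: indicator_def)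
    qed auto
    then have "(\<lambda>N. measure M I + (\<integral>\<omega>. indicator (space M - I) \<omega> * Y N \<omega> \<partial>M)) \<longlonglongrightarrow> measure M I + (\<integral>\<omega>. 0 \<partial>M)"
      by (intro tendsto_intros)
    then show ?thesis using bnd by (intro LIMSEQ_le_const) auto
  qed
  have "(\<lambda>n. exp (- (\<integral>x. ln (1 + (1 / real (Suc n)) * f x) \<partial>\<alpha>))) \<longlonglongrightarrow> exp (- (\<integral>x. 0 \<partial>\<alpha>))"
  proof (intro tendsto_exp tendsto_minus integral_dominated_convergence[where w = "\<lambda>x. ln (1 + f x)"])
    have e0: "(\<lambda>n. 1 / real (Suc n)) \<longlonglongrightarrow> 0" using LIMSEQ_inverse_real_of_nat by (simp add: inverse_eq_divide)
    show "AE x in \<alpha>. (\<lambda>n. ln (1 + (1 / real (Suc n)) * f x)) \<longlonglongrightarrow> 0"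
    proof (rule AE_I2)
      fix x
      have "(\<lambda>n. ln (1 + (1 / real (Suc n)) * f x)) \<longlonglongrightarrow> ln (1 + 0 * f x)" by (intro tendsto_intros e0) simp
      then show "(\<lambda>n. ln (1 + (1 / real (Suc n)) * f x)) \<longlonglongrightarrow> 0" by simp
    qed
    show "AE x in \<alpha>. norm (ln (1 + (1 / real (Suc n)) * f x)) \<le> ln (1 + f x)" for n
    proof (rule AE_I2)
      fix x
      have "0 \<le> (1 / real (Suc n)) * f x" "(1 / real (Suc n)) * f x \<le> f x" using f0[of x] by (auto simp: field_simps mult_left_le)
      then show "norm (ln (1 + (1 / real (Suc n)) * f x)) \<le> ln (1 + f x)"
        unfolding real_norm_def by (rule abs_ln_one_plus_mono)
    qed
  qed (use int in auto)
  then have "exp (- (\<integral>x. 0 \<partial>\<alpha>)) \<le> measure M I" 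
    by (rule LIMSEQ_le_const2) (intro exI[of _ 0] allI impI key; simp)
  then have "prob I = 1" using prob_le_1[of I] by simp
  then have "AE \<omega> in M. \<omega> \<in> I" by (subst (asm) prob_eq_1) auto
  then show ?thesis by eventually_elim (simp add: I_def)
qed

text \<open>
  On the real half-line this is \<open>markov_krein_real\<close> for the function \<open>z - h\<close>.
\<close>
lemma markov_krein_complex:
  fixes h :: "real \<Rightarrow> real"
  assumes h [measurable]: "h \<in> borel_measurable borel" and b: "\<And>x. \<bar>h x\<bar> \<le> B" and s: "\<And>x. h x \<le> s" and z: "s < Re z"
  shows "(\<integral>\<omega>. (z - of_real (\<integral>x. h x \<partial>\<phi> \<omega>)) powr (- of_real a) \<partial>M) = exp (- (\<integral>x. Ln (z - of_real (h x)) \<partial>\<alpha>))"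
proof (rule holomorphic_eq_on_halfplane[OF _ _ _ z])
  define Y where "Y \<omega> = (\<integral>x. h x \<partial>\<phi> \<omega>)" for \<omega>
  have Ym [measurable]: "Y \<in> borel_measurable M" unfolding Y_def by (intro integral_\<phi>_measurable h)
  have Ys: "Y \<omega> \<le> s" if "\<omega> \<in> space M" for \<omega> unfolding Y_def by (rule integral_\<phi>_bounds(1)[OF h b s that])
  have nonpos: "w - complex_of_real y \<notin> \<real>\<^sub>\<le>\<^sub>0" if "s < Re w" "y \<le> s" for w y
    using that by (auto simp: complex_nonpos_Reals_iff)
  have npow: "norm ((w - complex_of_real y) powr (- complex_of_real c)) \<le> d powr (- c)"
    if "0 < d" "d \<le> Re w - s" "y \<le> s" "0 < c" for w y d c
    using norm_ge_Re_minus[OF that(1-3)] that norm_powr_real_powr'[of "- complex_of_real c" "w - complex_of_real y"]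
    by (auto intro!: powr_mono2')
  have int1: "integrable M (\<lambda>\<omega>. (w - of_real (Y \<omega>)) powr (- complex_of_real a))" if w: "s < Re w" for w
    using npow[of "Re w - s" w _ a] w a_pos Ys by (intro integrable_const_bound[of _ "(Re w - s) powr (- a)"] AE_I2) auto
  show "(\<lambda>w. \<integral>\<omega>. (w - of_real (\<integral>x. h x \<partial>\<phi> \<omega>)) powr (- of_real a) \<partial>M) holomorphic_on {z. s < Re z}"
    unfolding Y_def[symmetric]
  proof (subst holomorphic_on_open, rule open_right_halfplane, safe)
    fix z :: complex assume z: "s < Re z"
    let ?d = "(Re z - s) / 2"
    have R: "?d < Re w - s" if "w \<in> ball z ?d" for w using ball_Re_gt[OF that] .
    have "((\<lambda>w. \<integral>\<omega>. (w - of_real (Y \<omega>)) powr (- complex_of_real a) \<partial>M) has_field_derivative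
       (\<integral>\<omega>. - of_real a * (z - of_real (Y \<omega>)) powr (- complex_of_real (a + 1)) \<partial>M)) (at z)"
    proof (rule has_field_derivative_integral[where e = ?d and g = "\<lambda>_. a * ?d powr (- (a + 1))"])
      show "0 < ?d" using z by simp
      show "integrable M (\<lambda>\<omega>. (w - of_real (Y \<omega>)) powr (- complex_of_real a))" if "w \<in> ball z ?d" for w
        using R[OF that] z by (intro int1) simp
      show "((\<lambda>w. (w - of_real (Y \<omega>)) powr (- complex_of_real a)) has_field_derivative - of_real a * (w - of_real (Y \<omega>)) powr (- complex_of_real (a + 1))) (at w)"
        if "w \<in> ball z ?d" "\<omega> \<in> space M" for w \<omega>
      proof -
        have "w - complex_of_real (Y \<omega>) \<notin> \<real>\<^sub>\<le>\<^sub>0" using R[OF that(1)] z Ys[OF that(2)] by (intro nonpos) auto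
        moreover have "- complex_of_real (a + 1) = - complex_of_real a - 1" by simp
        ultimately show ?thesis by (auto intro!: derivative_eq_intros)
      qed
      show "norm (- of_real a * (w - of_real (Y \<omega>)) powr (- complex_of_real (a + 1))) \<le> a * ?d powr (- (a + 1))"
        if "w \<in> ball z ?d" "\<omega> \<in> space M" for w \<omega>
        using npow[of ?d w "Y \<omega>" "a + 1"] R[OF that(1)] z Ys[OF that(2)] a_pos by (simp add: norm_mult mult_left_mono)
    qed auto
    then show "\<exists>f'. ((\<lambda>w. \<integral>\<omega>. (w - of_real (Y \<omega>)) powr (- complex_of_real a) \<partial>M) has_field_derivative f') (at z)" ..
  qed
  have int2: "integrable \<alpha> (\<lambda>x. Ln (w - of_real (h x)))" if w: "s < Re w" for w
  proof (rule \<alpha>.integrable_const_bound)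
    show "AE x in \<alpha>. norm (Ln (w - of_real (h x))) \<le> \<bar>ln (Re w - s)\<bar> + \<bar>ln (norm w + B)\<bar> + pi"
    proof (rule AE_I2, rule norm_Ln_le)
      fix x
      show "Re w - s \<le> norm (w - of_real (h x))" using w s[of x] by (intro norm_ge_Re_minus[where s = s]) auto
      show "norm (w - of_real (h x)) \<le> norm w + B" using norm_triangle_ineq4[of w "of_real (h x)"] b[of x] by simp
    qed (use w in simp)
  qed simp
  show "(\<lambda>w. exp (- (\<integral>x. Ln (w - of_real (h x)) \<partial>\<alpha>))) holomorphic_on {z. s < Re z}"
  proof (rule holomorphic_on_exp' holomorphic_on_minus)+
    show "(\<lambda>w. \<integral>x. Ln (w - of_real (h x)) \<partial>\<alpha>) holomorphic_on {z. s < Re z}"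
    proof (subst holomorphic_on_open, rule open_right_halfplane, safe)
      fix z :: complex assume z: "s < Re z"
      let ?d = "(Re z - s) / 2"
      have R: "?d < Re w - s" if "w \<in> ball z ?d" for w using ball_Re_gt[OF that] .
      have "((\<lambda>w. \<integral>x. Ln (w - of_real (h x)) \<partial>\<alpha>) has_field_derivative (\<integral>x. inverse (z - of_real (h x)) \<partial>\<alpha>)) (at z)"
      proof (rule has_field_derivative_integral[where e = ?d and g = "\<lambda>_. inverse ?d"])
        show "0 < ?d" using z by simp
        show "integrable \<alpha> (\<lambda>x. Ln (w - of_real (h x)))" if "w \<in> ball z ?d" for w
          using R[OF that] z by (intro int2) simp
        show "((\<lambda>w. Ln (w - of_real (h x))) has_field_derivative inverse (w - of_real (h x))) (at w)" if "w \<in> ball z ?d" for w x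
        proof -
          have "w - complex_of_real (h x) \<notin> \<real>\<^sub>\<le>\<^sub>0" using R[OF that] z s by (intro nonpos) auto
          then show ?thesis by (auto intro!: derivative_eq_intros)
        qed
        show "norm (inverse (w - complex_of_real (h x))) \<le> inverse ?d" if "w \<in> ball z ?d" for w x
          unfolding norm_inverse using norm_ge_Re_minus[of ?d w s "h x"] R[OF that] z s[of x]
          by (intro le_imp_inverse_le) auto
      qed auto
      then show "\<exists>f'. ((\<lambda>w. \<integral>x. Ln (w - of_real (h x)) \<partial>\<alpha>) has_field_derivative f') (at z)" ..
    qed
  qed
  fix x :: real assume x: "s < x"
  have "(\<integral>\<omega>. (of_real x - of_real (\<integral>x. h x \<partial>\<phi> \<omega>)) powr (- complex_of_real a) \<partial>M) = (\<integral>\<omega>. complex_of_real ((\<integral>u. x - h u \<partial>\<phi> \<omega>) powr (- a)) \<partial>M)"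
  proof (rule Bochner_Integration.integral_cong[OF refl])
    fix \<omega> assume \<omega>: "\<omega> \<in> space M"
    interpret \<phi>: prob_space "\<phi> \<omega>" by (rule \<phi>_prob[OF \<omega>])
    have "(\<integral>u. x - h u \<partial>\<phi> \<omega>) = x - Y \<omega>"
      using integrable_\<phi>_bounded[OF \<omega> h b] by (simp add: Y_def \<phi>.prob_space)
    moreover have "0 \<le> x - Y \<omega>" using Ys[OF \<omega>] x by simp
    ultimately show "(of_real x - of_real (\<integral>x. h x \<partial>\<phi> \<omega>)) powr (- complex_of_real a) = complex_of_real ((\<integral>u. x - h u \<partial>\<phi> \<omega>) powr (- a))"
      using powr_of_real[of "x - Y \<omega>" "- a"] by (simp add: Y_def)
  qed
  also have "\<dots> = of_real (\<integral>\<omega>. (\<integral>u. x - h u \<partial>\<phi> \<omega>) powr (- a) \<partial>M)" by (rule integral_complex_of_real)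
  also have "(\<integral>\<omega>. (\<integral>u. x - h u \<partial>\<phi> \<omega>) powr (- a) \<partial>M) = exp (- (\<integral>u. ln (x - h u) \<partial>\<alpha>))"
  proof (rule markov_krein_real[where e = "x - s" and B = "x + B"])
    show "x - h u \<le> x + B" for u using b[of u] by simp
    show "x - s \<le> x - h u" for u using s[of u] by simp
  qed (use x in auto)
  also have "complex_of_real (exp (- (\<integral>u. ln (x - h u) \<partial>\<alpha>))) = exp (- of_real (\<integral>u. ln (x - h u) \<partial>\<alpha>))"
    by (simp only: of_real_minus exp_of_real[symmetric])
  also have "complex_of_real (\<integral>u. ln (x - h u) \<partial>\<alpha>) = (\<integral>u. Ln (of_real x - of_real (h u)) \<partial>\<alpha>)"
  proof -
    have "Ln (of_real x - of_real (h u)) = of_real (ln (x - h u))" for u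
      using Ln_of_real[of "x - h u"] s[of u] x by simp
    then show ?thesis by (simp only: integral_complex_of_real)
  qed
  finally show "(\<integral>\<omega>. (of_real x - of_real (\<integral>x. h x \<partial>\<phi> \<omega>)) powr (- complex_of_real a) \<partial>M) = exp (- (\<integral>u. Ln (of_real x - of_real (h u)) \<partial>\<alpha>))" .
qed

text \<open>
  The kernel has the primitive \<open>E (e^Y Q(z - Y))\<close>, where \<open>Q\<close> is the primitive from
  \<open>hankel_primitive\<close>; so the exchange of expectation and contour integral is differentiation under the
  expectation, and the limit at infinity is taken inside the expectation by uniform convergence.
\<close>
lemma pv_integral_exp_mean:
  fixes h :: "real \<Rightarrow> real"
  assumes h [measurable]: "h \<in> borel_measurable borel" and b: "\<And>x. \<bar>h x\<bar> \<le> B" and s: "\<And>x. h x \<le> s" and c: "s < c"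
    and k: "\<And>z. s < Re z \<Longrightarrow> k z = exp z * (\<integral>\<omega>. (z - of_real (\<integral>x. h x \<partial>\<phi> \<omega>)) powr (- of_real a) \<partial>M)"
  shows "has_pv_vertical_integral k (2 * of_real pi * \<i> / of_real (Gamma a) * of_real (\<integral>\<omega>. exp (\<integral>x. h x \<partial>\<phi> \<omega>) \<partial>M)) c"
proof -
  define Y where "Y \<omega> = (\<integral>x. h x \<partial>\<phi> \<omega>)" for \<omega>
  have Ym [measurable]: "Y \<in> borel_measurable M" unfolding Y_def by (intro integral_\<phi>_measurable h)
  have Ys: "Y \<omega> \<le> s" "- B \<le> Y \<omega>" if "\<omega> \<in> space M" for \<omega>
    unfolding Y_def by (rule integral_\<phi>_bounds[OF h b s that])+
  have Bs: "- B \<le> s" using b[of 0] s[of 0] by simp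
  let ?L = "2 * of_real pi * \<i> / of_real (Gamma a) :: complex"
  obtain Q where Q: "\<And>w. 0 < Re w \<Longrightarrow> (Q has_field_derivative exp w * w powr (- of_real a)) (at w)"
    and U: "\<And>D. uniform_limit {0<..D} (\<lambda>R u. Q (Complex u R) - Q (Complex u (- R))) (\<lambda>_. ?L) at_top"
    using hankel_primitive[OF a_pos] by blast
  have Qcont: "isCont Q w" if "0 < Re w" for w using Q[OF that] by (rule DERIV_isCont)
  have contQ: "continuous_on {- B..s} (\<lambda>y. Q (z - of_real y))" if z: "s < Re z" for z
    using z by (intro continuous_at_imp_continuous_on ballI isCont_o2[where g = Q and f = "\<lambda>y. z - of_real y"] Qcont) (auto intro!: continuous_intros)
  \<comment> \<open>\<open>Q\<close> is arbitrary off the right half-plane, so measurability is read off after clamping \<open>Y\<close> to its range.\<close>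
  have Qm: "(\<lambda>\<omega>. Q (z - of_real (Y \<omega>))) \<in> borel_measurable M" if z: "s < Re z" for z
  proof -
    have "continuous_on UNIV (\<lambda>y. Q (z - of_real (max (- B) (min s y))))"
      by (rule continuous_on_compose2[OF contQ[OF z], of _ "\<lambda>y. max (- B) (min s y)"])
        (use Bs in \<open>auto intro!: continuous_intros\<close>)
    from measurable_compose[OF Ym borel_measurable_continuous_onI[OF this]]
    have "(\<lambda>\<omega>. Q (z - of_real (max (- B) (min s (Y \<omega>))))) \<in> borel_measurable M" .
    then show ?thesis
      by (rule measurable_cong[THEN iffD1, rotated]) (simp add: Ys max.absorb2 min.absorb2)
  qed
  have Qint: "integrable M (\<lambda>\<omega>. exp (of_real (Y \<omega>)) * Q (z - of_real (Y \<omega>)))" if z: "s < Re z" for z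
  proof -
    have "compact ((\<lambda>y. Q (z - of_real y)) ` {- B..s})" by (intro compact_continuous_image contQ z) simp
    from compact_imp_bounded[OF this] obtain C where "\<forall>q\<in>(\<lambda>y. Q (z - of_real y)) ` {- B..s}. norm q \<le> C"
      unfolding bounded_iff by blast
    then have C: "norm (Q (z - of_real y)) \<le> C" if "y \<in> {- B..s}" for y using that by blast
    show ?thesis
    proof (rule integrable_const_bound)
      show "AE \<omega> in M. norm (exp (of_real (Y \<omega>)) * Q (z - of_real (Y \<omega>))) \<le> exp s * C"
        unfolding norm_mult using Ys C by (intro AE_I2 mult_mono) auto
      show "(\<lambda>\<omega>. exp (of_real (Y \<omega>)) * Q (z - of_real (Y \<omega>))) \<in> borel_measurable M"
        using Qm[OF z] by (intro borel_measurable_times) auto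
    qed
  qed
  define P where "P z = (\<integral>\<omega>. exp (of_real (Y \<omega>)) * Q (z - of_real (Y \<omega>)) \<partial>M)" for z
  have P: "(P has_field_derivative k z) (at z)" if z: "s < Re z" for z
  proof -
    let ?d = "(Re z - s) / 2"
    have R: "?d < Re w - s" if "w \<in> ball z ?d" for w using ball_Re_gt[OF that] .
    have "(P has_field_derivative (\<integral>\<omega>. exp z * (z - of_real (Y \<omega>)) powr (- of_real a) \<partial>M)) (at z)"
      unfolding P_def
    proof (rule has_field_derivative_integral[where e = ?d and g = "\<lambda>_. exp (Re z + ?d) * ?d powr (- a)"])
      show "0 < ?d" using z by simp
      show "integrable M (\<lambda>\<omega>. exp (of_real (Y \<omega>)) * Q (w - of_real (Y \<omega>)))" if "w \<in> ball z ?d" for w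
        using R[OF that] z by (intro Qint) simp
      show "((\<lambda>w. exp (of_real (Y \<omega>)) * Q (w - of_real (Y \<omega>))) has_field_derivative exp w * (w - of_real (Y \<omega>)) powr (- of_real a)) (at w)"
        if "w \<in> ball z ?d" "\<omega> \<in> space M" for w \<omega>
      proof -
        have "0 < Re (w - complex_of_real (Y \<omega>))" using R[OF that(1)] Ys[OF that(2)] z by simp
        from DERIV_cmult[OF DERIV_chain2[OF Q[OF this] DERIV_diff[OF DERIV_ident DERIV_const]], of "exp (of_real (Y \<omega>))"]
        show ?thesis by (simp add: exp_diff)
      qed
      show "norm (exp w * (w - of_real (Y \<omega>)) powr (- complex_of_real a)) \<le> exp (Re z + ?d) * ?d powr (- a)"
        if "w \<in> ball z ?d" "\<omega> \<in> space M" for w \<omega>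
      proof -
        have "Re w \<le> Re z + ?d"
          using that(1) abs_Re_le_cmod[of "z - w"] unfolding mem_ball dist_norm minus_complex.sel by linarith
        moreover have "norm (w - of_real (Y \<omega>)) powr (- a) \<le> ?d powr (- a)"
          using norm_ge_Re_minus[of ?d w s "Y \<omega>"] R[OF that(1)] z Ys[OF that(2)] a_pos by (intro powr_mono2') auto
        ultimately show ?thesis
          using norm_powr_real_powr'[of "- complex_of_real a" "w - of_real (Y \<omega>)"]
          by (simp add: norm_mult mult_mono)
      qed
    qed auto
    also have "(\<integral>\<omega>. exp z * (z - of_real (Y \<omega>)) powr (- of_real a) \<partial>M) = k z"
      using k[OF z] by (simp add: Y_def)
    finally show ?thesis .
  qed
  have ci: "(k has_contour_integral (P (Complex c R) - P (Complex c (- R)))) (linepath (Complex c (- R)) (Complex c R))" for R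
  proof -
    have "path_image (linepath (Complex c (- R)) (Complex c R)) \<subseteq> {z. s < Re z}"
      unfolding path_image_linepath using c by (intro closed_segment_subset convex_right_halfplane) auto
    from contour_integral_primitive[OF _ valid_path_linepath this, of P k]
    show ?thesis using P by (auto intro: has_field_derivative_at_within)
  qed
  have "((\<lambda>R. \<integral>\<omega>. exp (of_real (Y \<omega>)) * (Q (Complex (c - Y \<omega>) R) - Q (Complex (c - Y \<omega>) (- R))) \<partial>M) \<longlongrightarrow> (\<integral>\<omega>. exp (of_real (Y \<omega>)) * ?L \<partial>M)) at_top"
  proof (rule integral_dominated_convergence_at_top[where w = "\<lambda>_. exp s * (norm ?L + 1)"])
    have eq: "Complex c R - of_real y = Complex (c - y) R" for R y by (simp add: complex_eq_iff)
    have u: "c - Y \<omega> \<in> {0<..c + B}" if "\<omega> \<in> space M" for \<omega> using Ys[OF that] c by auto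
    show "(\<lambda>\<omega>. exp (of_real (Y \<omega>)) * (Q (Complex (c - Y \<omega>) R) - Q (Complex (c - Y \<omega>) (- R)))) \<in> borel_measurable M" for R
      unfolding eq[symmetric] using c by (intro borel_measurable_times borel_measurable_diff Qm) auto
    show "(\<lambda>\<omega>. exp (of_real (Y \<omega>)) * ?L) \<in> borel_measurable M" by measurable
    show "AE \<omega> in M. ((\<lambda>R. exp (of_real (Y \<omega>)) * (Q (Complex (c - Y \<omega>) R) - Q (Complex (c - Y \<omega>) (- R)))) \<longlongrightarrow> exp (of_real (Y \<omega>)) * ?L) at_top"
      using tendsto_uniform_limitI[OF U u] by (intro AE_I2 tendsto_mult_left) auto
    have "\<forall>\<^sub>F R in at_top. \<forall>u\<in>{0<..c + B}. dist (Q (Complex u R) - Q (Complex u (- R))) ?L < 1"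
      using U[of "c + B"] by (auto simp: uniform_limit_iff)
    then show "\<forall>\<^sub>F R in at_top. AE \<omega> in M. norm (exp (of_real (Y \<omega>)) * (Q (Complex (c - Y \<omega>) R) - Q (Complex (c - Y \<omega>) (- R)))) \<le> exp s * (norm ?L + 1)"
    proof eventually_elim
      case (elim R)
      show ?case
      proof (rule AE_I2)
        fix \<omega> assume \<omega>: "\<omega> \<in> space M"
        let ?q = "Q (Complex (c - Y \<omega>) R) - Q (Complex (c - Y \<omega>) (- R))"
        have "norm ?q \<le> norm ?L + norm (?q - ?L)" by (rule norm_triangle_sub)
        also have "\<dots> \<le> norm ?L + 1" using elim u[OF \<omega>] by (auto simp: dist_norm intro: less_imp_le)
        finally show "norm (exp (of_real (Y \<omega>)) * ?q) \<le> exp s * (norm ?L + 1)"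
          unfolding norm_mult using Ys[OF \<omega>] by (intro mult_mono) auto
      qed
    qed
  qed simp
  moreover have "contour_integral (linepath (Complex c (- R)) (Complex c R)) k
      = (\<integral>\<omega>. exp (of_real (Y \<omega>)) * (Q (Complex (c - Y \<omega>) R) - Q (Complex (c - Y \<omega>) (- R))) \<partial>M)" for R
  proof -
    have eq: "Complex c R - of_real y = Complex (c - y) R" for R y by (simp add: complex_eq_iff)
    have "contour_integral (linepath (Complex c (- R)) (Complex c R)) k = P (Complex c R) - P (Complex c (- R))"
      by (rule contour_integral_unique[OF ci])
    also have "\<dots> = (\<integral>\<omega>. exp (of_real (Y \<omega>)) * Q (Complex c R - of_real (Y \<omega>)) - exp (of_real (Y \<omega>)) * Q (Complex c (- R) - of_real (Y \<omega>)) \<partial>M)"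
      unfolding P_def using c by (intro Bochner_Integration.integral_diff[symmetric] Qint) auto
    finally show ?thesis by (simp add: eq right_diff_distrib)
  qed
  moreover have "(\<integral>\<omega>. exp (of_real (Y \<omega>)) * ?L \<partial>M) = ?L * of_real (\<integral>\<omega>. exp (Y \<omega>) \<partial>M)"
    by (simp add: exp_of_real mult.commute)
  ultimately have "((\<lambda>R. contour_integral (linepath (Complex c (- R)) (Complex c R)) k) \<longlongrightarrow> ?L * of_real (\<integral>\<omega>. exp (Y \<omega>) \<partial>M)) at_top"
    by (simp only:)
  then show ?thesis
    unfolding has_pv_vertical_integral_def contour_integrable_on_def Y_def using ci by blast
qed

end

section \<open>Measures with bounded support\<close>

lemma closed_measure_support: "closed (measure_support \<alpha>)"
proof -
  have "- measure_support \<alpha> = \<Union>{U. open U \<and> emeasure \<alpha> U = 0}"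
    by (auto simp: measure_support_def zero_less_iff_neq_zero)
  moreover have "open (\<Union>{U. open U \<and> emeasure \<alpha> U = 0})" by auto
  ultimately show ?thesis by (simp add: closed_def)
qed

text \<open>
  The complement is a union of open null sets, and by Lindelof countably many of them suffice.
\<close>
lemma emeasure_Compl_measure_support:
  assumes "sets \<alpha> = sets borel"
  shows "emeasure \<alpha> (- measure_support \<alpha>) = 0"
proof -
  let ?F = "{U. open U \<and> emeasure \<alpha> U = 0}"
  have eq: "- measure_support \<alpha> = \<Union>?F"
    by (auto simp: measure_support_def zero_less_iff_neq_zero)
  obtain F' where F': "F' \<subseteq> ?F" "countable F'" "\<Union>F' = \<Union>?F"
    by (rule Lindelof[of ?F]) auto
  have "(\<Union>U\<in>F'. U) \<in> null_sets \<alpha>"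
    using F' by (intro null_sets_UN') (auto simp: null_sets_def assms)
  then show ?thesis unfolding eq using F'(3) by (auto simp: null_sets_def)
qed

text \<open>
  Completing the square; up to a factor the integrand is the normal density with mean \<open>2 u\<close> and
  variance 2.
\<close>
lemma gaussian_linear_integral:
  fixes u v :: real
  shows "has_bochner_integral lborel (\<lambda>y. exp (- y\<^sup>2 / 4) * exp (y * u - v)) (2 * sqrt pi * exp (u\<^sup>2 - v))"
proof -
  have "exp (- y\<^sup>2 / 4) * exp (y * u - v) = (2 * sqrt pi * exp (u\<^sup>2 - v)) * normal_density (2 * u) (sqrt 2) y" for y
  proof -
    have "- y\<^sup>2 / 4 + (y * u - v) = (u\<^sup>2 - v) + (- (y - 2 * u)\<^sup>2 / 4)"
      by (simp add: power2_eq_square field_simps)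
    then have "exp (- y\<^sup>2 / 4) * exp (y * u - v) = exp (u\<^sup>2 - v) * exp (- (y - 2 * u)\<^sup>2 / 4)"
      by (simp only: exp_add[symmetric])
    moreover have "normal_density (2 * u) (sqrt 2) y = 1 / (2 * sqrt pi) * exp (- (y - 2 * u)\<^sup>2 / 4)"
      by (simp add: normal_density_def real_sqrt_mult)
    ultimately show ?thesis by simp
  qed
  moreover have "has_bochner_integral lborel (normal_density (2 * u) (sqrt 2)) 1"
    by (simp add: has_bochner_integral_iff integrable_normal_density)
  then have "has_bochner_integral lborel (\<lambda>y. (2 * sqrt pi * exp (u\<^sup>2 - v)) * normal_density (2 * u) (sqrt 2) y) ((2 * sqrt pi * exp (u\<^sup>2 - v)) * 1)"
    by (rule has_bochner_integral_mult_right)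
  ultimately show ?thesis by simp
qed

context dirichlet_process_space begin

text \<open>
  Since \<open>z\<close> and \<open>z - h\<close> both lie in the right half-plane, the principal logarithm of their quotient
  splits without a multiple of \<open>2 \<pi> \<i>\<close>; the total mass \<open>a\<close> then cancels the factor \<open>z powr -a\<close>.
\<close>
lemma inversion_kernel_eq:
  assumes hm: "h \<in> borel_measurable borel" and hb: "\<And>x. \<bar>h x\<bar> \<le> B" and hs: "\<And>x. h x \<le> s"
    and ae: "AE x in \<alpha>. h x = y * sqrt t * x - t * x\<^sup>2" and z: "0 < Re z" "s < Re z"
  shows "inversion_kernel \<alpha> a t y z = exp z * (\<integral>\<omega>. (z - of_real (\<integral>x. h x \<partial>\<phi> \<omega>)) powr (- of_real a) \<partial>M)"
proof -
  note hm[measurable]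
  have z0: "z \<noteq> 0" using z by auto
  have Ln_div: "Ln ((z - complex_of_real u) / z) = Ln (z - of_real u) - Ln z" if u: "u \<le> s" for u
  proof -
    have w: "0 < Re (z - complex_of_real u)" using z u by simp
    then have w0: "z - complex_of_real u \<noteq> 0" by auto
    have "\<bar>Im (Ln (z - complex_of_real u))\<bar> < pi / 2" "\<bar>Im (Ln z)\<bar> < pi / 2"
      using Re_Ln_pos_lt[OF w0] Re_Ln_pos_lt[OF z0] w z by auto
    then have *: "- pi < Im (Ln (z - complex_of_real u) - Ln z)" "Im (Ln (z - complex_of_real u) - Ln z) \<le> pi"
      unfolding minus_complex.sel by linarith+
    have "exp (Ln (z - complex_of_real u) - Ln z) = (z - complex_of_real u) / z"
      using w0 z0 by (simp add: exp_diff)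
    then show ?thesis using * by (rule Ln_unique)
  qed
  have intL: "integrable \<alpha> (\<lambda>x. Ln (z - of_real (h x)))"
  proof (rule \<alpha>.integrable_const_bound)
    show "AE x in \<alpha>. norm (Ln (z - of_real (h x))) \<le> \<bar>ln (Re z - s)\<bar> + \<bar>ln (norm z + B)\<bar> + pi"
    proof (rule AE_I2, rule norm_Ln_le)
      fix x
      show "Re z - s \<le> norm (z - of_real (h x))" using z hs[of x] by (intro norm_ge_Re_minus[where s = s]) auto
      show "norm (z - of_real (h x)) \<le> norm z + B" using norm_triangle_ineq4[of z "of_real (h x)"] hb[of x] by simp
    qed (use z in simp)
  qed simp
  have "(\<integral>x. Ln (1 + complex_of_real (t * x\<^sup>2 - y * sqrt t * x) / z) \<partial>\<alpha>) = (\<integral>x. Ln (z - of_real (h x)) - Ln z \<partial>\<alpha>)"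
  proof (rule integral_cong_AE)
    show "AE x in \<alpha>. Ln (1 + complex_of_real (t * x\<^sup>2 - y * sqrt t * x) / z) = Ln (z - of_real (h x)) - Ln z"
      using ae
    proof eventually_elim
      case (elim x)
      have "1 + complex_of_real (t * x\<^sup>2 - y * sqrt t * x) / z = (z - of_real (h x)) / z"
        using z0 by (simp add: elim field_simps)
      then show ?case using Ln_div[OF hs] by simp
    qed
  qed measurable
  also have "\<dots> = (\<integral>x. Ln (z - of_real (h x)) \<partial>\<alpha>) - of_real a * Ln z"
    using intL by (subst Bochner_Integration.integral_diff) (auto simp: a_eq scaleR_conv_of_real)
  finally have "inversion_kernel \<alpha> a t y z = exp z / z powr of_real a * (exp (- (\<integral>x. Ln (z - of_real (h x)) \<partial>\<alpha>)) * z powr of_real a)"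
    using z0 by (simp add: inversion_kernel_def powr_def exp_diff exp_minus divide_inverse mult.commute)
  also have "\<dots> = exp z * exp (- (\<integral>x. Ln (z - of_real (h x)) \<partial>\<alpha>))" using z0 by simp
  also have "exp (- (\<integral>x. Ln (z - of_real (h x)) \<partial>\<alpha>)) = (\<integral>\<omega>. (z - of_real (\<integral>x. h x \<partial>\<phi> \<omega>)) powr (- of_real a) \<partial>M)"
    by (rule markov_krein_complex[OF hm hb hs z(2), symmetric])
  finally show ?thesis .
qed

lemma random_mean_measurable: "random_mean \<phi> \<in> borel_measurable M"
  unfolding random_mean_def[abs_def] by (rule integral_\<phi>_measurable) simp

lemma random_variance_nonneg: "0 \<le> random_variance \<phi> \<omega>"
  unfolding random_variance_def by (rule integral_nonneg_AE) simp

lemma random_variance_measurable: "random_variance \<phi> \<in> borel_measurable M"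
proof -
  note random_mean_measurable[measurable]
  have "(\<lambda>\<omega>. enn2real (\<integral>\<^sup>+x. ennreal ((x - random_mean \<phi> \<omega>)\<^sup>2) \<partial>\<phi> \<omega>)) \<in> borel_measurable M"
    by (intro borel_measurable_enn2real nn_integral_measurable_subprob_algebra2[where N = borel] \<phi>_subprob) measurable
  then show ?thesis
  proof (rule measurable_cong[THEN iffD1, rotated])
    fix \<omega> assume \<omega>: "\<omega> \<in> space M"
    show "enn2real (\<integral>\<^sup>+x. ennreal ((x - random_mean \<phi> \<omega>)\<^sup>2) \<partial>\<phi> \<omega>) = random_variance \<phi> \<omega>"
      unfolding random_variance_def
      by (rule integral_eq_nn_integral[symmetric]) (auto simp: measurable_cong_sets[OF \<phi>_prob(2)[OF \<omega>] refl])
  qed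
qed

text \<open>
  The function \<open>y sqrt t x - t x\<^sup>2\<close> is cut off by 0 outside the support: this makes it bounded on the
  whole line, keeps it below the abscissa because the latter is positive, and changes
  neither \<open>\<alpha>\<close>-integrals nor, almost surely, \<open>\<phi>\<close>-integrals.
\<close>
lemma bounded_support_inversion:
  assumes bdd: "bounded (measure_support \<alpha>)" and t: "0 \<le> t" and adm: "\<And>y. admissible_abscissa \<alpha> t y (\<gamma> y)"
  shows "\<exists>l. has_pv_vertical_integral (inversion_kernel \<alpha> a t y) l (\<gamma> y)"
    and "integrable lborel (gaussian_inversion_integrand \<alpha> a t \<gamma>)"
    and "complex_of_real (variance_mgf M \<phi> t) = complex_of_real (Gamma a) / (4 * complex_of_real (pi powr (3/2)) * \<i>) *
            (\<integral>y. gaussian_inversion_integrand \<alpha> a t \<gamma> y \<partial>lborel)"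
proof -
  let ?S = "measure_support \<alpha>"
  let ?L = "2 * of_real pi * \<i> / of_real (Gamma a) :: complex"
  from bdd obtain b where b: "\<And>x. x \<in> ?S \<Longrightarrow> \<bar>x\<bar> \<le> b" by (auto simp: bounded_iff)
  define b' where "b' = max b 0"
  have b': "\<bar>x\<bar> \<le> b'" "x\<^sup>2 \<le> b'\<^sup>2" if "x \<in> ?S" for x
    using b[OF that] abs_le_square_iff[of x b'] by (auto simp: b'_def)
  have b'0: "0 \<le> b'" by (simp add: b'_def)
  have S [measurable]: "?S \<in> sets borel" using closed_measure_support by (rule borel_closed)
  have ES: "emeasure \<alpha> (- ?S) = 0" by (rule emeasure_Compl_measure_support[OF sets_\<alpha>])
  have aeS: "AE x in \<alpha>. x \<in> ?S"
  proof -
    have "AE x in \<alpha>. x \<notin> - ?S" by (rule AE_not_in) (use ES S sets_\<alpha> in auto)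
    then show ?thesis by simp
  qed
  have "AE \<omega> in M. AE x in \<phi> \<omega>. x \<notin> - ?S" by (rule AE_null_set) (use ES S in auto)
  then have ae\<phi>: "AE \<omega> in M. AE x in \<phi> \<omega>. x \<in> ?S" by simp
  define h where "h y x = indicator ?S x * (y * sqrt t * x - t * x\<^sup>2)" for y x
  have hm: "h y \<in> borel_measurable borel" for y unfolding h_def by measurable
  have h_abs: "\<bar>y * sqrt t * x - t * x\<^sup>2\<bar> \<le> \<bar>y\<bar> * sqrt t * b' + t * b'\<^sup>2" if "x \<in> ?S" for x y
  proof -
    have "\<bar>y * sqrt t * x - t * x\<^sup>2\<bar> \<le> \<bar>y\<bar> * sqrt t * \<bar>x\<bar> + t * x\<^sup>2"
      using abs_triangle_ineq4[of "y * sqrt t * x" "t * x\<^sup>2"] t by (simp add: abs_mult)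
    also have "\<dots> \<le> \<bar>y\<bar> * sqrt t * b' + t * b'\<^sup>2"
      using b'[OF that] t by (intro add_mono mult_left_mono) auto
    finally show ?thesis .
  qed
  have hb: "\<bar>h y x\<bar> \<le> \<bar>y\<bar> * sqrt t * b' + t * b'\<^sup>2" for y x
    using h_abs[of x y] t b'0 by (cases "x \<in> ?S") (auto simp: h_def)
  define s where "s y = max 0 (SUP x\<in>?S. y * sqrt t * x - t * x\<^sup>2)" for y
  have bddS: "bdd_above ((\<lambda>x. y * sqrt t * x - t * x\<^sup>2) ` ?S)" for y
    using h_abs[of _ y] by (intro bdd_aboveI2[where M = "\<bar>y\<bar> * sqrt t * b' + t * b'\<^sup>2"]) (auto simp: abs_le_iff)
  have hs: "h y x \<le> s y" for y x
    using cSUP_upper[OF _ bddS[of y], of x] by (cases "x \<in> ?S") (auto simp: h_def s_def le_max_iff_disj)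
  have s\<gamma>: "s y < \<gamma> y" for y using adm[of y] by (simp add: admissible_abscissa_def s_def)
  have ker: "inversion_kernel \<alpha> a t y z = exp z * (\<integral>\<omega>. (z - of_real (\<integral>x. h y x \<partial>\<phi> \<omega>)) powr (- of_real a) \<partial>M)"
    if "s y < Re z" for y z
  proof (rule inversion_kernel_eq[OF hm hb hs])
    show "AE x in \<alpha>. h y x = y * sqrt t * x - t * x\<^sup>2" using aeS by eventually_elim (simp add: h_def)
    show "0 < Re z" using that by (simp add: s_def)
  qed (rule that)
  have pv: "has_pv_vertical_integral (inversion_kernel \<alpha> a t y) (?L * of_real (\<integral>\<omega>. exp (\<integral>x. h y x \<partial>\<phi> \<omega>) \<partial>M)) (\<gamma> y)" for y
    by (rule pv_integral_exp_mean[OF hm hb hs s\<gamma> ker])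
  then show "\<exists>l. has_pv_vertical_integral (inversion_kernel \<alpha> a t y) l (\<gamma> y)" by blast
  define m where "m \<omega> = (\<integral>x. indicator ?S x * x \<partial>\<phi> \<omega>)" for \<omega>
  define q where "q \<omega> = (\<integral>x. indicator ?S x * x\<^sup>2 \<partial>\<phi> \<omega>)" for \<omega>
  have [measurable]: "m \<in> borel_measurable M" "q \<in> borel_measurable M"
    unfolding m_def q_def by (intro integral_\<phi>_measurable; measurable)+
  have ib: "\<bar>indicator ?S x * x\<bar> \<le> b'" "\<bar>indicator ?S x * x\<^sup>2\<bar> \<le> b'\<^sup>2" for x
    using b'[of x] b'0 by (cases "x \<in> ?S"; simp)+
  have i1: "integrable (\<phi> \<omega>) (\<lambda>x. indicator ?S x * x)" and i2: "integrable (\<phi> \<omega>) (\<lambda>x. indicator ?S x * x\<^sup>2)"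
    if "\<omega> \<in> space M" for \<omega>
    by (rule integrable_\<phi>_bounded[OF that _ ib(1)], measurable) (rule integrable_\<phi>_bounded[OF that _ ib(2)], measurable)
  have mb: "\<bar>m \<omega>\<bar> \<le> b'" and q0: "0 \<le> q \<omega>" if "\<omega> \<in> space M" for \<omega>
  proof -
    have "indicator ?S x * x \<le> b'" for x using ib(1)[of x] by (simp add: abs_le_iff)
    moreover have "(\<lambda>x. indicator ?S x * x) \<in> borel_measurable borel" by measurable
    ultimately show "\<bar>m \<omega>\<bar> \<le> b'"
      using integral_\<phi>_bounds[where h = "\<lambda>x. indicator ?S x * x" and B = b' and s = b', OF _ ib(1) _ that]
      unfolding m_def by (simp add: abs_le_iff)
    show "0 \<le> q \<omega>" unfolding q_def by (rule integral_nonneg_AE) simp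
  qed
  have hmq: "(\<integral>x. h y x \<partial>\<phi> \<omega>) = y * (sqrt t * m \<omega>) - t * q \<omega>" if "\<omega> \<in> space M" for \<omega> y
  proof -
    have "(\<integral>x. h y x \<partial>\<phi> \<omega>) = (\<integral>x. y * sqrt t * (indicator ?S x * x) - t * (indicator ?S x * x\<^sup>2) \<partial>\<phi> \<omega>)"
      by (rule Bochner_Integration.integral_cong) (auto simp: h_def algebra_simps)
    also have "\<dots> = (\<integral>x. y * sqrt t * (indicator ?S x * x) \<partial>\<phi> \<omega>) - (\<integral>x. t * (indicator ?S x * x\<^sup>2) \<partial>\<phi> \<omega>)"
      by (intro Bochner_Integration.integral_diff integrable_mult_right i1 i2 that)
    also have "\<dots> = y * sqrt t * m \<omega> - t * q \<omega>"
      by (simp only: integral_mult_right_zero m_def q_def)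
    finally show ?thesis by (simp add: mult.assoc)
  qed
  define f where "f \<omega> y = exp (- y\<^sup>2 / 4) * exp (y * (sqrt t * m \<omega>) - t * q \<omega>)" for \<omega> y
  have [measurable]: "case_prod f \<in> borel_measurable (M \<Otimes>\<^sub>M lborel)" unfolding f_def case_prod_beta' by measurable
  have fint: "has_bochner_integral lborel (f \<omega>) (2 * sqrt pi * exp (- t * (q \<omega> - (m \<omega>)\<^sup>2)))" for \<omega>
    using gaussian_linear_integral[of "sqrt t * m \<omega>" "t * q \<omega>"] t
    by (simp add: f_def[abs_def] power_mult_distrib algebra_simps)
  interpret P: pair_sigma_finite M lborel ..
  \<comment> \<open>The integrand is positive, so integrability on the product needs only the iterated integral.\<close>
  have fprod: "integrable (M \<Otimes>\<^sub>M lborel) (case_prod f)"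
  proof (rule P.Fubini_integrable)
    show "AE \<omega> in M. integrable lborel (\<lambda>y. case_prod f (\<omega>, y))" using fint by (auto simp: has_bochner_integral_iff)
    have "norm (f \<omega> y) = f \<omega> y" for \<omega> y by (simp add: f_def)
    then have eq: "(\<integral>y. norm (case_prod f (\<omega>, y)) \<partial>lborel) = 2 * sqrt pi * exp (- t * (q \<omega> - (m \<omega>)\<^sup>2))" for \<omega>
      using fint[of \<omega>] by (simp add: has_bochner_integral_iff)
    show "integrable M (\<lambda>\<omega>. \<integral>y. norm (case_prod f (\<omega>, y)) \<partial>lborel)"
      unfolding eq
    proof (rule integrable_const_bound)
      show "AE \<omega> in M. norm (2 * sqrt pi * exp (- t * (q \<omega> - (m \<omega>)\<^sup>2))) \<le> 2 * sqrt pi * exp (t * b'\<^sup>2)"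
      proof (rule AE_I2)
        fix \<omega> assume \<omega>: "\<omega> \<in> space M"
        have "(m \<omega>)\<^sup>2 \<le> b'\<^sup>2" using mb[OF \<omega>] b'0 abs_le_square_iff[of "m \<omega>" b'] by simp
        then have "t * ((m \<omega>)\<^sup>2 - q \<omega>) \<le> t * b'\<^sup>2" using q0[OF \<omega>] t by (intro mult_left_mono) auto
        then show "norm (2 * sqrt pi * exp (- t * (q \<omega> - (m \<omega>)\<^sup>2))) \<le> 2 * sqrt pi * exp (t * b'\<^sup>2)"
          by (simp add: algebra_simps)
      qed
    qed measurable
  qed measurable
  have integrand: "gaussian_inversion_integrand \<alpha> a t \<gamma> y = ?L * of_real (\<integral>\<omega>. f \<omega> y \<partial>M)" for y
  proof -
    have "pv_vertical_integral (inversion_kernel \<alpha> a t y) (\<gamma> y) = ?L * of_real (\<integral>\<omega>. exp (\<integral>x. h y x \<partial>\<phi> \<omega>) \<partial>M)"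
      using pv[of y] unfolding pv_vertical_integral_def has_pv_vertical_integral_def by (intro tendsto_Lim) auto
    also have "(\<integral>\<omega>. exp (\<integral>x. h y x \<partial>\<phi> \<omega>) \<partial>M) = (\<integral>\<omega>. exp (y * (sqrt t * m \<omega>) - t * q \<omega>) \<partial>M)"
      by (rule Bochner_Integration.integral_cong) (auto simp: hmq)
    finally show ?thesis by (simp add: gaussian_inversion_integrand_def f_def mult_ac)
  qed
  have "integrable lborel (\<lambda>y. \<integral>\<omega>. f \<omega> y \<partial>M)" by (rule P.integrable_snd[OF fprod])
  then show "integrable lborel (gaussian_inversion_integrand \<alpha> a t \<gamma>)"
    unfolding integrand[abs_def] by (intro integrable_mult_right integrable_of_real)
  have "(\<integral>y. gaussian_inversion_integrand \<alpha> a t \<gamma> y \<partial>lborel) = ?L * of_real (\<integral>y. (\<integral>\<omega>. f \<omega> y \<partial>M) \<partial>lborel)"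
    by (simp only: integrand integral_mult_right_zero integral_complex_of_real)
  also have "(\<integral>y. (\<integral>\<omega>. f \<omega> y \<partial>M) \<partial>lborel) = (\<integral>\<omega>. (\<integral>y. f \<omega> y \<partial>lborel) \<partial>M)"
    by (rule P.Fubini_integral[OF fprod])
  also have "\<dots> = 2 * sqrt pi * (\<integral>\<omega>. exp (- t * (q \<omega> - (m \<omega>)\<^sup>2)) \<partial>M)"
    using fint by (simp add: has_bochner_integral_iff)
  also have "(\<integral>\<omega>. exp (- t * (q \<omega> - (m \<omega>)\<^sup>2)) \<partial>M) = variance_mgf M \<phi> t"
    unfolding variance_mgf_def
  proof (rule integral_cong_AE)
    show "AE \<omega> in M. exp (- t * (q \<omega> - (m \<omega>)\<^sup>2)) = exp (- t * random_variance \<phi> \<omega>)"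
      using ae\<phi> AE_space
    proof eventually_elim
      case (elim \<omega>)
      interpret \<phi>: prob_space "\<phi> \<omega>" by (rule \<phi>_prob[OF elim(2)])
      note cs = measurable_cong_sets[OF \<phi>_prob(2)[OF elim(2)] refl]
      have mean: "random_mean \<phi> \<omega> = m \<omega>"
        unfolding random_mean_def m_def
      proof (rule integral_cong_AE)
        show "AE x in \<phi> \<omega>. x = indicator ?S x * x" using elim(1) by eventually_elim simp
      qed (simp_all add: cs)
      have "random_variance \<phi> \<omega> = (\<integral>x. indicator ?S x * x\<^sup>2 - 2 * m \<omega> * (indicator ?S x * x) + (m \<omega>)\<^sup>2 \<partial>\<phi> \<omega>)"
        unfolding random_variance_def mean
      proof (rule integral_cong_AE)
        show "AE x in \<phi> \<omega>. (x - m \<omega>)\<^sup>2 = indicator ?S x * x\<^sup>2 - 2 * m \<omega> * (indicator ?S x * x) + (m \<omega>)\<^sup>2"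
          using elim(1) by eventually_elim (simp add: power2_diff)
      qed (simp_all add: cs)
      also have "\<dots> = q \<omega> - 2 * m \<omega> * m \<omega> + (m \<omega>)\<^sup>2"
        using i1[OF elim(2)] i2[OF elim(2)] \<phi>.prob_space unfolding m_def[of \<omega>] q_def
        by (subst Bochner_Integration.integral_add, simp, simp, subst Bochner_Integration.integral_diff) simp_all
      finally show ?case by (simp add: power2_eq_square)
    qed
  qed (use random_variance_measurable in measurable)
  finally have I: "(\<integral>y. gaussian_inversion_integrand \<alpha> a t \<gamma> y \<partial>lborel) = ?L * of_real (2 * sqrt pi * variance_mgf M \<phi> t)" .
  have "pi powr (3/2) = pi * sqrt pi"
    using powr_add[of pi 1 "1/2"] by (simp add: powr_half_sqrt)
  moreover have "0 < Gamma a" using a_pos by (rule Gamma_real_pos)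
  then have "complex_of_real (Gamma a) \<noteq> 0" by simp
  moreover have "complex_of_real (sqrt pi) \<noteq> 0" "complex_of_real pi \<noteq> 0" by auto
  ultimately show "complex_of_real (variance_mgf M \<phi> t) = complex_of_real (Gamma a) / (4 * complex_of_real (pi powr (3/2)) * \<i>) *
            (\<integral>y. gaussian_inversion_integrand \<alpha> a t \<gamma> y \<partial>lborel)"
    unfolding I by (simp add: field_simps)
qed

text \<open>
  A partition pulls back to a partition.
\<close>
lemma dirichlet_process_space_distr:
  assumes T [measurable]: "T \<in> borel_measurable borel"
  shows "dirichlet_process_space M (distr \<alpha> borel T) (\<lambda>\<omega>. distr (\<phi> \<omega>) borel T) a"
proof -
  have T\<alpha>: "T \<in> measurable \<alpha> borel" by measurable
  have ms: "measure (distr \<alpha> borel T) B = measure \<alpha> (T -` B)" if "B \<in> sets borel" for B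
    using that by (simp add: measure_distr[OF T\<alpha>])
  have msp: "measure (distr (\<phi> \<omega>) borel T) B = measure (\<phi> \<omega>) (T -` B)" if "\<omega> \<in> space M" "B \<in> sets borel" for B \<omega>
    using that \<phi>_prob[OF that(1)] by (subst measure_distr) (auto cong: measurable_cong_sets)
  have fin: "finite_measure (distr \<alpha> borel T)" by (rule \<alpha>.finite_measure_distr[OF T\<alpha>])
  have "dirichlet_process M (distr \<alpha> borel T) (\<lambda>\<omega>. distr (\<phi> \<omega>) borel T)"
    unfolding dirichlet_process_def
  proof (intro conjI allI impI)
    show "(\<lambda>\<omega>. distr (\<phi> \<omega>) borel T) \<in> M \<rightarrow>\<^sub>M prob_algebra borel"
      by (intro measurable_compose[OF \<phi>_measurable measurable_distr_prob_space] T)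
    fix n :: nat and C :: "nat \<Rightarrow> real set"
    assume C: "\<forall>i\<le>n. C i \<in> sets borel" "disjoint_family_on C {..n}" "(\<Union>i\<le>n. C i) = UNIV"
    \<comment> \<open>The clause for non-Borel sets matters beyond index \<open>n\<close>, where \<open>C\<close> is arbitrary.\<close>
    define D where "D i = (if C i \<in> sets borel then T -` C i else {})" for i
    have "\<forall>i\<le>n. D i \<in> sets borel" unfolding D_def using C(1) measurable_sets[OF T] by auto
    moreover have "disjoint_family_on D {..n}" using C(2) by (auto simp: D_def disjoint_family_on_def)
    moreover have "(\<Union>i\<le>n. D i) = UNIV" using C(1,3) by (fastforce simp: D_def)
    ultimately have "distr M (PiM {..<n} (\<lambda>_. borel)) (\<lambda>\<omega>. \<lambda>i\<in>{..<n}. measure (\<phi> \<omega>) (D i)) = dirichlet_distribution n (\<lambda>i. measure \<alpha> (D i))"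
      using DP unfolding dirichlet_process_def by blast
    moreover have "distr M (PiM {..<n} (\<lambda>_. borel)) (\<lambda>\<omega>. \<lambda>i\<in>{..<n}. measure (distr (\<phi> \<omega>) borel T) (C i))
        = distr M (PiM {..<n} (\<lambda>_. borel)) (\<lambda>\<omega>. \<lambda>i\<in>{..<n}. measure (\<phi> \<omega>) (D i))"
      using C(1) by (intro distr_cong refl restrict_ext) (auto simp: msp D_def)
    moreover have "(\<lambda>i. measure (distr \<alpha> borel T) (C i)) = (\<lambda>i. measure \<alpha> (D i))"
      by (auto simp: ms D_def fun_eq_iff measure_notin_sets)
    ultimately show "distr M (PiM {..<n} (\<lambda>_. borel)) (\<lambda>\<omega>. \<lambda>i\<in>{..<n}. measure (distr (\<phi> \<omega>) borel T) (C i))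
        = dirichlet_distribution n (\<lambda>i. measure (distr \<alpha> borel T) (C i))" by simp
  qed
  moreover have "a = measure (distr \<alpha> borel T) UNIV" by (simp add: ms a_eq)
  ultimately show ?thesis
    using fin a_pos by (auto simp: dirichlet_process_space_def dirichlet_process_space_axioms_def prob_space_axioms)
qed

end

section \<open>Truncation\<close>

definition clamp_at :: "nat \<Rightarrow> real \<Rightarrow> real" where
  "clamp_at k x = max (- real k) (min (real k) x)"

lemma clamp_at_measurable [measurable]: "clamp_at k \<in> borel_measurable borel"
  unfolding clamp_at_def[abs_def] by measurable

lemma abs_clamp_at_le: "\<bar>clamp_at k x\<bar> \<le> \<bar>x\<bar>" "\<bar>clamp_at k x\<bar> \<le> real k"
  by (auto simp: clamp_at_def)

lemma clamp_at_tendsto: "(\<lambda>k. clamp_at k x) \<longlonglongrightarrow> x"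
proof (rule tendsto_eventually)
  show "\<forall>\<^sub>F k in sequentially. clamp_at k x = x"
    using eventually_ge_at_top[of "nat \<lceil>\<bar>x\<bar>\<rceil>"]
  proof eventually_elim
    case (elim k)
    then have "\<bar>x\<bar> \<le> real k" by linarith
    then show ?case by (auto simp: clamp_at_def)
  qed
qed

lemma truncated_measure_eq_distr:
  assumes "sets \<alpha> = sets borel" and k: "1 \<le> k"
  shows "truncated_measure \<alpha> k = distr \<alpha> borel (clamp_at k)"
proof (rule measure_eqI)
  have T: "clamp_at k \<in> measurable \<alpha> borel" using assms(1) by (simp cong: measurable_cong_sets)
  have sp: "space \<alpha> = UNIV" using sets_eq_imp_space_eq[OF assms(1)] by simp
  fix B assume "B \<in> sets (truncated_measure \<alpha> k)"
  then have B: "B \<in> sets borel" by simp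
  let ?P = "clamp_at k -` B"
  let ?l = "{..- real k}" and ?i = "{- real k<..<real k}" and ?u = "{real k..}"
  have P: "?P \<in> sets \<alpha>" using measurable_sets[OF T B] sp by simp
  have m: "?P \<inter> ?l \<in> sets \<alpha>" "?P \<inter> ?i \<in> sets \<alpha>" "?P \<inter> ?u \<in> sets \<alpha>" using P assms(1) by auto
  have cl: "clamp_at k x = - real k" if "x \<in> ?l" for x using that by (auto simp: clamp_at_def)
  have cu: "clamp_at k x = real k" if "x \<in> ?u" for x using that by (auto simp: clamp_at_def)
  have ci: "clamp_at k x = x" if "x \<in> ?i" for x using that by (auto simp: clamp_at_def)
  have parts: "?P \<inter> ?l = (if - real k \<in> B then ?l else {})" "?P \<inter> ?i = B \<inter> ?i" "?P \<inter> ?u = (if real k \<in> B then ?u else {})"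
    using cl cu ci by auto
  have "emeasure (distr \<alpha> borel (clamp_at k)) B = emeasure \<alpha> ?P"
    using B sp by (simp add: emeasure_distr[OF T])
  also have "?P = (?P \<inter> ?l \<union> ?P \<inter> ?i) \<union> ?P \<inter> ?u" by (auto simp: not_less)
  also have "emeasure \<alpha> \<dots> = emeasure \<alpha> (?P \<inter> ?l \<union> ?P \<inter> ?i) + emeasure \<alpha> (?P \<inter> ?u)"
    using m k by (intro plus_emeasure[symmetric]) auto
  also have "emeasure \<alpha> (?P \<inter> ?l \<union> ?P \<inter> ?i) = emeasure \<alpha> (?P \<inter> ?l) + emeasure \<alpha> (?P \<inter> ?i)"
    using m by (intro plus_emeasure[symmetric]) auto
  finally show "emeasure (truncated_measure \<alpha> k) B = emeasure (distr \<alpha> borel (clamp_at k)) B"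
    unfolding emeasure_truncated_measure[OF assms(1) B] parts using B by (simp add: indicator_def)
qed simp

lemma bounded_support_distr_clamp:
  assumes "sets \<alpha> = sets borel"
  shows "bounded (measure_support (distr \<alpha> borel (clamp_at k)))"
proof -
  have T: "clamp_at k \<in> measurable \<alpha> borel" using assms by (simp cong: measurable_cong_sets)
  have sp: "space \<alpha> = UNIV" using sets_eq_imp_space_eq[OF assms] by simp
  let ?U = "- {- real k..real k}"
  have "clamp_at k x \<in> {- real k..real k}" for x by (auto simp: clamp_at_def)
  then have "clamp_at k -` ?U = {}" by blast
  then have "emeasure (distr \<alpha> borel (clamp_at k)) ?U = 0"
    using sp by (simp add: emeasure_distr[OF T])
  moreover have "open ?U" by (intro open_Compl closed_atLeastAtMost)
  ultimately have "measure_support (distr \<alpha> borel (clamp_at k)) \<subseteq> {- real k..real k}"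
    by (auto simp: measure_support_def)
  then show ?thesis by (rule bounded_subset[OF bounded_closed_interval])
qed

context dirichlet_process_space begin

lemma AE_integrable_square:
  assumes "integrable \<alpha> (\<lambda>x. ln (1 + \<bar>x\<bar>))"
  shows "AE \<omega> in M. integrable (\<phi> \<omega>) (\<lambda>x. x\<^sup>2)"
proof (rule AE_integrable_of_log_integrable)
  show "integrable \<alpha> (\<lambda>x. ln (1 + x\<^sup>2))"
  proof (rule Bochner_Integration.integrable_bound)
    show "integrable \<alpha> (\<lambda>x. 2 * ln (1 + \<bar>x\<bar>))" using assms by simp
    show "AE x in \<alpha>. norm (ln (1 + x\<^sup>2)) \<le> norm (2 * ln (1 + \<bar>x\<bar>))"
    proof (rule AE_I2)
      fix x :: real
      have "\<bar>ln (1 + x\<^sup>2)\<bar> \<le> ln (1 + (2 * \<bar>x\<bar> + x\<^sup>2))" by (rule abs_ln_one_plus_mono) auto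
      also have "1 + (2 * \<bar>x\<bar> + x\<^sup>2) = (1 + \<bar>x\<bar>) ^ 2" by (simp add: power2_sum)
      also have "ln ((1 + \<bar>x\<bar>) ^ 2) = 2 * ln (1 + \<bar>x\<bar>)" by (subst ln_realpow) auto
      finally show "norm (ln (1 + x\<^sup>2)) \<le> norm (2 * ln (1 + \<bar>x\<bar>))" by simp
    qed
  qed simp
qed auto

text \<open>
  Finiteness of the second moment provides the dominating function; without it the Bochner integrals
  defining mean and variance would silently be 0.
\<close>
lemma random_variance_clamp_tendsto:
  assumes \<omega>: "\<omega> \<in> space M" and int: "integrable (\<phi> \<omega>) (\<lambda>x. x\<^sup>2)"
  shows "(\<lambda>k. random_variance (\<lambda>\<omega>. distr (\<phi> \<omega>) borel (clamp_at k)) \<omega>) \<longlonglongrightarrow> random_variance \<phi> \<omega>"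
proof -
  interpret \<phi>: prob_space "\<phi> \<omega>" by (rule \<phi>_prob[OF \<omega>])
  note cs = measurable_cong_sets[OF \<phi>_prob(2)[OF \<omega>] refl]
  have T: "clamp_at k \<in> measurable (\<phi> \<omega>) borel" for k by (simp add: cs)
  have int1: "integrable (\<phi> \<omega>) (\<lambda>x. \<bar>x\<bar>)"
  proof (rule Bochner_Integration.integrable_bound)
    show "integrable (\<phi> \<omega>) (\<lambda>x. 1 + x\<^sup>2)" using int by simp
    show "AE x in \<phi> \<omega>. norm \<bar>x\<bar> \<le> norm (1 + x\<^sup>2)"
    proof (rule AE_I2)
      fix x :: real
      have "0 \<le> (\<bar>x\<bar> - 1)\<^sup>2" by simp
      then have "2 * \<bar>x\<bar> \<le> 1 + x\<^sup>2" by (simp add: power2_diff)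
      then show "norm \<bar>x\<bar> \<le> norm (1 + x\<^sup>2)" by simp
    qed
  qed (simp add: cs)
  define \<mu> where "\<mu> k = (\<integral>x. clamp_at k x \<partial>\<phi> \<omega>)" for k
  have mean: "\<mu> \<longlonglongrightarrow> random_mean \<phi> \<omega>"
    unfolding \<mu>_def random_mean_def
    by (rule integral_dominated_convergence[where w = "\<lambda>x. \<bar>x\<bar>"])
      (auto simp: cs clamp_at_tendsto abs_clamp_at_le int1)
  from convergent_imp_Bseq[OF convergentI[OF this]] obtain C where C: "\<And>k. \<bar>\<mu> k\<bar> \<le> C"
    by (auto simp: Bseq_def)
  have "(\<lambda>k. \<integral>x. (clamp_at k x - \<mu> k)\<^sup>2 \<partial>\<phi> \<omega>) \<longlonglongrightarrow> random_variance \<phi> \<omega>"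
    unfolding random_variance_def
  proof (rule integral_dominated_convergence[where w = "\<lambda>x. 2 * x\<^sup>2 + 2 * C\<^sup>2"])
    show "integrable (\<phi> \<omega>) (\<lambda>x. 2 * x\<^sup>2 + 2 * C\<^sup>2)" using int by simp
    show "AE x in \<phi> \<omega>. (\<lambda>k. (clamp_at k x - \<mu> k)\<^sup>2) \<longlonglongrightarrow> (x - random_mean \<phi> \<omega>)\<^sup>2"
      by (intro AE_I2 tendsto_intros clamp_at_tendsto mean)
    show "AE x in \<phi> \<omega>. norm ((clamp_at k x - \<mu> k)\<^sup>2) \<le> 2 * x\<^sup>2 + 2 * C\<^sup>2" for k
    proof (rule AE_I2)
      fix x :: real
      have "0 \<le> (clamp_at k x + \<mu> k)\<^sup>2" by simp
      then have "(clamp_at k x - \<mu> k)\<^sup>2 \<le> 2 * (clamp_at k x)\<^sup>2 + 2 * (\<mu> k)\<^sup>2"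
        by (simp add: power2_diff power2_sum)
      moreover have "(clamp_at k x)\<^sup>2 \<le> x\<^sup>2" using abs_clamp_at_le(1)[of k x] by (simp add: abs_le_square_iff)
      moreover have "(\<mu> k)\<^sup>2 \<le> C\<^sup>2" using C[of k] by (subst abs_le_square_iff[symmetric]) linarith
      ultimately show "norm ((clamp_at k x - \<mu> k)\<^sup>2) \<le> 2 * x\<^sup>2 + 2 * C\<^sup>2" by simp
    qed
  qed (simp_all add: cs)
  moreover have "random_variance (\<lambda>\<omega>. distr (\<phi> \<omega>) borel (clamp_at k)) \<omega> = (\<integral>x. (clamp_at k x - \<mu> k)\<^sup>2 \<partial>\<phi> \<omega>)" for k
    unfolding random_variance_def random_mean_def \<mu>_def by (simp add: integral_distr[OF T])
  ultimately show ?thesis by simp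
qed

lemma variance_mgf_clamp_tendsto:
  assumes log: "integrable \<alpha> (\<lambda>x. ln (1 + \<bar>x\<bar>))" and t: "0 \<le> t"
  shows "(\<lambda>k. variance_mgf M (\<lambda>\<omega>. distr (\<phi> \<omega>) borel (clamp_at k)) t) \<longlonglongrightarrow> variance_mgf M \<phi> t"
  unfolding variance_mgf_def
proof (rule integral_dominated_convergence[where w = "\<lambda>_. 1"])
  show "(\<lambda>\<omega>. exp (- t * random_variance \<phi> \<omega>)) \<in> borel_measurable M"
    using random_variance_measurable by measurable
  fix k
  interpret K: dirichlet_process_space M "distr \<alpha> borel (clamp_at k)" "\<lambda>\<omega>. distr (\<phi> \<omega>) borel (clamp_at k)" a
    by (rule dirichlet_process_space_distr) simp
  show "(\<lambda>\<omega>. exp (- t * random_variance (\<lambda>\<omega>. distr (\<phi> \<omega>) borel (clamp_at k)) \<omega>)) \<in> borel_measurable M"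
    using K.random_variance_measurable by measurable
  show "AE \<omega> in M. norm (exp (- t * random_variance (\<lambda>\<omega>. distr (\<phi> \<omega>) borel (clamp_at k)) \<omega>)) \<le> 1"
    using t K.random_variance_nonneg by simp
next
  show "AE \<omega> in M. (\<lambda>k. exp (- t * random_variance (\<lambda>\<omega>. distr (\<phi> \<omega>) borel (clamp_at k)) \<omega>)) \<longlonglongrightarrow> exp (- t * random_variance \<phi> \<omega>)"
    using AE_integrable_square[OF log] AE_space
    by eventually_elim (intro tendsto_intros random_variance_clamp_tendsto)
qed simp

text \<open>
  The truncated measures have bounded support and belong to the clamped processes, so for each \<open>k\<close>
  the Gaussian integral is a constant multiple of a moment generating function.  The convergence of
  the latter carries over because the constant does not vanish.
\<close>
lemma truncated_inversion:
  assumes log: "integrable \<alpha> (\<lambda>x. ln (1 + \<bar>x\<bar>))" and t: "0 \<le> t"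
    and adm: "\<And>k y. 1 \<le> k \<Longrightarrow> admissible_abscissa (truncated_measure \<alpha> k) t y (\<gamma> k y)"
  defines "I \<equiv> \<lambda>k. \<integral>y. gaussian_inversion_integrand (truncated_measure \<alpha> k) a t (\<gamma> k) y \<partial>lborel"
  shows "1 \<le> k \<Longrightarrow> \<exists>l. has_pv_vertical_integral (inversion_kernel (truncated_measure \<alpha> k) a t y) l (\<gamma> k y)"
    and "1 \<le> k \<Longrightarrow> integrable lborel (gaussian_inversion_integrand (truncated_measure \<alpha> k) a t (\<gamma> k))"
    and "convergent I"
    and "complex_of_real (variance_mgf M \<phi> t) = complex_of_real (Gamma a) / (4 * complex_of_real (pi powr (3/2)) * \<i>) * lim I"
proof -
  let ?\<phi> = "\<lambda>k \<omega>. distr (\<phi> \<omega>) borel (clamp_at k)"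
  let ?c = "complex_of_real (Gamma a) / (4 * complex_of_real (pi powr (3/2)) * \<i>)"
  have tr: "truncated_measure \<alpha> k = distr \<alpha> borel (clamp_at k)" if "1 \<le> k" for k
    by (rule truncated_measure_eq_distr[OF sets_\<alpha> that])
  have inv: "\<exists>l. has_pv_vertical_integral (inversion_kernel (truncated_measure \<alpha> k) a t y) l (\<gamma> k y)"
     "integrable lborel (gaussian_inversion_integrand (truncated_measure \<alpha> k) a t (\<gamma> k))"
     "complex_of_real (variance_mgf M (?\<phi> k) t) = ?c * I k" if k: "1 \<le> k" for k y
  proof -
    interpret K: dirichlet_process_space M "distr \<alpha> borel (clamp_at k)" "?\<phi> k" a
      by (rule dirichlet_process_space_distr) simp
    note * = K.bounded_support_inversion[OF bounded_support_distr_clamp[OF sets_\<alpha>] t adm[OF k, unfolded tr[OF k]]]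
    show "\<exists>l. has_pv_vertical_integral (inversion_kernel (truncated_measure \<alpha> k) a t y) l (\<gamma> k y)"
     "integrable lborel (gaussian_inversion_integrand (truncated_measure \<alpha> k) a t (\<gamma> k))"
     "complex_of_real (variance_mgf M (?\<phi> k) t) = ?c * I k"
      unfolding I_def tr[OF k] by (rule *)+
  qed
  show "1 \<le> k \<Longrightarrow> \<exists>l. has_pv_vertical_integral (inversion_kernel (truncated_measure \<alpha> k) a t y) l (\<gamma> k y)"
    "1 \<le> k \<Longrightarrow> integrable lborel (gaussian_inversion_integrand (truncated_measure \<alpha> k) a t (\<gamma> k))"
    by (rule inv; assumption)+
  have c0: "?c \<noteq> 0" using Gamma_real_pos[OF a_pos] by simp
  have "(\<lambda>k. complex_of_real (variance_mgf M (?\<phi> k) t) / ?c) \<longlonglongrightarrow> complex_of_real (variance_mgf M \<phi> t) / ?c"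
    using c0 by (intro tendsto_intros variance_mgf_clamp_tendsto log t)
  moreover have "\<forall>\<^sub>F k in sequentially. complex_of_real (variance_mgf M (?\<phi> k) t) / ?c = I k"
    using eventually_ge_at_top[of 1]
  proof eventually_elim
    case (elim k)
    show ?case unfolding inv(3)[OF elim] using c0 by (rule nonzero_mult_div_cancel_left)
  qed
  ultimately have lim: "I \<longlonglongrightarrow> complex_of_real (variance_mgf M \<phi> t) / ?c"
    by (rule Lim_transform_eventually)
  then show "convergent I" by (rule convergentI)
  show "complex_of_real (variance_mgf M \<phi> t) = ?c * lim I"
    unfolding limI[OF lim] times_divide_eq_right using c0 by (rule nonzero_mult_div_cancel_left[symmetric])
qed

end

theorem mainTheorem13:
  fixes M :: "'w measure" and \<alpha> :: "real measure" and \<phi> :: "'w \<Rightarrow> real measure" and a :: real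
  assumes "prob_space M"
    and "finite_measure \<alpha>" and "sets \<alpha> = sets borel"
    and "a = measure \<alpha> UNIV" and "a > 0"
    and "integrable \<alpha> (\<lambda>x. ln (1 + \<bar>x\<bar>))"
    and "dirichlet_process M \<alpha> \<phi>"
  shows "(bounded (measure_support \<alpha>) \<longrightarrow>
      (\<forall>t\<ge>0. \<forall>\<gamma> :: real \<Rightarrow> real.
        (\<forall>y. admissible_abscissa \<alpha> t y (\<gamma> y)) \<longrightarrow>
          (\<forall>y. \<exists>l. has_pv_vertical_integral (inversion_kernel \<alpha> a t y) l (\<gamma> y)) \<and>
          integrable lborel (gaussian_inversion_integrand \<alpha> a t \<gamma>) \<and>
          complex_of_real (variance_mgf M \<phi> t) =
            complex_of_real (Gamma a) / (4 * complex_of_real (pi powr (3/2)) * \<i>) *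
            (\<integral>y. gaussian_inversion_integrand \<alpha> a t \<gamma> y \<partial>lborel))) \<and>
    (\<forall>t\<ge>0. \<forall>\<gamma> :: nat \<Rightarrow> real \<Rightarrow> real.
      (\<forall>k\<ge>1. \<forall>y. admissible_abscissa (truncated_measure \<alpha> k) t y (\<gamma> k y)) \<longrightarrow>
        (\<forall>k\<ge>1. \<forall>y. \<exists>l.
          has_pv_vertical_integral (inversion_kernel (truncated_measure \<alpha> k) a t y) l (\<gamma> k y)) \<and>
        (\<forall>k\<ge>1.
          integrable lborel (gaussian_inversion_integrand (truncated_measure \<alpha> k) a t (\<gamma> k))) \<and>
        convergent
          (\<lambda>k. \<integral>y. gaussian_inversion_integrand (truncated_measure \<alpha> k) a t (\<gamma> k) y \<partial>lborel) \<and>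
        complex_of_real (variance_mgf M \<phi> t) =
          complex_of_real (Gamma a) / (4 * complex_of_real (pi powr (3/2)) * \<i>) *
          lim (\<lambda>k. \<integral>y. gaussian_inversion_integrand (truncated_measure \<alpha> k) a t (\<gamma> k) y \<partial>lborel))"
proof -
  interpret dirichlet_process_space M \<alpha> \<phi> a
    using assms by (simp add: dirichlet_process_space_def dirichlet_process_space_axioms_def)
  show ?thesis
  proof (intro conjI[of "_ \<longrightarrow> _"] impI allI)
    fix t :: real and \<gamma> :: "real \<Rightarrow> real"
    assume "bounded (measure_support \<alpha>)" "0 \<le> t" and adm: "\<forall>y. admissible_abscissa \<alpha> t y (\<gamma> y)"
    note inv = bounded_support_inversion[OF this(1,2) adm[rule_format]]
    show "(\<forall>y. \<exists>l. has_pv_vertical_integral (inversion_kernel \<alpha> a t y) l (\<gamma> y)) \<and>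
          integrable lborel (gaussian_inversion_integrand \<alpha> a t \<gamma>) \<and>
          complex_of_real (variance_mgf M \<phi> t) =
            complex_of_real (Gamma a) / (4 * complex_of_real (pi powr (3/2)) * \<i>) *
            (\<integral>y. gaussian_inversion_integrand \<alpha> a t \<gamma> y \<partial>lborel)"
      by (intro conjI allI inv)
  next
    fix t :: real and \<gamma> :: "nat \<Rightarrow> real \<Rightarrow> real"
    assume "0 \<le> t" and adm: "\<forall>k\<ge>1. \<forall>y. admissible_abscissa (truncated_measure \<alpha> k) t y (\<gamma> k y)"
    note inv = truncated_inversion[OF assms(6) this(1) adm[rule_format]]
    show "(\<forall>k\<ge>1. \<forall>y. \<exists>l.
          has_pv_vertical_integral (inversion_kernel (truncated_measure \<alpha> k) a t y) l (\<gamma> k y)) \<and>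
        (\<forall>k\<ge>1.
          integrable lborel (gaussian_inversion_integrand (truncated_measure \<alpha> k) a t (\<gamma> k))) \<and>
        convergent
          (\<lambda>k. \<integral>y. gaussian_inversion_integrand (truncated_measure \<alpha> k) a t (\<gamma> k) y \<partial>lborel) \<and>
        complex_of_real (variance_mgf M \<phi> t) =
          complex_of_real (Gamma a) / (4 * complex_of_real (pi powr (3/2)) * \<i>) *
          lim (\<lambda>k. \<integral>y. gaussian_inversion_integrand (truncated_measure \<alpha> k) a t (\<gamma> k) y \<partial>lborel)"
      by (intro conjI allI impI inv)
  qed
qed

end
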